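(* Let $\kappa:=\operatorname{arccosh}(3/2)$, let $p$ be a positive integer and put $\xi:=\kappa+2p\pi i$. Let $J_n(E;q)$ denote the $n$-dimensional colored Jones polynomial of the figure-eight knot $E$ (as in the context). Then, as $N\to\infty$, \[ J_N\left(E;e^{\xi/N}\right) \underset{N\to\infty}{\sim} J_p\left(E;e^{4\pi^2N/\xi}\right) \frac{\Gamma(1/3)e^{\pi i/6}}{3^{1/6}} \left(\frac{N}{\xi}\right)^{2/3}\exp\left(\frac{S_{\kappa}(E)}{\xi}N\right), \] where $S_{\kappa}(E):=2\kappa\pi i$, and where $\xi^{1/3}:=|\xi|^{1/3}e^{i\arctan(2p\pi/\kappa)/3}$, so that $(N/\xi)^{2/3}:=N^{2/3}/(\xi^{1/3})^2$.
   Context: For a positive integer $n$ and $q\in\mathbb{C}\setminus\{0\}$, the colored Jones polynomial of the figure-eight knot $E$ (normalized so that the unknot has value $1$, and for $n=2$ satisfying $qJ_2(L_+)-q^{-1}J_2(L_-)=(q^{1/2}-q^{-1/2})J_2(L_0)$) is given by \[ J_n(E;q)=\sum_{k=0}^{n-1}q^{-kn}\prod_{l=1}^{k}\left(1-q^{n-l}\right)\left(1-q^{n+l}\right). \] $F(N)\underset{N\to\infty}{\sim}G(N)$ means $\lim_{N\to\infty}F(N)/G(N)=1$. $\Gamma$ is the gamma function. *)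

theory Defs
  imports "HOL-Analysis.Analysis"
begin

definition jones_fig8 :: "nat \<Rightarrow> complex \<Rightarrow> complex" where
  "jones_fig8 n q = (\<Sum>k<n. inverse q ^ (k * n) *
      (\<Prod>l=1..k. (1 - q ^ (n - l)) * (1 - q ^ (n + l))))"

end

theory Submission
  imports Defs "HOL-Complex_Analysis.Complex_Analysis" "HOL-Real_Asymp.Real_Asymp"
begin

text \<open>
  Write \<open>\<omega> = \<xi> / N\<close>. The summands of \<open>J_N\<close> are the values at the multiples of \<open>\<omega>\<close> of a holomorphic function
  \<open>F\<close> built from quantum dilogarithms, and quasi-periodicity under \<open>2 \<pi> \<i>\<close> turns \<open>J_N\<close> into
  \<open>exp (2 \<pi> \<i> p \<kappa> N / \<xi>)\<close> times the sum of \<open>F\<close> over \<open>\<kappa> - j \<omega>\<close>, \<open>1 \<le> j \<le> N\<close>. On the other side,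
  \<open>J_p(q)\<close> is asymptotic to \<open>q ^ (p (p - 1))\<close> at infinity, and \<open>q = exp (4 \<pi>\<^sup>2 N / \<xi>)\<close> tends to infinity, so
  that the factor \<open>J_p(q) exp (S N / \<xi>)\<close> matches exactly this prefactor. It remains to show that the sum is
  asymptotic to \<open>\<Gamma>(1/3) e\<^bsup>\<pi> \<i> / 6\<^esup> 3\<^bsup>- 1 / 6\<^esup> (N / \<xi>)\<^bsup>2 / 3\<^esup>\<close>.

  The terms with \<open>2 p j > N\<close> are exponentially small. The others are the residues of \<open>F\<close> divided by
  the product of the \<open>1 - q\<^bsup>- n\<^esup> exp (2 \<pi> \<i> (t - \<kappa>) / \<omega>)\<close> for \<open>0 \<le> n \<le> p\<close> in the rectangle
  \<open>0 < Re t < \<kappa>\<close>, \<open>- \<pi> < Im t < 0\<close>. Taking \<open>p + 1\<close> factors instead of the single kernel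
  \<open>1 - exp (2 \<pi> \<i> (t - \<kappa>) / \<omega>)\<close> keeps the quotient small up to the right edge, because there it continues
  across \<open>Re t = \<kappa>\<close> as a quotient of a theta function by its own factors, which the maximum principle
  controls. So only the neighbourhood of the corner \<open>t = 0\<close> contributes, along the two
  edges meeting there. On them \<open>F\<close> behaves like \<open>exp (- N t ^ 3 / (3 \<xi>))\<close>, and both integrals are multiples of
  \<open>\<Gamma>(1/3)\<close>.
\<close>

section \<open>Dilogarithm and quantum dilogarithm\<close>

text \<open>Every exponent is divided by xi, and 1/xi = (kappa - 2 pi p i)/|xi|^2, so the size of
  exp (N V / xi) is governed by kappa Re V + 2 pi p Im V. As V is real on the real edge and purely
  imaginary on the imaginary one, each of the two edges at the corner involves only one of these
  terms. On all other edges crude numerical bounds suffice (kappa is about 0.962), but they have to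
  hold for every p, so the term with weight 2 pi p must be negative there, or negligible for large
  N. Origin of the constant: an edge contributes Gamma(1/3)/(3 zeta), where zeta^3 is 1/(3 xi) on
  the real edge and i/(3 xi) on the imaginary one. The two roots differ by the factor e = exp (pi
  i/6), the direction of the imaginary edge brings in a factor i, and 1 + i/e = 1 + e^2 = sqrt 3 e.
  This explains the phase, and 3^(1/3) sqrt 3 / 3 = 3^(-1/6). The power N^(2/3) is N from 1/omega
  times the width N^(-1/3) of a cubic critical point.\<close>

definition dilog :: "complex \<Rightarrow> complex" where
  "dilog z = (\<Sum>n. z ^ Suc n / of_nat (Suc n) ^ 2)"

text \<open>
  For \<open>Re \<omega> > 0\<close> and \<open>|z| < 1\<close>, \<open>qexp \<omega> z\<close> is the infinite product of the factors \<open>1 - z exp (- n \<omega>)\<close>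
  over \<open>n \<ge> 0\<close>; \<open>qlog\<close> is minus its logarithm, expanded in powers of \<open>z\<close>.
\<close>

definition qlog :: "complex \<Rightarrow> complex \<Rightarrow> complex" where
  "qlog \<omega> z = (\<Sum>n. z ^ Suc n / (of_nat (Suc n) * (1 - exp (- (of_nat (Suc n) * \<omega>)))))"

definition qexp :: "complex \<Rightarrow> complex \<Rightarrow> complex" where
  "qexp \<omega> z = exp (- qlog \<omega> z)"

lemma norm_one_minus_exp_ge:
  assumes "Re \<omega> > 0"
  shows "norm (1 - exp (- (of_nat (Suc n) * \<omega>))) \<ge> 1 - exp (- Re \<omega>)"
proof -
  have "1 * Re \<omega> \<le> real (Suc n) * Re \<omega>"
    by (rule mult_right_mono) (use assms in auto)
  hence "norm (exp (- (of_nat (Suc n) * \<omega>))) \<le> exp (- Re \<omega>)"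
    by (simp del: of_nat_Suc)
  thus ?thesis
    using norm_triangle_ineq2[of 1 "exp (- (of_nat (Suc n) * \<omega>))"] unfolding norm_one by linarith
qed

lemma one_minus_exp_nz:
  assumes "Re \<omega> > 0"
  shows "1 - exp (- (of_nat (Suc n) * \<omega>)) \<noteq> 0"
proof -
  have "1 - exp (- Re \<omega>) > 0" using assms by simp
  thus ?thesis using norm_one_minus_exp_ge[OF assms, of n] by auto
qed

lemma summable_power_Suc: "norm (x :: 'a :: {real_normed_field, banach}) < 1 \<Longrightarrow> summable (\<lambda>n. x ^ Suc n)"
  using summable_geometric[of x] by (simp add: summable_mult)

lemma summable_geometric_bounded:
  fixes z :: complex
  assumes "norm z < 1" and "\<And>n. norm (c n) \<le> C"
  shows "summable (\<lambda>n. norm (z ^ Suc n * c n))" and "summable (\<lambda>n. z ^ Suc n * c n)"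
proof -
  have s: "summable (\<lambda>n. norm z ^ Suc n * C)"
    using summable_power_Suc[of "norm z"] assms(1) by (intro summable_mult2) auto
  have b: "norm (z ^ Suc n * c n) \<le> norm z ^ Suc n * C" for n
    unfolding norm_mult norm_power by (intro mult_left_mono assms) auto
  show "summable (\<lambda>n. norm (z ^ Suc n * c n))"
    by (rule summable_comparison_test_ev[OF _ s]) (use b in auto)
  show "summable (\<lambda>n. z ^ Suc n * c n)"
    by (rule summable_comparison_test_ev[OF _ s]) (use b in auto)
qed

lemma qlog_coeff_bound:
  assumes "Re \<omega> > 0"
  shows "norm (1 / (of_nat (Suc n) * (1 - exp (- (of_nat (Suc n) * \<omega>))))) \<le> 1 / (1 - exp (- Re \<omega>))"
proof -
  have p: "1 - exp (- Re \<omega>) > 0" using assms by simp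
  have "1 * (1 - exp (- Re \<omega>)) \<le> real (Suc n) * norm (1 - exp (- (of_nat (Suc n) * \<omega>)))"
    by (intro mult_mono norm_one_minus_exp_ge assms) (use p in auto)
  hence le: "1 - exp (- Re \<omega>) \<le> real (Suc n) * norm (1 - exp (- (of_nat (Suc n) * \<omega>)))" by simp
  show ?thesis unfolding norm_divide norm_mult norm_of_nat norm_one
    by (rule divide_left_mono[OF le]) (use p le in \<open>auto simp del: of_nat_Suc intro!: mult_pos_pos\<close>)
qed

lemma qlog_sums:
  assumes "Re \<omega> > 0" "norm z < 1"
  shows "(\<lambda>n. z ^ Suc n / (of_nat (Suc n) * (1 - exp (- (of_nat (Suc n) * \<omega>))))) sums qlog \<omega> z"
  using summable_geometric_bounded(2)[OF assms(2) qlog_coeff_bound[OF assms(1)]]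
  unfolding qlog_def by (simp add: summable_sums)

lemma summable_inverse_squares_Suc: "summable (\<lambda>n. 1 / real (Suc n) ^ 2)"
  using inverse_squares_sums by (simp add: sums_iff)

lemma suminf_inverse_squares_Suc: "(\<Sum>n. 1 / real (Suc n) ^ 2) = pi\<^sup>2 / 6"
  using inverse_squares_sums by (simp add: sums_iff)

lemma dilog_term_bound:
  fixes z :: complex
  assumes "norm z \<le> 1"
  shows "norm (z ^ Suc n / of_nat (Suc n) ^ 2) \<le> norm z * (1 / real (Suc n) ^ 2)"
proof -
  have "norm z ^ Suc n \<le> norm z ^ 1"
    by (rule power_decreasing) (use assms in auto)
  hence "norm z ^ Suc n / real (Suc n) ^ 2 \<le> norm z / real (Suc n) ^ 2"
    by (intro divide_right_mono) auto
  thus ?thesis unfolding norm_divide norm_power norm_of_nat by simp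
qed

lemma dilog_summable_norm:
  fixes z :: complex
  assumes "norm z \<le> 1"
  shows "summable (\<lambda>n. norm (z ^ Suc n / of_nat (Suc n) ^ 2))"
proof (rule summable_comparison_test_ev[OF _ summable_mult[OF summable_inverse_squares_Suc, of "norm z"]], rule always_eventually, rule allI)
  fix n show "norm (norm (z ^ Suc n / of_nat (Suc n) ^ 2)) \<le> norm z * (1 / real (Suc n) ^ 2)"
    using dilog_term_bound[OF assms, of n] by (simp only: real_norm_def abs_norm_cancel)
qed

lemma dilog_sums: "norm z \<le> 1 \<Longrightarrow> (\<lambda>n. z ^ Suc n / of_nat (Suc n) ^ 2) sums dilog z"
  unfolding dilog_def by (rule summable_sums[OF summable_norm_cancel[OF dilog_summable_norm]])

text \<open>One power of |z| can be pulled out of every term. Keeping it, instead of bounding by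
  pi^2/6 alone, makes the dilogarithms small enough in \<open>Psi_low\<close> and
  \<open>Phi_edges\<close>.\<close>

lemma norm_dilog_le:
  assumes "norm z \<le> 1"
  shows "norm (dilog z) \<le> norm z * (pi\<^sup>2 / 6)"
proof -
  have "norm (dilog z) \<le> (\<Sum>n. norm (z ^ Suc n / of_nat (Suc n) ^ 2))"
    unfolding dilog_def by (rule summable_norm[OF dilog_summable_norm[OF assms]])
  also have "\<dots> \<le> (\<Sum>n. norm z * (1 / real (Suc n) ^ 2))"
    by (rule suminf_le[OF dilog_term_bound[OF assms] dilog_summable_norm[OF assms]
        summable_mult[OF summable_inverse_squares_Suc]])
  also have "\<dots> = norm z * (pi\<^sup>2 / 6)"
    unfolding suminf_mult[OF summable_inverse_squares_Suc] suminf_inverse_squares_Suc ..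
  finally show ?thesis .
qed

text \<open>The closed disc matters: the value at -1 and the line Re t = kappa lie on its
  boundary.\<close>

lemma continuous_on_dilog: "continuous_on (cball 0 1) dilog"
proof -
  have "uniform_limit (cball 0 1) (\<lambda>n (z::complex). \<Sum>i<n. z ^ Suc i / of_nat (Suc i) ^ 2)
          (\<lambda>z. \<Sum>i. z ^ Suc i / of_nat (Suc i) ^ 2) sequentially"
  proof (rule Weierstrass_m_test[OF _ summable_inverse_squares_Suc])
    fix n and z :: complex assume "z \<in> cball 0 1"
    hence z: "norm z \<le> 1" by simp
    show "norm (z ^ Suc n / of_nat (Suc n) ^ 2) \<le> 1 / real (Suc n) ^ 2"
      using dilog_term_bound[OF z, of n] mult_right_mono[OF z, of "1 / real (Suc n) ^ 2"] by simp
  qed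
  thus ?thesis unfolding dilog_def[abs_def]
    by (intro uniform_limit_theorem[where F = sequentially]) (auto intro!: continuous_intros always_eventually simp del: of_nat_Suc power_Suc)
qed

lemma Ln_one_minus_sums:
  fixes z :: complex
  assumes "norm z < 1"
  shows "(\<lambda>n. z ^ Suc n / of_nat (Suc n)) sums (- Ln (1 - z))"
proof -
  have "(\<lambda>n. - ((-(-z)) ^ n) / of_nat n) sums Ln (1 + (-z))"
    by (rule Ln_series') (use assms in simp)
  hence "(\<lambda>n. - (z ^ n) / of_nat n) sums Ln (1 - z)" by simp
  hence "(\<lambda>n. - (z ^ Suc n) / of_nat (Suc n)) sums Ln (1 - z)"
    by (subst sums_Suc_iff) simp
  from sums_minus[OF this] show ?thesis by simp
qed

text \<open>With E = exp ((n+1) omega) the coefficients satisfy E/(1 - 1/E) = 1/(1 - 1/E) + E; the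
  extra terms sum to the logarithm.\<close>

lemma qlog_shift:
  assumes "Re \<omega> > 0" "norm (exp \<omega> * z) < 1"
  shows "qlog \<omega> (exp \<omega> * z) = qlog \<omega> z - Ln (1 - exp \<omega> * z)"
proof -
  have e1: "norm (exp \<omega>) > 1" using assms(1) by simp
  have z: "norm z < 1"
    using assms(2) e1 unfolding norm_mult
    by (smt (verit) mult_left_le_one_le norm_ge_zero mult_le_cancel_right1)
  have "(\<lambda>n. z ^ Suc n / (of_nat (Suc n) * (1 - exp (- (of_nat (Suc n) * \<omega>))))
          + (exp \<omega> * z) ^ Suc n / of_nat (Suc n)) sums (qlog \<omega> z + - Ln (1 - exp \<omega> * z))"
    by (intro sums_add qlog_sums Ln_one_minus_sums assms z)
  also have "(\<lambda>n. z ^ Suc n / (of_nat (Suc n) * (1 - exp (- (of_nat (Suc n) * \<omega>))))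
          + (exp \<omega> * z) ^ Suc n / of_nat (Suc n)) =
        (\<lambda>n. (exp \<omega> * z) ^ Suc n / (of_nat (Suc n) * (1 - exp (- (of_nat (Suc n) * \<omega>)))))"
  proof
    fix n
    define E where "E = exp (of_nat (Suc n) * \<omega>)"
    have [simp]: "E \<noteq> 0" by (simp add: E_def)
    have nz: "1 - 1 / E \<noteq> 0"
      using one_minus_exp_nz[OF assms(1), of n] unfolding E_def exp_minus inverse_eq_divide .
    hence nz': "E - 1 \<noteq> 0" by auto
    have p: "(exp \<omega> * z) ^ Suc n = E * z ^ Suc n"
      unfolding power_mult_distrib E_def by (simp add: exp_of_nat_mult [symmetric] del: of_nat_Suc power_Suc)
    have "exp (- (of_nat (Suc n) * \<omega>)) = 1 / E"
      unfolding E_def exp_minus inverse_eq_divide ..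
    thus "z ^ Suc n / (of_nat (Suc n) * (1 - exp (- (of_nat (Suc n) * \<omega>))))
          + (exp \<omega> * z) ^ Suc n / of_nat (Suc n)
        = (exp \<omega> * z) ^ Suc n / (of_nat (Suc n) * (1 - exp (- (of_nat (Suc n) * \<omega>))))"
      unfolding p using nz nz' by (simp add: divide_simps del: of_nat_Suc power_Suc) (auto simp: algebra_simps)
  qed
  finally show ?thesis
    using qlog_sums[OF assms] by (simp add: sums_iff del: of_nat_Suc power_Suc)
qed

lemma qexp_shift:
  assumes "Re \<omega> > 0" "norm (exp \<omega> * z) < 1"
  shows "qexp \<omega> (exp \<omega> * z) = (1 - exp \<omega> * z) * qexp \<omega> z"
proof -
  have "1 - exp \<omega> * z \<noteq> 0" using assms(2) by auto
  thus ?thesis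
    unfolding qexp_def qlog_shift[OF assms] by (simp add: exp_diff exp_add exp_minus field_simps)
qed

lemma qexp_nonzero [simp]: "qexp \<omega> z \<noteq> 0"
  by (simp add: qexp_def)

lemma holomorphic_qlog:
  assumes "Re \<omega> > 0"
  shows "qlog \<omega> holomorphic_on ball 0 1"
proof (rule power_series_holomorphic)
  fix w :: complex assume "w \<in> ball 0 1"
  hence w: "norm w < 1" by simp
  define a where "a n = (if n = 0 then 0 else 1 / (of_nat n * (1 - exp (- (of_nat n * \<omega>)))))" for n
  have "(\<lambda>n. a (Suc n) * w ^ Suc n) sums qlog \<omega> w"
    using qlog_sums[OF assms w] by (simp add: a_def del: of_nat_Suc power_Suc)
  hence "(\<lambda>n. a n * w ^ n) sums qlog \<omega> w"
    by (subst (asm) sums_Suc_iff) (simp add: a_def)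
  thus "(\<lambda>n. a n * (w - 0) ^ n) sums qlog \<omega> w" by simp
qed

lemma holomorphic_qexp: "Re \<omega> > 0 \<Longrightarrow> qexp \<omega> holomorphic_on ball 0 1"
  unfolding qexp_def[abs_def] by (intro holomorphic_intros holomorphic_qlog)

text \<open>
  The entire continuation of \<open>qexp \<omega>\<close>: finitely many factors are split off so that the
  argument of \<open>qexp\<close> lies in the unit disc.
\<close>

definition qpoch :: "complex \<Rightarrow> complex \<Rightarrow> complex" where
  "qpoch \<omega> z = (let L = (LEAST L. norm (z * exp (- (of_nat L * \<omega>))) < 1)
     in (\<Prod>l<L. 1 - z * exp (- (of_nat l * \<omega>))) * qexp \<omega> (z * exp (- (of_nat L * \<omega>))))"

text \<open>Every further factor that is split off is the one that \<open>qexp_shift\<close> gives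
  back. So all admissible numbers of factors yield the same value, and the \<open>LEAST\<close> in
  \<open>qpoch\<close> is only a way to pick one.\<close>

lemma qpoch_eq_aux:
  assumes "Re \<omega> > 0" "norm (z * exp (- (of_nat L * \<omega>))) < 1" "L \<le> L'"
  shows "(\<Prod>l<L'. 1 - z * exp (- (of_nat l * \<omega>))) * qexp \<omega> (z * exp (- (of_nat L' * \<omega>)))
       = (\<Prod>l<L. 1 - z * exp (- (of_nat l * \<omega>))) * qexp \<omega> (z * exp (- (of_nat L * \<omega>)))"
  using assms(3)
proof (induction L' rule: dec_induct)
  case (step m)
  have "exp \<omega> * exp (- (of_nat (Suc m) * \<omega>)) = exp (- (of_nat m * \<omega>))"
    by (simp add: exp_add[symmetric] algebra_simps)
  hence e: "exp \<omega> * (z * exp (- (of_nat (Suc m) * \<omega>))) = z * exp (- (of_nat m * \<omega>))"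
    by (simp only: mult.left_commute[of "exp \<omega>"])
  have "norm (z * exp (- (of_nat m * \<omega>))) \<le> norm (z * exp (- (of_nat L * \<omega>)))"
    using step(1) assms(1) unfolding norm_mult by (intro mult_left_mono) auto
  hence n: "norm (exp \<omega> * (z * exp (- (of_nat (Suc m) * \<omega>)))) < 1"
    unfolding e using assms(2) by simp
  show ?case
    using qexp_shift[OF assms(1) n] step.IH unfolding e by (simp add: mult.assoc)
qed simp

lemma ex_norm_lt_1:
  assumes "Re \<omega> > 0"
  shows "\<exists>L. \<forall>z. norm z \<le> R \<longrightarrow> norm (z * exp (- (of_nat L * \<omega>))) < 1"
proof -
  obtain L :: nat where L: "real L * Re \<omega> > \<bar>R\<bar>"
    using ex_less_of_nat_mult[OF assms] by blast
  have "norm (z * exp (- (of_nat L * \<omega>))) < 1" if "norm z \<le> R" for z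
  proof -
    have "norm (exp (of_nat L * \<omega>)) > norm z"
      using L exp_ge_add_one_self[of "real L * Re \<omega>"] that abs_ge_self[of R]
      unfolding norm_exp_eq_Re by (simp; linarith)
    thus ?thesis by (simp add: exp_minus norm_mult norm_inverse norm_divide field_simps)
  qed
  thus ?thesis by blast
qed

lemma qpoch_eq:
  assumes "Re \<omega> > 0" "norm (z * exp (- (of_nat L * \<omega>))) < 1"
  shows "qpoch \<omega> z = (\<Prod>l<L. 1 - z * exp (- (of_nat l * \<omega>))) * qexp \<omega> (z * exp (- (of_nat L * \<omega>)))"
  unfolding qpoch_def Let_def
proof (rule qpoch_eq_aux[symmetric, OF assms(1)])
  show "norm (z * exp (- (of_nat (LEAST L. norm (z * exp (- (of_nat L * \<omega>))) < 1) * \<omega>))) < 1"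
    by (rule LeastI[of "\<lambda>L. norm (z * exp (- (of_nat L * \<omega>))) < 1"]) (rule assms(2))
  show "(LEAST L. norm (z * exp (- (of_nat L * \<omega>))) < 1) \<le> L"
    by (rule Least_le) (rule assms(2))
qed

lemma qpoch_eq_qexp: "Re \<omega> > 0 \<Longrightarrow> norm z < 1 \<Longrightarrow> qpoch \<omega> z = qexp \<omega> z"
  using qpoch_eq[of \<omega> z 0] by simp

lemma qpoch_rec:
  assumes "Re \<omega> > 0"
  shows "qpoch \<omega> z = (1 - z) * qpoch \<omega> (z * exp (- \<omega>))"
proof -
  obtain L where "\<forall>w. norm w \<le> norm z \<longrightarrow> norm (w * exp (- (of_nat L * \<omega>))) < 1"
    using ex_norm_lt_1[OF assms, of "norm z"] by blast
  hence 1: "norm (z * exp (- (of_nat L * \<omega>))) < 1" by blast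
  have "exp (- \<omega>) * exp (- (of_nat l * \<omega>)) = exp (- (of_nat (Suc l) * \<omega>))" for l
    by (simp add: exp_add[symmetric] algebra_simps)
  hence m: "z * exp (- \<omega>) * exp (- (of_nat l * \<omega>)) = z * exp (- (of_nat (Suc l) * \<omega>))" for l
    by (simp only: mult.assoc)
  have "norm (z * exp (- (of_nat (Suc L) * \<omega>))) \<le> norm (z * exp (- (of_nat L * \<omega>)))"
    unfolding norm_mult by (intro mult_left_mono) (use assms in auto)
  hence 2: "norm (z * exp (- (of_nat (Suc L) * \<omega>))) < 1" using 1 by linarith
  have "qpoch \<omega> (z * exp (- \<omega>)) = (\<Prod>l<L. 1 - z * exp (- (of_nat (Suc l) * \<omega>))) * qexp \<omega> (z * exp (- (of_nat (Suc L) * \<omega>)))"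
    using qpoch_eq[OF assms, of "z * exp (-\<omega>)" L] 2 unfolding m by blast
  moreover have "qpoch \<omega> z = (\<Prod>l<Suc L. 1 - z * exp (- (of_nat l * \<omega>))) * qexp \<omega> (z * exp (- (of_nat (Suc L) * \<omega>)))"
    by (rule qpoch_eq[OF assms 2])
  ultimately show ?thesis unfolding prod.lessThan_Suc_shift by simp
qed

text \<open>The number of factors picked by \<open>qpoch\<close> jumps with z, but on a ball a
  single L serves all points.\<close>

lemma holomorphic_qpoch:
  assumes "Re \<omega> > 0" shows "qpoch \<omega> holomorphic_on A"
proof -
  have "qpoch \<omega> holomorphic_on ball 0 R" for R
  proof -
    obtain L where L: "\<forall>z. norm z \<le> R \<longrightarrow> norm (z * exp (- (of_nat L * \<omega>))) < 1"
      using ex_norm_lt_1[OF assms, of R] by blast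
    have "(qexp \<omega> \<circ> (\<lambda>z. z * exp (- (of_nat L * \<omega>)))) holomorphic_on ball 0 R"
      by (rule holomorphic_on_compose_gen[OF _ holomorphic_qexp[OF assms]])
         (use L in \<open>auto intro!: holomorphic_intros\<close>)
    hence "(\<lambda>z. (\<Prod>l<L. 1 - z * exp (- (of_nat l * \<omega>))) * qexp \<omega> (z * exp (- (of_nat L * \<omega>)))) holomorphic_on ball 0 R"
      by (intro holomorphic_intros) (simp add: o_def)
    thus ?thesis
      by (rule holomorphic_transform) (use L in \<open>auto intro!: qpoch_eq[OF assms, symmetric]\<close>)
  qed
  hence "qpoch \<omega> field_differentiable at z" for z
  proof -
    have "z \<in> ball 0 (norm z + 1)" by simp
    with \<open>\<And>R. qpoch \<omega> holomorphic_on ball 0 R\<close> show ?thesis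
      using holomorphic_on_imp_differentiable_at[OF _ open_ball] by blast
  qed
  thus ?thesis by (meson field_differentiable_at_within holomorphic_onI)
qed

section \<open>A theta function and its quotient by finitely many factors\<close>

text \<open>
  Normalised to be 1-periodic in \<open>x\<close>; its zeros are the points \<open>m - 2 \<pi> \<i> n / \<omega>\<close> with integers
  \<open>m\<close>, \<open>n\<close>. Those with \<open>0 \<le> n < P\<close> are the zeros of \<open>theta_factors \<omega> P\<close>.
\<close>

definition jtheta :: "complex \<Rightarrow> complex \<Rightarrow> complex" where
  "jtheta \<omega> x = exp (\<i> * pi * x - \<omega> * x\<^sup>2 / 2 - \<omega> * x / 2) *
     qpoch \<omega> (exp (\<omega> * x)) * qpoch \<omega> (exp (- (\<omega> * (x + 1))))"

lemma holomorphic_jtheta: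
  assumes "Re \<omega> > 0" shows "jtheta \<omega> holomorphic_on A"
proof -
  have 1: "(qpoch \<omega> \<circ> (\<lambda>x. exp (\<omega> * x))) holomorphic_on A"
    by (intro holomorphic_on_compose holomorphic_qpoch assms holomorphic_intros)
  have 2: "(qpoch \<omega> \<circ> (\<lambda>x. exp (- (\<omega> * (x + 1))))) holomorphic_on A"
    by (intro holomorphic_on_compose holomorphic_qpoch assms holomorphic_intros)
  show ?thesis
    using 1 2 unfolding jtheta_def[abs_def] o_def by (intro holomorphic_intros) auto
qed

text \<open>With y = exp (omega (x + 1)), the prefactor is multiplied by -1/y, the first product
  gains 1 - y and the second loses 1 - 1/y; these cancel since - (1 - y)/y = 1 - 1/y.\<close>

lemma jtheta_plus_1:
  assumes "Re \<omega> > 0" shows "jtheta \<omega> (x + 1) = jtheta \<omega> x"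
proof -
  define y where "y = exp (\<omega> * (x + 1))"
  have [simp]: "y \<noteq> 0" by (simp add: y_def)
  have e: "exp (\<i> * pi * (x + 1) - \<omega> * (x + 1)\<^sup>2 / 2 - \<omega> * (x + 1) / 2)
      = exp (\<i> * pi * x - \<omega> * x\<^sup>2 / 2 - \<omega> * x / 2) * (- (1 / y))"
  proof -
    have "\<i> * pi * (x + 1) - \<omega> * (x + 1)\<^sup>2 / 2 - \<omega> * (x + 1) / 2
        = (\<i> * pi * x - \<omega> * x\<^sup>2 / 2 - \<omega> * x / 2) + (pi * \<i> - \<omega> * (x + 1))"
      by (simp add: field_simps power2_eq_square)
    thus ?thesis by (simp add: exp_add exp_diff y_def)
  qed
  have s: "y * exp (-\<omega>) = exp (\<omega> * x)"
    by (simp add: y_def exp_add[symmetric] algebra_simps)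
  have 1: "qpoch \<omega> y = (1 - y) * qpoch \<omega> (exp (\<omega> * x))"
    using qpoch_rec[OF assms, of y] unfolding s .
  have s2: "1 / y * exp (-\<omega>) = exp (- (\<omega> * (x + 1 + 1)))"
  proof -
    have "1 / y = exp (- (\<omega> * (x + 1)))" by (simp add: y_def exp_minus inverse_eq_divide)
    moreover have "- (\<omega> * (x + 1)) + - \<omega> = - (\<omega> * (x + 1 + 1))" by (simp add: algebra_simps)
    ultimately show ?thesis by (metis exp_add)
  qed
  have 2: "qpoch \<omega> (1 / y) = (1 - 1 / y) * qpoch \<omega> (exp (- (\<omega> * (x + 1 + 1))))"
    using qpoch_rec[OF assms, of "1 / y"] unfolding s2 .
  have y': "exp (- (\<omega> * (x + 1))) = 1 / y" by (simp add: y_def exp_minus inverse_eq_divide)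
  have "jtheta \<omega> (x + 1) = exp (\<i> * pi * x - \<omega> * x\<^sup>2 / 2 - \<omega> * x / 2) * (- (1 / y)) *
     ((1 - y) * qpoch \<omega> (exp (\<omega> * x))) * qpoch \<omega> (exp (- (\<omega> * (x + 1 + 1))))"
    unfolding jtheta_def e y_def[symmetric] 1 ..
  also have "\<dots> = exp (\<i> * pi * x - \<omega> * x\<^sup>2 / 2 - \<omega> * x / 2) * qpoch \<omega> (exp (\<omega> * x)) *
      ((1 - 1 / y) * qpoch \<omega> (exp (- (\<omega> * (x + 1 + 1)))))"
    by (simp add: field_simps)
  also have "\<dots> = jtheta \<omega> x"
    unfolding jtheta_def y' 2 ..
  finally show ?thesis .
qed

lemma jtheta_plus_of_nat:
  assumes "Re \<omega> > 0" shows "jtheta \<omega> (x + of_nat m) = jtheta \<omega> x"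
proof (induction m)
  case (Suc m)
  thus ?case using jtheta_plus_1[OF assms, of "x + of_nat m"] by (simp add: add_ac)
qed simp

lemma jtheta_plus_of_int:
  assumes "Re \<omega> > 0" shows "jtheta \<omega> (x + of_int m) = jtheta \<omega> x"
proof (cases "m \<ge> 0")
  case True
  thus ?thesis using jtheta_plus_of_nat[OF assms, of x "nat m"] by simp
next
  case False
  thus ?thesis using jtheta_plus_of_nat[OF assms, of "x + of_int m" "nat (-m)"] by simp
qed

text \<open>Both products see x only through exp (omega x), which is unchanged; the multiplier comes
  from the quadratic exponent alone.\<close>

lemma jtheta_minus_quasiperiod:
  fixes \<omega> :: complex
  assumes "Re \<omega> > 0"
  shows "jtheta \<omega> (x - 2 * pi * \<i> / \<omega>) = - exp (2 * pi * \<i> * x + 4 * (of_real pi)\<^sup>2 / \<omega>) * jtheta \<omega> x"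
proof -
  have [simp]: "\<omega> \<noteq> 0" using assms by auto
  have a: "exp (\<omega> * (x - 2 * pi * \<i> / \<omega>)) = exp (\<omega> * x)"
  proof -
    have "\<omega> * (x - 2 * pi * \<i> / \<omega>) = \<omega> * x - 2 * pi * \<i>" by (simp add: field_simps)
    thus ?thesis by (simp add: exp_diff)
  qed
  have b: "exp (- (\<omega> * (x - 2 * pi * \<i> / \<omega> + 1))) = exp (- (\<omega> * (x + 1)))"
  proof -
    have "- (\<omega> * (x - 2 * pi * \<i> / \<omega> + 1)) = - (\<omega> * (x + 1)) + 2 * pi * \<i>" by (simp add: field_simps)
    thus ?thesis by (simp add: exp_add exp_diff exp_minus inverse_eq_divide)
  qed
  have "\<i> * pi * (x - 2 * pi * \<i> / \<omega>) - \<omega> * (x - 2 * pi * \<i> / \<omega>)\<^sup>2 / 2 - \<omega> * (x - 2 * pi * \<i> / \<omega>) / 2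
     = (\<i> * pi * x - \<omega> * x\<^sup>2 / 2 - \<omega> * x / 2) + (2 * pi * \<i> * x + 4 * (of_real pi)\<^sup>2 / \<omega>) + pi * \<i>"
    by (simp add: field_simps power2_eq_square)
  hence c: "exp (\<i> * pi * (x - 2 * pi * \<i> / \<omega>) - \<omega> * (x - 2 * pi * \<i> / \<omega>)\<^sup>2 / 2 - \<omega> * (x - 2 * pi * \<i> / \<omega>) / 2)
     = - exp (2 * pi * \<i> * x + 4 * (of_real pi)\<^sup>2 / \<omega>) * exp (\<i> * pi * x - \<omega> * x\<^sup>2 / 2 - \<omega> * x / 2)"
    by (simp only: exp_add exp_pi_i) simp
  show ?thesis unfolding jtheta_def a b c by simp
qed

lemma jtheta_minus_quasiperiods:
  fixes \<omega> :: complex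
  assumes "Re \<omega> > 0"
  shows "jtheta \<omega> (x - of_nat k * (2 * pi * \<i> / \<omega>)) =
    (\<Prod>j=1..k. - exp (2 * pi * \<i> * x + of_nat j * (4 * (of_real pi)\<^sup>2 / \<omega>))) * jtheta \<omega> x"
proof (induction k)
  case (Suc k)
  have [simp]: "\<omega> \<noteq> 0" using assms by auto
  have "x - of_nat (Suc k) * (2 * pi * \<i> / \<omega>) = (x - of_nat k * (2 * pi * \<i> / \<omega>)) - 2 * pi * \<i> / \<omega>"
    by (simp add: algebra_simps add_divide_distrib)
  moreover have "2 * pi * \<i> * (x - of_nat k * (2 * pi * \<i> / \<omega>)) + 4 * (of_real pi)\<^sup>2 / \<omega>
      = 2 * pi * \<i> * x + of_nat (Suc k) * (4 * (of_real pi)\<^sup>2 / \<omega>)"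
    by (simp add: field_simps power2_eq_square)
  ultimately have "jtheta \<omega> (x - of_nat (Suc k) * (2 * pi * \<i> / \<omega>)) =
      - exp (2 * pi * \<i> * x + of_nat (Suc k) * (4 * (of_real pi)\<^sup>2 / \<omega>)) * jtheta \<omega> (x - of_nat k * (2 * pi * \<i> / \<omega>))"
    using jtheta_minus_quasiperiod[OF assms, of "x - of_nat k * (2 * pi * \<i> / \<omega>)"] by (simp only:)
  thus ?case unfolding Suc by (simp del: of_nat_Suc)
qed simp

text \<open>The hypothesis makes x an integer minus n quasi-periods. At 0 the leading factor of
  \<open>qpoch\<close> vanishes, and both kinds of translation preserve zeros.\<close>

lemma jtheta_eq_0:
  fixes \<omega> :: complex
  assumes "Re \<omega> > 0" and "exp (2 * pi * \<i> * x) = exp (of_nat n * (4 * (of_real pi)\<^sup>2 / \<omega>))"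
  shows "jtheta \<omega> x = 0"
proof -
  have [simp]: "\<omega> \<noteq> 0" using assms by auto
  obtain m :: int where m: "2 * pi * \<i> * x = of_nat n * (4 * (of_real pi)\<^sup>2 / \<omega>) + of_int (2 * m) * pi * \<i>"
    using assms(2) unfolding exp_eq by blast
  have "x = of_int m - of_nat n * (2 * pi * \<i> / \<omega>)"
  proof -
    have "(2 * pi * \<i>) * x = (2 * pi * \<i>) * (of_int m - of_nat n * (2 * pi * \<i> / \<omega>))"
      unfolding m by (simp add: field_simps power2_eq_square)
    thus ?thesis by (subst (asm) mult_cancel_left) auto
  qed
  moreover have "jtheta \<omega> (of_int m) = 0"
    using jtheta_plus_of_int[OF assms(1), of 0 m] qpoch_rec[OF assms(1), of 1] by (simp add: jtheta_def)
  ultimately show ?thesis using jtheta_minus_quasiperiods[OF assms(1), of "of_int m" n] by simp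
qed

text \<open>The zeros of g are removable singularities, filled in with the ratio of derivatives.
  Near such a zero a, both functions are first divided by z - a, after which the denominator no
  longer vanishes.\<close>

lemma holomorphic_divide_simple_zeros:
  fixes f g :: "complex \<Rightarrow> complex"
  assumes f: "f holomorphic_on UNIV" and g: "g holomorphic_on UNIV"
    and z: "\<And>z. g z = 0 \<Longrightarrow> f z = 0" and d: "\<And>z. g z = 0 \<Longrightarrow> deriv g z \<noteq> 0"
  shows "(\<lambda>z. if g z = 0 then deriv f z / deriv g z else f z / g z) holomorphic_on UNIV" (is "?h holomorphic_on _")
proof -
  have "?h field_differentiable at a" for a
  proof (cases "g a = 0")
    case False
    have "open {z. g z \<noteq> 0}"
      using g by (intro open_Collect_neq holomorphic_on_imp_continuous_on continuous_intros) auto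
    then obtain e where e: "e > 0" "ball a e \<subseteq> {z. g z \<noteq> 0}"
      using False openE by blast
    have "(\<lambda>z. f z / g z) holomorphic_on ball a e"
      by (intro holomorphic_intros holomorphic_on_subset[OF f] holomorphic_on_subset[OF g]) (use e in auto)
    hence "?h holomorphic_on ball a e"
      by (rule holomorphic_transform) (use e in auto)
    thus ?thesis using e holomorphic_on_imp_differentiable_at[of ?h "ball a e" a] by auto
  next
    case True
    define Df where "Df = (\<lambda>z. if z = a then deriv f a else (f z - f a) / (z - a))"
    define Dg where "Dg = (\<lambda>z. if z = a then deriv g a else (g z - g a) / (z - a))"
    have hDf: "Df holomorphic_on UNIV" and hDg: "Dg holomorphic_on UNIV"
      unfolding Df_def Dg_def by (rule pole_lemma_open; use f g in auto)+
    have "open {z. Dg z \<noteq> 0}"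
      using hDg by (intro open_Collect_neq holomorphic_on_imp_continuous_on continuous_intros) auto
    moreover have "a \<in> {z. Dg z \<noteq> 0}" using d[OF True] by (simp add: Dg_def)
    ultimately obtain e where e: "e > 0" "ball a e \<subseteq> {z. Dg z \<noteq> 0}"
      using openE by blast
    have "(\<lambda>z. Df z / Dg z) holomorphic_on ball a e"
      by (intro holomorphic_intros holomorphic_on_subset[OF hDf] holomorphic_on_subset[OF hDg]) (use e in auto)
    hence "?h holomorphic_on ball a e"
    proof (rule holomorphic_transform)
      fix x assume x: "x \<in> ball a e"
      hence nz: "Dg x \<noteq> 0" using e by auto
      show "Df x / Dg x = ?h x"
      proof (cases "x = a")
        case True thus ?thesis using \<open>g a = 0\<close> by (simp add: Df_def Dg_def)
      next
        case False
        hence "g x \<noteq> 0" using nz True by (auto simp: Dg_def)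
        thus ?thesis using False True z[OF True] by (simp add: Df_def Dg_def)
      qed
    qed
    thus ?thesis using e holomorphic_on_imp_differentiable_at[of ?h "ball a e" a] by auto
  qed
  thus ?thesis by (simp add: holomorphic_on_def field_differentiable_at_within)
qed

text \<open>Needed so that the values filled in at the zeros are periodic as well.\<close>

lemma deriv_periodic:
  assumes "\<And>z. f (z + 1) = f z" shows "deriv f (z + 1) = deriv f (z :: complex)"
proof -
  have "(f has_field_derivative D) (at (z + 1)) \<longleftrightarrow> (f has_field_derivative D) (at z)" for D
    using DERIV_shift[of f D z 1] assms by (simp add: fun_eq_iff)
  thus ?thesis by (simp add: deriv_def)
qed

lemma periodic_divide_simple_zeros:
  fixes f g :: "complex \<Rightarrow> complex"
  assumes "f holomorphic_on UNIV" "g holomorphic_on UNIV"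
    and "\<And>z. f (z + 1) = f z" "\<And>z. g (z + 1) = g z"
    and "\<And>z. g z = 0 \<Longrightarrow> f z = 0" "\<And>z. g z = 0 \<Longrightarrow> deriv g z \<noteq> 0"
  shows "\<exists>h. h holomorphic_on UNIV \<and> (\<forall>z. h (z + 1) = h z) \<and> (\<forall>z. f z = g z * h z)"
  by (rule exI[of _ "\<lambda>z. if g z = 0 then deriv f z / deriv g z else f z / g z"])
     (use holomorphic_divide_simple_zeros[OF assms(1,2,5,6)] assms deriv_periodic[of f] deriv_periodic[of g] in auto)

definition theta_factors :: "complex \<Rightarrow> nat \<Rightarrow> complex \<Rightarrow> complex" where
  "theta_factors \<omega> P x = (\<Prod>n<P. 1 - exp (2 * pi * \<i> * x - of_nat n * (4 * (of_real pi)\<^sup>2 / \<omega>)))"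

lemma exp_2pi_i_plus_1: "exp (2 * pi * \<i> * (x + 1) - c) = exp (2 * pi * \<i> * x - c)"
proof -
  have "of_real (2 * pi) * \<i> * (x + 1) - c = (2 * pi * \<i> * x - c) + 2 * pi * \<i>" by (simp add: algebra_simps)
  hence "exp (2 * pi * \<i> * (x + 1) - c) = exp (2 * pi * \<i> * x - c) * exp (2 * pi * \<i>)"
    by (simp only: exp_add)
  thus ?thesis by simp
qed

lemma Re_dual_pos:
  fixes \<omega> :: complex
  shows "Re \<omega> > 0 \<Longrightarrow> Re (4 * (of_real pi)\<^sup>2 / \<omega>) > 0"
proof -
  assume a: "Re \<omega> > 0"
  have "Re (4 * (of_real pi)\<^sup>2 / \<omega>) = 4 * pi\<^sup>2 * Re \<omega> / (norm \<omega>)\<^sup>2"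
    by (simp add: Re_divide cmod_power2)
  thus ?thesis using a by (auto intro!: divide_pos_pos mult_pos_pos)
qed

text \<open>One factor is divided out at a time. Its zeros satisfy |exp (2 pi i z)| = exp (P Re
  tau), a modulus that no zero of the earlier factors has; so the zeros of \<open>jtheta\<close>
  there are still zeros of the remaining quotient.\<close>

lemma jtheta_factor:
  fixes \<omega> :: complex
  assumes "Re \<omega> > 0"
  shows "\<exists>h. h holomorphic_on UNIV \<and> (\<forall>z. h (z + 1) = h z) \<and> (\<forall>z. jtheta \<omega> z = theta_factors \<omega> P z * h z)"
proof (induction P)
  case 0
  show ?case
    by (rule exI[of _ "jtheta \<omega>"]) (use assms in \<open>auto simp: theta_factors_def holomorphic_jtheta jtheta_plus_1\<close>)
next
  case (Suc P)
  then obtain h where h: "h holomorphic_on UNIV" "\<And>z. h (z + 1) = h z" "\<And>z. jtheta \<omega> z = theta_factors \<omega> P z * h z"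
    by blast
  define \<tau> where "\<tau> = 4 * (of_real pi)\<^sup>2 / \<omega>"
  have T: "Re \<tau> > 0" using Re_dual_pos[OF assms] by (simp add: \<tau>_def)
  define g where "g = (\<lambda>x. 1 - exp (2 * pi * \<i> * x - of_nat P * \<tau>))"
  have "\<exists>k. k holomorphic_on UNIV \<and> (\<forall>z. k (z + 1) = k z) \<and> (\<forall>z. h z = g z * k z)"
  proof (rule periodic_divide_simple_zeros[OF h(1) _ h(2)])
    show "g holomorphic_on UNIV" unfolding g_def by (intro holomorphic_intros)
    show "g (z + 1) = g z" for z
      unfolding g_def exp_2pi_i_plus_1 ..
    fix z assume z: "g z = 0"
    have "(g has_field_derivative - (2 * pi * \<i> * exp (2 * pi * \<i> * z - of_nat P * \<tau>))) (at z)"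
      unfolding g_def by (auto intro!: derivative_eq_intros)
    thus "deriv g z \<noteq> 0" by (simp add: DERIV_imp_deriv)
    have e: "exp (2 * pi * \<i> * z) = exp (of_nat P * \<tau>)"
      using z by (simp add: g_def exp_diff)
    hence "jtheta \<omega> z = 0" using jtheta_eq_0[OF assms, of z P] unfolding \<tau>_def by simp
    moreover have "theta_factors \<omega> P z \<noteq> 0"
    proof
      assume "theta_factors \<omega> P z = 0"
      then obtain n where n: "n < P" "exp (2 * pi * \<i> * z) = exp (of_nat n * \<tau>)"
        unfolding theta_factors_def \<tau>_def[symmetric] by (auto simp: exp_diff)
      hence "norm (exp (of_nat n * \<tau>)) = norm (exp (of_nat P * \<tau>))" using e by simp
      hence "real n * Re \<tau> = real P * Re \<tau>" by simp
      thus False using n T by simp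
    qed
    ultimately show "h z = 0" using h(3)[of z] by simp
  qed
  then obtain k where k: "k holomorphic_on UNIV" "\<And>z. k (z + 1) = k z" "\<And>z. h z = g z * k z" by blast
  show ?case
    by (rule exI[of _ k]) (use k h(3) in \<open>auto simp: theta_factors_def g_def \<tau>_def\<close>)
qed

text \<open>Periodicity takes the place of a growth condition: the supremum over the strip is a
  maximum over one compact rectangle. If it is attained inside, f is constant and its value is
  already seen on the boundary.\<close>

lemma periodic_strip_bound:
  fixes f :: "complex \<Rightarrow> complex"
  assumes holo: "f holomorphic_on UNIV" and per: "\<And>z. f (z + 1) = f z"
    and b: "\<And>z. Im z = c \<or> Im z = d \<Longrightarrow> norm (f z) \<le> B"
    and z: "c \<le> Im z" "Im z \<le> d"
  shows "norm (f z) \<le> B"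
proof -
  have pern: "f (w + of_nat n) = f w" for w n
  proof (induction n)
    case (Suc n)
    thus ?case using per[of "w + of_nat n"] by (simp add: add_ac)
  qed simp
  have peri: "f (w + of_int n) = f w" for w n
  proof (cases "n \<ge> 0")
    case True thus ?thesis using pern[of w "nat n"] by simp
  next
    case False thus ?thesis using pern[of "w + of_int n" "nat (-n)"] by simp
  qed
  define K where "K = cbox (Complex 0 c) (Complex 1 d)"
  have red: "\<exists>w'\<in>K. f w' = f w" if "c \<le> Im w" "Im w \<le> d" for w
  proof (rule bexI[of _ "w + of_int (- \<lfloor>Re w\<rfloor>)"])
    show "w + of_int (- \<lfloor>Re w\<rfloor>) \<in> K"
      using that by (auto simp: K_def in_cbox_complex_iff) linarith+
  qed (rule peri)
  have "K \<noteq> {}" using red[OF z] by blast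
  moreover have "compact K" by (simp add: K_def)
  moreover have "continuous_on K (\<lambda>w. norm (f w))"
    using holo by (intro continuous_intros holomorphic_on_imp_continuous_on) (auto intro: holomorphic_on_subset)
  ultimately obtain w where w: "w \<in> K" "\<And>u. u \<in> K \<Longrightarrow> norm (f u) \<le> norm (f w)"
    using continuous_attains_sup[of K "\<lambda>w. norm (f w)"] by blast
  have wim: "c \<le> Im w" "Im w \<le> d" using w(1) by (auto simp: K_def in_cbox_complex_iff)
  have mx: "norm (f u) \<le> norm (f w)" if "c \<le> Im u" "Im u \<le> d" for u
    using red[OF that] w(2) by metis
  have "norm (f w) \<le> B"
  proof (cases "Im w = c \<or> Im w = d")
    case True thus ?thesis by (rule b)
  next
    case False
    define S where "S = {u. c < Im u} \<inter> {u. Im u < d}"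
    have S: "open S" "convex S" unfolding S_def
      by (auto intro!: open_Int open_halfspace_Im_gt open_halfspace_Im_lt convex_Int convex_halfspace_Im_gt convex_halfspace_Im_lt)
    have "w \<in> S" using False wim by (auto simp: S_def)
    have "f constant_on UNIV"
      by (rule maximum_modulus_principle[of f UNIV S w])
         (use S \<open>w \<in> S\<close> holo mx in \<open>auto simp: S_def\<close>)
    then obtain v where "\<And>u. f u = v" unfolding constant_on_def by blast
    thus ?thesis using b[of "Complex 0 c"] by simp
  qed
  thus ?thesis using mx[OF z] by simp
qed

text \<open>
  The strip is bounded by lines half way between two rows of zeros. Both lines are translates of
  the line of the hypothesis by quasi-periods, and there \<open>theta_factors\<close> absorbs the automorphy factor.
\<close>

lemma jtheta_quotient_bound:
  fixes \<omega> :: complex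
  assumes \<omega>: "Re \<omega> > 0"
    and h: "h holomorphic_on UNIV" "\<And>z. h (z + 1) = h z" "\<And>z. jtheta \<omega> z = theta_factors \<omega> P z * h z"
    and B: "\<And>r. 0 \<le> r \<Longrightarrow> r \<le> 1 \<Longrightarrow> norm (jtheta \<omega> (\<i> * pi / \<omega> + of_real r)) \<le> B"
    and x: "exp (- Re (4 * (of_real pi)\<^sup>2 / \<omega>) / 2) \<le> norm (exp (2 * pi * \<i> * x))"
           "norm (exp (2 * pi * \<i> * x)) \<le> exp (Re (4 * (of_real pi)\<^sup>2 / \<omega>) * (real P - 1 / 2))"
  shows "norm (h x) \<le> B / (1 - exp (- Re (4 * (of_real pi)\<^sup>2 / \<omega>) / 2)) ^ P"
proof -
  define \<tau> where "\<tau> = 4 * (of_real pi)\<^sup>2 / \<omega>"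
  define T where "T = Re \<tau>"
  define D where "D = 1 - exp (- T / 2)"
  have nz: "\<omega> \<noteq> 0" using \<omega> by auto
  have T: "T > 0" using Re_dual_pos[OF \<omega>] by (simp add: \<tau>_def T_def)
  have D: "D > 0" using T by (simp add: D_def)
  have del: "2 * pi * \<i> / \<omega> = \<i> * \<tau> / (2 * pi)" unfolding \<tau>_def by (simp add: field_simps power2_eq_square)
  have del': "\<i> * pi / \<omega> = \<i> * \<tau> / (4 * pi)" unfolding \<tau>_def by (simp add: field_simps power2_eq_square)
  have up: "norm (jtheta \<omega> z) \<le> B" if "Im z = T / (4 * pi)" for z
  proof -
    define s where "s = Re z - Re (\<i> * \<tau> / (4 * pi))"
    have zz: "z = \<i> * pi / \<omega> + of_real s"
      unfolding del' s_def by (rule complex_eqI) (use that in \<open>auto simp: T_def\<close>)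
    have "jtheta \<omega> z = jtheta \<omega> (\<i> * pi / \<omega> + of_real (frac s) + of_int \<lfloor>s\<rfloor>)"
      unfolding zz by (simp add: frac_def)
    also have "\<dots> = jtheta \<omega> (\<i> * pi / \<omega> + of_real (frac s))" by (rule jtheta_plus_of_int[OF \<omega>])
    finally show ?thesis using B[of "frac s"] by (simp add: frac_ge_0 frac_lt_1 less_imp_le)
  qed
  have B0: "B \<ge> 0" using B[of 0] norm_ge_zero order_trans by blast
  have nX: "norm (exp (2 * pi * \<i> * z + c)) = exp (- 2 * pi * Im z + Re c)" for z c by simp
  have f1: "norm (h z) \<le> B / D ^ P" if z: "Im z = T / (4 * pi)" for z
  proof -
    have "norm (theta_factors \<omega> P z) \<ge> D ^ P"
    proof -
      have "D \<le> norm (1 - exp (2 * pi * \<i> * z - of_nat n * \<tau>))" for n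
      proof -
        have "norm (exp (2 * pi * \<i> * z - of_nat n * \<tau>)) = exp (- T / 2 - real n * T)"
          using nX[of z "- (of_nat n * \<tau>)"] z by (simp add: T_def)
        also have "\<dots> \<le> exp (- T / 2)" using T by simp
        finally show ?thesis
          using norm_triangle_ineq2[of 1 "exp (2 * pi * \<i> * z - of_nat n * \<tau>)"]
          unfolding D_def norm_one by linarith
      qed
      hence "(\<Prod>n<P. D) \<le> (\<Prod>n<P. norm (1 - exp (2 * pi * \<i> * z - of_nat n * \<tau>)))"
        by (intro prod_mono) (use D in auto)
      thus ?thesis by (simp add: theta_factors_def prod_norm \<tau>_def)
    qed
    hence "D ^ P * norm (h z) \<le> norm (jtheta \<omega> z)"
      unfolding h(3) norm_mult by (intro mult_right_mono) auto
    hence "D ^ P * norm (h z) \<le> B" using up[OF z] by linarith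
    thus ?thesis using D by (simp add: field_simps)
  qed
  have f2: "norm (h z) \<le> B / D ^ P" if z: "Im z = - (real P - 1 / 2) * T / (2 * pi)" for z
  proof -
    define y where "y = z + of_nat P * (2 * pi * \<i> / \<omega>)"
    have y: "Im y = T / (4 * pi)"
    proof -
      have "Im y = Im z + real P * T / (2 * pi)" unfolding y_def del by (simp add: T_def)
      also have "\<dots> = T / (4 * pi)" unfolding z by (simp add: field_simps)
      finally show ?thesis .
    qed
    define E where "E j = exp (2 * pi * \<i> * y + of_nat j * \<tau>)" for j :: nat
    have zy: "z = y - of_nat P * (2 * pi * \<i> / \<omega>)" by (simp add: y_def)
    have j: "jtheta \<omega> z = (\<Prod>j=1..P. - E j) * jtheta \<omega> y"
      unfolding zy jtheta_minus_quasiperiods[OF \<omega>] E_def \<tau>_def ..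
    have "theta_factors \<omega> P z = (\<Prod>n<P. 1 - E (P - n))"
    proof -
      have "2 * pi * \<i> * z - of_nat n * \<tau> = 2 * pi * \<i> * y + of_nat (P - n) * \<tau>" if "n < P" for n
        using that unfolding zy \<tau>_def using nz by (simp add: of_nat_diff field_simps power2_eq_square)
      thus ?thesis unfolding theta_factors_def E_def \<tau>_def[symmetric] by simp
    qed
    also have "\<dots> = (\<Prod>j=1..P. 1 - E j)"
      by (rule prod.reindex_bij_witness[of _ "\<lambda>j. P - j" "\<lambda>n. P - n"]) auto
    finally have d: "theta_factors \<omega> P z = (\<Prod>j=1..P. 1 - E j)" .
    \<comment> \<open>For j >= 1 the modulus of \<open>E j\<close> is exp ((j - 1/2) T) >= exp
      (T/2), whence |1 - E j| >= |E j| - 1 >= |E j| D. The product of the |E j| then cancels against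
      the multiplier in fact \<open>j\<close>.\<close>
    have "norm (E j) * D \<le> norm (1 - E j)" if "j \<ge> 1" for j
    proof -
      have n: "norm (E j) = exp (- T / 2 + real j * T)"
        unfolding E_def nX y T_def by simp
      have "real j * T \<ge> 1 * T" by (rule mult_right_mono) (use T that in auto)
      hence "norm (E j) * exp (- T / 2) \<ge> 1" unfolding n by (simp add: exp_add[symmetric])
      moreover have "norm (1 - E j) \<ge> norm (E j) - 1"
        using norm_triangle_ineq2[of "E j" 1] by (simp add: norm_minus_commute)
      ultimately show ?thesis by (simp add: D_def algebra_simps)
    qed
    hence "(\<Prod>j=1..P. norm (E j) * D) \<le> (\<Prod>j=1..P. norm (1 - E j))"
      using D by (intro prod_mono) auto
    hence l: "(\<Prod>j=1..P. norm (E j)) * D ^ P \<le> norm (theta_factors \<omega> P z)"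
      by (simp add: prod.distrib d prod_norm)
    have pe: "(\<Prod>j=1..P. norm (E j)) > 0" by (intro prod_pos) (simp add: E_def)
    have "(\<Prod>j=1..P. norm (E j)) * D ^ P * norm (h z) \<le> norm (theta_factors \<omega> P z) * norm (h z)"
      by (intro mult_right_mono l) auto
    also have "\<dots> = norm (jtheta \<omega> z)" by (simp add: h(3) norm_mult)
    also have "\<dots> = (\<Prod>j=1..P. norm (E j)) * norm (jtheta \<omega> y)"
      by (simp add: j norm_mult prod_norm[symmetric])
    also have "\<dots> \<le> (\<Prod>j=1..P. norm (E j)) * B"
      by (intro mult_left_mono up y) (use pe in auto)
    finally have "D ^ P * norm (h z) \<le> B" using pe by (simp add: mult.assoc)
    thus ?thesis using D by (simp add: field_simps)
  qed
  have nx: "norm (exp (2 * pi * \<i> * x)) = exp (- 2 * pi * Im x)" by simp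
  have "norm (h x) \<le> B / D ^ P"
  proof (rule periodic_strip_bound[OF h(1,2)])
    show "norm (h z) \<le> B / D ^ P" if "Im z = - (real P - 1 / 2) * T / (2 * pi) \<or> Im z = T / (4 * pi)" for z
      using that f1 f2 by blast
    have "- 2 * pi * Im x \<le> T * (real P - 1/2)" "- T / 2 \<le> - 2 * pi * Im x"
      using x unfolding nx \<tau>_def[symmetric] T_def[symmetric] exp_le_cancel_iff by auto
    thus "- (real P - 1 / 2) * T / (2 * pi) \<le> Im x" "Im x \<le> T / (4 * pi)"
      by (simp_all add: field_simps)
  qed
  thus ?thesis by (simp add: D_def T_def \<tau>_def)
qed

section \<open>Asymptotics of the quantum dilogarithm\<close>

text \<open>Over the common denominator the numerator 2 s - (2 + s)(1 - exp (- s)) starts with s^3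
  only. The 6 is (9/2) / (3/4), from the bounds of numerator and denominator.\<close>

lemma inverse_one_minus_exp_small:
  fixes s :: complex
  assumes "s \<noteq> 0" "norm s \<le> 1 / 2"
  shows "norm (1 / (1 - exp (- s)) - 1 / s - 1 / 2) \<le> 6 * norm s"
proof -
  define E where "E = exp (- s) - (1 - s + s\<^sup>2 / 2)"
  have "(\<Sum>k\<le>2. (- s) ^ k / fact k) = 1 - s + s\<^sup>2 / 2"
    by (simp add: numeral_2_eq_2 atMost_Suc)
  hence "norm E \<le> exp \<bar>Re (- s)\<bar> * norm (- s) ^ Suc 2 / fact 2"
    using Taylor_exp[of "- s" 2] unfolding E_def by simp
  also have "exp \<bar>Re (- s)\<bar> \<le> 3"
  proof -
    have "\<bar>Re (- s)\<bar> \<le> 1" using abs_Re_le_cmod[of s] assms by simp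
    hence "exp \<bar>Re (- s)\<bar> \<le> exp 1" by simp
    thus ?thesis using exp_le by linarith
  qed
  finally have E: "norm E \<le> 3 / 2 * norm s ^ 3"
    by (simp add: fact_numeral numeral_3_eq_3 mult_right_mono divide_right_mono)
  have s2: "norm s ^ 2 \<le> 1 / 2 * norm s" and s3: "norm s ^ 3 \<le> 1 / 4 * norm s"
  proof -
    show a: "norm s ^ 2 \<le> 1 / 2 * norm s"
      unfolding power2_eq_square by (rule mult_right_mono) (use assms in auto)
    have "norm s ^ 3 = norm s ^ 2 * norm s" by (simp add: power3_eq_cube power2_eq_square)
    also have "\<dots> \<le> (1 / 2 * norm s) * norm s" by (rule mult_right_mono[OF a]) auto
    also have "\<dots> = 1 / 2 * norm s ^ 2" by (simp add: power2_eq_square)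
    also have "\<dots> \<le> 1 / 2 * (1 / 2 * norm s)" by (rule mult_left_mono[OF a]) auto
    finally show "norm s ^ 3 \<le> 1 / 4 * norm s" by simp
  qed
  have d: "1 - exp (- s) = s - (s\<^sup>2 / 2 + E)" by (simp add: E_def algebra_simps)
  have "norm (s\<^sup>2 / 2 + E) \<le> norm s ^ 2 / 2 + 3 / 2 * norm s ^ 3"
    using norm_triangle_ineq[of "s\<^sup>2 / 2" E] E by (simp add: norm_divide norm_power)
  also have "\<dots> \<le> 5 / 8 * norm s" using s2 s3 by simp
  finally have den: "norm (1 - exp (- s)) \<ge> 3 / 8 * norm s"
    unfolding d using norm_triangle_ineq2[of s "s\<^sup>2 / 2 + E"] by simp
  have nz: "1 - exp (- s) \<noteq> 0" using den assms(1) by auto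
  have eq: "1 / (1 - exp (- s)) - 1 / s - 1 / 2 = (s ^ 3 / 2 + (2 + s) * E) / (2 * s * (1 - exp (- s)))"
  proof -
    have "1 / (1 - exp (- s)) - 1 / s - 1 / 2 = (2 * s - (2 + s) * (1 - exp (- s))) / (2 * s * (1 - exp (- s)))"
      using nz assms(1) by (simp add: field_simps)
    also have "2 * s - (2 + s) * (1 - exp (- s)) = s ^ 3 / 2 + (2 + s) * E"
      unfolding d by (simp add: field_simps power2_eq_square power3_eq_cube)
    finally show ?thesis .
  qed
  have "norm (s ^ 3 / 2 + (2 + s) * E) \<le> norm s ^ 3 / 2 + norm (2 + s) * norm E"
    using norm_triangle_ineq[of "s ^ 3 / 2" "(2 + s) * E"] by (simp add: norm_divide norm_power norm_mult)
  also have "\<dots> \<le> norm s ^ 3 / 2 + (5 / 2) * (3 / 2 * norm s ^ 3)"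
    using norm_triangle_ineq[of 2 s] assms E by (intro add_mono mult_mono) auto
  also have "\<dots> \<le> 9 / 2 * norm s ^ 3" by simp
  finally have num: "norm (s ^ 3 / 2 + (2 + s) * E) \<le> 9 / 2 * norm s ^ 3" .
  have "norm (1 / (1 - exp (- s)) - 1 / s - 1 / 2) \<le> (9 / 2 * norm s ^ 3) / (2 * norm s * (3 / 8 * norm s))"
    unfolding eq norm_divide by (rule frac_le) (use num den assms in \<open>auto simp: norm_mult mult_left_mono\<close>)
  also have "\<dots> = 6 * norm s" using assms(1) by (simp add: field_simps power3_eq_cube)
  finally show ?thesis .
qed

text \<open>Below \<open>r0\<close> the local expansion applies; above it exp (- r xi) stays away
  from 1. The bound linear in r yields the 1/N error in \<open>qlog_asymp\<close>, the constant one
  yields the logarithmic error.\<close>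

lemma inverse_one_minus_exp_ray:
  fixes \<xi> :: complex
  assumes "Re \<xi> > 0"
  obtains C where "C > 0"
    "\<And>r. r > 0 \<Longrightarrow> norm (1 / (1 - exp (- (of_real r * \<xi>))) - 1 / (of_real r * \<xi>) - 1 / 2) \<le> C * r"
    "\<And>r. r > 0 \<Longrightarrow> norm (1 / (1 - exp (- (of_real r * \<xi>))) - 1 / (of_real r * \<xi>)) \<le> C"
proof -
  have x0: "norm \<xi> > 0" using assms by auto
  define r0 where "r0 = 1 / (2 * norm \<xi>)"
  have r0: "r0 > 0" using x0 by (simp add: r0_def)
  define D where "D = 1 / (1 - exp (- (r0 * Re \<xi>))) + 5 / 2"
  have e1: "1 - exp (- (r0 * Re \<xi>)) > 0" using r0 assms by simp
  have D0: "D \<ge> 5 / 2" unfolding D_def using e1 by simp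
  define C where "C = 6 * norm \<xi> + 2 * norm \<xi> * D + D + 1"
  have big: "norm (1 / (1 - exp (- (of_real r * \<xi>)))) + norm (1 / (of_real r * \<xi>)) + 1 / 2 \<le> D" if "r \<ge> r0" for r
  proof -
    have "r0 * Re \<xi> \<le> r * Re \<xi>" using that assms by (intro mult_right_mono) auto
    hence "norm (exp (- (of_real r * \<xi>))) \<le> exp (- (r0 * Re \<xi>))" by simp
    hence "norm (1 - exp (- (of_real r * \<xi>))) \<ge> 1 - exp (- (r0 * Re \<xi>))"
      using norm_triangle_ineq2[of 1 "exp (- (of_real r * \<xi>))"] unfolding norm_one by linarith
    hence "norm (1 / (1 - exp (- (of_real r * \<xi>)))) \<le> 1 / (1 - exp (- (r0 * Re \<xi>)))"
      unfolding norm_divide norm_one using e1 by (intro divide_left_mono mult_pos_pos) auto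
    moreover have "norm (1 / (of_real r * \<xi>)) \<le> 2"
    proof -
      have r: "r > 0" using that r0 by linarith
      have "1 \<le> r * norm \<xi> * 2" using that x0 by (simp add: r0_def field_simps)
      thus ?thesis using r x0 by (simp add: norm_divide norm_mult field_simps)
    qed
    ultimately show ?thesis unfolding D_def by simp
  qed
  show ?thesis
  proof (rule that[of C])
    show "C > 0" unfolding C_def using x0 D0 by (auto intro!: add_pos_pos)
    fix r :: real assume r: "r > 0"
    have s: "of_real r * \<xi> \<noteq> 0" using r x0 by auto
    have ns: "norm (of_real r * \<xi>) = r * norm \<xi>" using r by (simp add: norm_mult)
    let ?a = "1 / (1 - exp (- (of_real r * \<xi>)))" and ?b = "1 / (of_real r * \<xi>)"
    have "norm (?a - ?b - 1 / 2) \<le> C * r \<and> norm (?a - ?b) \<le> C"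
    proof (cases "r \<ge> r0")
      case True
      have "norm (?a - ?b) \<le> norm ?a + norm ?b" by (rule norm_triangle_ineq4)
      hence 1: "norm (?a - ?b) + 1 / 2 \<le> D" using big[OF True] by linarith
      have 2: "norm (?a - ?b - 1 / 2) \<le> D"
        using norm_triangle_ineq4[of "?a - ?b" "1 / 2"] 1 by simp
      have "1 \<le> 2 * norm \<xi> * r" using True x0 by (simp add: r0_def field_simps)
      hence "D * 1 \<le> D * (2 * norm \<xi> * r)" using D0 by (intro mult_left_mono) auto
      also have "\<dots> = (2 * norm \<xi> * D) * r" by simp
      also have "\<dots> \<le> C * r" unfolding C_def using r D0 x0 by (intro mult_right_mono) auto
      finally have "D \<le> C * r" by simp
      moreover have "D \<le> C" unfolding C_def using D0 x0 by simp
      ultimately show ?thesis using 1 2 by linarith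
    next
      case False
      hence "norm (of_real r * \<xi>) \<le> 1 / 2"
        unfolding ns using x0 by (simp add: r0_def field_simps)
      from inverse_one_minus_exp_small[OF s this]
      have 1: "norm (?a - ?b - 1 / 2) \<le> 6 * norm (of_real r * \<xi>)" .
      have "norm (?a - ?b) \<le> norm (?a - ?b - 1 / 2) + norm (1 / 2 :: complex)"
        using norm_triangle_ineq[of "?a - ?b - 1 / 2" "1 / 2"] by simp
      hence 2: "norm (?a - ?b) \<le> 7 / 2" using 1 \<open>norm (of_real r * \<xi>) \<le> 1 / 2\<close> by simp
      have "6 * norm (of_real r * \<xi>) = 6 * norm \<xi> * r" unfolding ns by simp
      also have "\<dots> \<le> C * r" unfolding C_def using r D0 x0 by (intro mult_right_mono) auto
      finally have "norm (?a - ?b - 1 / 2) \<le> C * r" using 1 by linarith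
      moreover have "7 / 2 \<le> C"
      proof -
        have "0 \<le> 2 * norm \<xi> * D" using D0 by simp
        thus ?thesis using D0 x0 unfolding C_def by linarith
      qed
      ultimately show ?thesis using 2 by linarith
    qed
    thus "norm (?a - ?b - 1 / 2) \<le> C * r" "norm (?a - ?b) \<le> C" by blast+
  qed
qed

lemma Ln_one_minus_real_sums:
  assumes "0 \<le> x" "x < 1"
  shows "(\<lambda>n. x ^ Suc n / real (Suc n)) sums (- ln (1 - x))"
proof -
  have "(\<lambda>n. complex_of_real (x ^ Suc n / real (Suc n))) sums of_real (- ln (1 - x))"
    using Ln_one_minus_sums[of "of_real x"] assms Ln_of_real[of "1 - x"]
    by (simp del: of_nat_Suc power_Suc)
  thus ?thesis by (simp only: sums_of_real_iff)
qed

lemma norm_suminf_diff_le: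
  fixes f g :: "nat \<Rightarrow> complex"
  assumes "f sums a" "g sums b" "h sums c" "\<And>n. norm (f n - g n) \<le> h n"
  shows "norm (a - b) \<le> c"
proof -
  have 1: "(\<lambda>n. f n - g n) sums (a - b)" by (intro sums_diff assms)
  have 2: "summable (\<lambda>n. norm (f n - g n))"
    by (rule summable_comparison_test_ev[of _ h])
       (use assms(3,4) in \<open>auto simp: sums_iff\<close>)
  have "norm (a - b) \<le> (\<Sum>n. norm (f n - g n))"
    using summable_norm[OF 2] 1 by (simp add: sums_iff)
  also have "\<dots> \<le> c"
    using suminf_le[OF assms(4) 2] assms(3) by (simp add: sums_iff)
  finally show ?thesis .
qed

text \<open>The coefficient 1/(1 - exp (- s)), s = (n+1) xi / N, is compared with 1/s + 1/2 or with
  1/s alone. The first error is of order 1/N inside the disc but degenerates like 1/(1 - |z|); the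
  second degenerates only logarithmically, so it remains useful close to the unit circle.\<close>

lemma qlog_asymp:
  fixes \<xi> :: complex
  assumes "Re \<xi> > 0"
  obtains C where "C > 0"
    "\<And>N z. N > 0 \<Longrightarrow> norm z < 1 \<Longrightarrow>
       norm (qlog (\<xi> / of_nat N) z - (of_nat N / \<xi> * dilog z - Ln (1 - z) / 2)) \<le> C / N * (norm z / (1 - norm z))"
    "\<And>N z. N > 0 \<Longrightarrow> norm z < 1 \<Longrightarrow>
       norm (qlog (\<xi> / of_nat N) z - of_nat N / \<xi> * dilog z) \<le> C * (- ln (1 - norm z))"
proof -
  obtain C where C: "C > 0"
    "\<And>r. r > 0 \<Longrightarrow> norm (1 / (1 - exp (- (of_real r * \<xi>))) - 1 / (of_real r * \<xi>) - 1 / 2) \<le> C * r"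
    "\<And>r. r > 0 \<Longrightarrow> norm (1 / (1 - exp (- (of_real r * \<xi>))) - 1 / (of_real r * \<xi>)) \<le> C"
    using inverse_one_minus_exp_ray[OF assms] by metis
  have nz: "\<xi> \<noteq> 0" using assms by auto
  show ?thesis
  proof (rule that[OF C(1)])
    fix N :: nat and z :: complex assume N: "N > 0" and z: "norm z < 1"
    have Re: "Re (\<xi> / of_nat N) > 0" using assms N by simp
    define r where "r n = real (Suc n) / real N" for n
    have r: "r n > 0" for n using N by (simp add: r_def)
    have eq: "of_nat (Suc n) * (\<xi> / of_nat N) = of_real (r n) * \<xi>" for n
      by (simp add: r_def)
    define w where "w n = z ^ Suc n / of_nat (Suc n)" for n
    have nw: "norm (w n) = norm z ^ Suc n / real (Suc n)" for n
      unfolding w_def norm_divide norm_power norm_of_nat ..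
    have q: "(\<lambda>n. w n * (1 / (1 - exp (- (of_real (r n) * \<xi>))))) sums qlog (\<xi> / of_nat N) z"
      using qlog_sums[OF Re z] unfolding eq w_def by (simp del: of_nat_Suc power_Suc)
    have d: "(\<lambda>n. w n * (1 / (of_real (r n) * \<xi>))) sums (of_nat N / \<xi> * dilog z)"
    proof -
      have "of_nat N / \<xi> * (z ^ Suc n / of_nat (Suc n) ^ 2) = w n * (1 / (of_real (r n) * \<xi>))" for n
        unfolding w_def r_def using N nz by (simp add: divide_simps power2_eq_square del: of_nat_Suc power_Suc)
      thus ?thesis using sums_mult[OF dilog_sums, of z "of_nat N / \<xi>"] z by simp
    qed
    have l: "(\<lambda>n. w n * (1 / 2)) sums (- Ln (1 - z) / 2)"
      using sums_divide[OF Ln_one_minus_sums[OF z], of 2] unfolding w_def by simp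
    have "norm (qlog (\<xi> / of_nat N) z - (of_nat N / \<xi> * dilog z + - Ln (1 - z) / 2)) \<le> C / N * (norm z / (1 - norm z))"
    proof (rule norm_suminf_diff_le[OF q sums_add[OF d l]])
      have "(\<lambda>n. norm z * norm z ^ n) sums (norm z * (1 / (1 - norm z)))"
        using geometric_sums[of "norm z"] z by (intro sums_mult) auto
      from sums_mult[OF this, of "C / N"]
      show "(\<lambda>n. C / N * norm z ^ Suc n) sums (C / N * (norm z / (1 - norm z)))" by simp
      fix n
      have "w n * (1 / (1 - exp (- (of_real (r n) * \<xi>)))) - (w n * (1 / (of_real (r n) * \<xi>)) + w n * (1 / 2))
         = w n * (1 / (1 - exp (- (of_real (r n) * \<xi>))) - 1 / (of_real (r n) * \<xi>) - 1 / 2)"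
        by (simp add: right_diff_distrib)
      hence "norm (w n * (1 / (1 - exp (- (of_real (r n) * \<xi>)))) - (w n * (1 / (of_real (r n) * \<xi>)) + w n * (1 / 2)))
         = norm (w n) * norm (1 / (1 - exp (- (of_real (r n) * \<xi>))) - 1 / (of_real (r n) * \<xi>) - 1 / 2)"
        by (simp only: norm_mult)
      also have "\<dots> \<le> norm (w n) * (C * r n)" by (intro mult_left_mono C(2) r) auto
      also have "\<dots> = C / N * norm z ^ Suc n" unfolding nw r_def by (simp del: of_nat_Suc power_Suc)
      finally show "norm (w n * (1 / (1 - exp (- (of_real (r n) * \<xi>)))) - (w n * (1 / (of_real (r n) * \<xi>)) + w n * (1 / 2)))
         \<le> C / N * norm z ^ Suc n" .
    qed
    thus "norm (qlog (\<xi> / of_nat N) z - (of_nat N / \<xi> * dilog z - Ln (1 - z) / 2)) \<le> C / N * (norm z / (1 - norm z))"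
      by simp
    show "norm (qlog (\<xi> / of_nat N) z - of_nat N / \<xi> * dilog z) \<le> C * (- ln (1 - norm z))"
    proof (rule norm_suminf_diff_le[OF q d])
      show "(\<lambda>n. C * (norm z ^ Suc n / real (Suc n))) sums (C * (- ln (1 - norm z)))"
        by (intro sums_mult Ln_one_minus_real_sums z norm_ge_zero)
      fix n
      have "norm (w n * (1 / (1 - exp (- (of_real (r n) * \<xi>)))) - w n * (1 / (of_real (r n) * \<xi>)))
         = norm (w n) * norm (1 / (1 - exp (- (of_real (r n) * \<xi>))) - 1 / (of_real (r n) * \<xi>))"
        unfolding right_diff_distrib[symmetric] norm_mult ..
      also have "\<dots> \<le> norm (w n) * C" by (intro mult_left_mono C(3) r) auto
      finally show "norm (w n * (1 / (1 - exp (- (of_real (r n) * \<xi>)))) - w n * (1 / (of_real (r n) * \<xi>)))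
         \<le> C * (norm z ^ Suc n / real (Suc n))" unfolding nw by (simp add: mult.commute del: of_nat_Suc power_Suc)
    qed
  qed
qed

text \<open>In this range - ln (1 - |z|) is of order ln N at most, which is below any fixed multiple
  of N.\<close>

lemma qlog_asymp_exp:
  fixes \<xi> :: complex
  assumes "Re \<xi> > 0" "c > 0" "\<epsilon> > 0"
  shows "eventually (\<lambda>N. \<forall>z. norm z \<le> exp (- (c / real N)) \<longrightarrow>
     norm (qlog (\<xi> / of_nat N) z - of_nat N / \<xi> * dilog z) \<le> \<epsilon> * real N) sequentially"
proof -
  obtain C where C: "C > 0"
    "\<And>N z. N > 0 \<Longrightarrow> norm z < 1 \<Longrightarrow>
       norm (qlog (\<xi> / of_nat N) z - of_nat N / \<xi> * dilog z) \<le> C * (- ln (1 - norm z))"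
    using qlog_asymp[OF assms(1)] by metis
  have "(\<lambda>N. - C * ln (1 - exp (- (c / real N))) / real N) \<longlonglongrightarrow> 0"
    using assms(2) by real_asymp
  hence "eventually (\<lambda>N. - C * ln (1 - exp (- (c / real N))) / real N < \<epsilon>) sequentially"
    using assms(3) order_tendstoD(2) by blast
  thus ?thesis using eventually_gt_at_top[of 0]
  proof eventually_elim
    case (elim N)
    hence N: "N > 0" by simp
    show ?case
    proof (intro allI impI)
      fix z :: complex assume z: "norm z \<le> exp (- (c / real N))"
      have e: "exp (- (c / real N)) < 1" using N assms(2) by simp
      have z1: "norm z < 1" using z e by linarith
      have "norm (qlog (\<xi> / of_nat N) z - of_nat N / \<xi> * dilog z) \<le> C * (- ln (1 - norm z))"
        by (rule C(2)[OF N z1])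
      also have "\<dots> \<le> C * (- ln (1 - exp (- (c / real N))))"
        using z e z1 C(1) by (intro mult_left_mono) auto
      also have "\<dots> \<le> \<epsilon> * real N" using elim N by (simp add: field_simps)
      finally show "norm (qlog (\<xi> / of_nat N) z - of_nat N / \<xi> * dilog z) \<le> \<epsilon> * real N" .
    qed
  qed
qed

text \<open>Composition with exp cancels the denominator in Li2'(z) = - log (1 - z) / z.\<close>

lemma has_field_derivative_dilog_exp:
  assumes "norm (exp (f t)) < 1" "(f has_field_derivative f') (at t)"
  shows "((\<lambda>t. dilog (exp (f t))) has_field_derivative (- Ln (1 - exp (f t)) * f')) (at t)"
proof -
  define z where "z = exp (f t)"
  have z: "norm z < 1" "z \<noteq> 0" using assms by (auto simp: z_def)
  obtain R where R: "norm z < R" "R < 1" using z(1) dense by blast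
  have R0: "R > 0" using R(1) norm_ge_zero[of z] by linarith
  define c :: "nat \<Rightarrow> complex" where "c n = (if n = 0 then 0 else 1 / of_nat n ^ 2)" for n
  have cs: "(\<lambda>n. c n * w ^ n) sums dilog w" if "norm w \<le> 1" for w
  proof -
    have "(\<lambda>n. c (Suc n) * w ^ Suc n) sums dilog w"
      using dilog_sums[OF that] by (simp add: c_def del: of_nat_Suc power_Suc)
    thus ?thesis by (subst (asm) sums_Suc_iff) (simp add: c_def)
  qed
  have "((\<lambda>x. \<Sum>n. c n * x ^ n) has_field_derivative (\<Sum>n. diffs c n * z ^ n)) (at z)"
    by (rule termdiffs_strong[of c "of_real R"])
       (use R R0 in \<open>auto intro!: sums_summable[OF cs]\<close>)
  moreover have "eventually (\<lambda>x. (\<Sum>n. c n * x ^ n) = dilog x) (nhds z)"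
  proof (rule eventually_mono[OF eventually_nhds_in_open[of "ball 0 1" z]])
    fix x :: complex assume "x \<in> ball 0 1"
    thus "(\<Sum>n. c n * x ^ n) = dilog x" using cs[of x] by (simp add: sums_iff)
  qed (use z in auto)
  ultimately have D: "(dilog has_field_derivative (\<Sum>n. diffs c n * z ^ n)) (at z)"
    by (subst (asm) DERIV_cong_ev[OF refl _ refl]) auto
  have "(\<lambda>n. z * (diffs c n * z ^ n)) = (\<lambda>n. z ^ Suc n / of_nat (Suc n))"
  proof
    fix n
    have "diffs c n = 1 / of_nat (Suc n)"
      by (simp add: diffs_def c_def power2_eq_square del: of_nat_Suc)
    thus "z * (diffs c n * z ^ n) = z ^ Suc n / of_nat (Suc n)" by (simp del: of_nat_Suc)
  qed
  hence m: "(\<lambda>n. z * (diffs c n * z ^ n)) sums (- Ln (1 - z))"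
    using Ln_one_minus_sums[OF z(1)] by simp
  have "(\<lambda>n. diffs c n * z ^ n) sums ((1 / z) * (- Ln (1 - z)))"
    using sums_mult[OF m, of "1 / z"] z(2) by simp
  hence v: "(\<Sum>n. diffs c n * z ^ n) = - Ln (1 - z) / z" by (simp add: sums_iff)
  have "((\<lambda>t. exp (f t)) has_field_derivative (z * f')) (at t)"
    unfolding z_def by (rule DERIV_chain2[OF DERIV_exp assms(2)])
  from DERIV_chain2[OF D[unfolded z_def] this] show ?thesis
    using z(2) unfolding v[unfolded z_def] by (simp add: z_def)
qed

lemma dilog_1: "dilog 1 = of_real (pi\<^sup>2 / 6)"
proof -
  have "(\<lambda>n. complex_of_real (1 / real (Suc n) ^ 2)) sums of_real (pi\<^sup>2 / 6)"
    using inverse_squares_sums by (intro sums_of_real) simp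
  thus ?thesis unfolding dilog_def by (simp add: sums_iff)
qed

text \<open>Adding the series at 1 and at -1 leaves twice the terms 1/(2m)^2, that is, half of the
  series at 1. Grouping in pairs isolates these terms.\<close>

lemma dilog_minus_1: "dilog (- 1) = of_real (- pi\<^sup>2 / 12)"
proof -
  define f :: "nat \<Rightarrow> complex" where "f n = 1 / of_nat (Suc n) ^ 2" for n
  have s1: "f sums dilog 1" using dilog_sums[of 1] by (simp add: f_def[abs_def] del: of_nat_Suc)
  have s2: "(\<lambda>n. - ((- 1) ^ n) * f n) sums dilog (- 1)" using dilog_sums[of "- 1"] by (simp add: f_def del: of_nat_Suc)
  have s3: "(\<lambda>n. f n - (- 1) ^ n * f n) sums (dilog 1 + dilog (- 1))"
    using sums_add[OF s1 s2] by simp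
  have g: "(\<lambda>m. (\<Sum>n\<in>{m * 2..<m * 2 + 2}. f n - (- 1) ^ n * f n)) sums (dilog 1 + dilog (- 1))"
    by (rule sums_group[OF s3]) simp
  have e: "(\<Sum>n\<in>{m * 2..<m * 2 + 2}. f n - (- 1) ^ n * f n) = 1 / 2 * f m" for m
  proof -
    have "{m * 2..<m * 2 + 2} = {m * 2, Suc (m * 2)}" by auto
    moreover have "f (Suc (m * 2)) = 1 / 4 * f m"
    proof -
      have "(of_nat (Suc (Suc (m * 2))) :: complex) = 2 * of_nat (Suc m)" by simp
      thus ?thesis unfolding f_def by (simp only: power_mult_distrib) (simp del: of_nat_Suc)
    qed
    moreover have "(- 1 :: complex) ^ (m * 2) = 1" "(- 1 :: complex) ^ Suc (m * 2) = - 1" by auto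
    ultimately show ?thesis by (simp del: power_Suc add: mult.commute)
  qed
  from g have "(\<lambda>m. 1 / 2 * f m) sums (dilog 1 + dilog (- 1))" unfolding e .
  moreover have "(\<lambda>m. 1 / 2 * f m) sums (1 / 2 * dilog 1)" by (rule sums_mult[OF s1])
  ultimately have "dilog 1 + dilog (- 1) = 1 / 2 * dilog 1" by (rule sums_unique2)
  hence "dilog (- 1) = 1 / 2 * dilog 1 - dilog 1" by (metis add_diff_cancel_left')
  thus ?thesis unfolding dilog_1 by simp
qed

lemma dilog_uniformly_close:
  assumes "\<epsilon> > 0"
  obtains \<delta> where "\<delta> > 0"
    "\<And>z w. norm z \<le> 1 \<Longrightarrow> norm w \<le> 1 \<Longrightarrow> norm (z - w) < \<delta> \<Longrightarrow> norm (dilog z - dilog w) < \<epsilon>"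
proof -
  have "uniformly_continuous_on (cball 0 1) dilog"
    by (rule compact_uniformly_continuous[OF continuous_on_dilog]) auto
  then obtain \<delta> where \<delta>: "\<delta> > 0" "\<And>z w. z \<in> cball 0 1 \<Longrightarrow> w \<in> cball 0 1 \<Longrightarrow> dist w z < \<delta> \<Longrightarrow> dist (dilog w) (dilog z) < \<epsilon>"
    by (rule uniformly_continuous_onE[OF _ assms]) metis
  show ?thesis
    by (rule that[OF \<delta>(1)]) (use \<delta>(2) in \<open>simp add: dist_norm\<close>)
qed

section \<open>Growth of the Jones polynomial at infinity\<close>

lemma tendsto_one_minus_power_ratio:
  assumes "m > 0"
  shows "((\<lambda>q :: complex. (1 - q ^ m) / q ^ m) \<longlongrightarrow> - 1) at_infinity"
proof -
  have "((\<lambda>q :: complex. inverse q ^ m - 1) \<longlongrightarrow> 0 ^ m - 1) at_infinity"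
    by (intro tendsto_intros tendsto_inverse_0)
  moreover have "0 ^ m - 1 = (- 1 :: complex)" using assms by simp
  ultimately have "((\<lambda>q :: complex. inverse q ^ m - 1) \<longlongrightarrow> - 1) at_infinity"
    by (simp only:)
  moreover have "eventually (\<lambda>q :: complex. inverse q ^ m - 1 = (1 - q ^ m) / q ^ m) at_infinity"
    using eventually_not_equal_at_infinity[of 0]
    by eventually_elim (simp add: field_simps)
  ultimately show ?thesis by (rule Lim_transform_eventually)
qed

text \<open>Each pair of factors has degree (p - l) + (p + l) = 2 p and leading coefficient (-1)(-1)
  = 1, so the k-th term grows like q^(2kp - kp) = q^(kp), and k = p - 1 dominates.\<close>

lemma jones_fig8_at_infinity:
  assumes "p > 0"
  shows "((\<lambda>q. jones_fig8 p q / q ^ (p * (p - 1))) \<longlongrightarrow> 1) at_infinity"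
proof -
  define T where "T k q = inverse q ^ (k * p) * (\<Prod>l=1..k. (1 - q ^ (p - l)) * (1 - q ^ (p + l)))" for k and q :: complex
  have T1: "((\<lambda>q. T k q / q ^ (k * p)) \<longlongrightarrow> 1) at_infinity" if k: "k < p" for k
  proof -
    have "((\<lambda>q :: complex. \<Prod>l=1..k. (1 - q ^ (p - l)) / q ^ (p - l) * ((1 - q ^ (p + l)) / q ^ (p + l)))
        \<longlongrightarrow> (\<Prod>l=1..k. (- 1) * (- 1))) at_infinity"
      by (intro tendsto_intros tendsto_one_minus_power_ratio) (use k in auto)
    hence "((\<lambda>q :: complex. \<Prod>l=1..k. (1 - q ^ (p - l)) / q ^ (p - l) * ((1 - q ^ (p + l)) / q ^ (p + l)))
        \<longlongrightarrow> 1) at_infinity" by simp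
    moreover have "eventually (\<lambda>q :: complex. (\<Prod>l=1..k. (1 - q ^ (p - l)) / q ^ (p - l) * ((1 - q ^ (p + l)) / q ^ (p + l)))
        = T k q / q ^ (k * p)) at_infinity"
      using eventually_not_equal_at_infinity[of 0]
    proof eventually_elim
      case (elim q)
      have "(\<Prod>l=1..k. (1 - q ^ (p - l)) / q ^ (p - l) * ((1 - q ^ (p + l)) / q ^ (p + l)))
          = (\<Prod>l=1..k. (1 - q ^ (p - l)) * (1 - q ^ (p + l)) / q ^ (2 * p))"
      proof (rule prod.cong[OF refl])
        fix l assume "l \<in> {1..k}"
        hence "p - l + (p + l) = 2 * p" using k by auto
        thus "(1 - q ^ (p - l)) / q ^ (p - l) * ((1 - q ^ (p + l)) / q ^ (p + l))
            = (1 - q ^ (p - l)) * (1 - q ^ (p + l)) / q ^ (2 * p)"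
          by (metis power_add times_divide_times_eq)
      qed
      also have "\<dots> = (\<Prod>l=1..k. (1 - q ^ (p - l)) * (1 - q ^ (p + l))) / (q ^ (k * p) * q ^ (k * p))"
      proof -
        have "(\<Prod>l=1..k. q ^ (2 * p)) = q ^ (k * p) * q ^ (k * p)"
          by (simp add: power_add[symmetric] power_mult[symmetric] algebra_simps flip: mult_2)
        thus ?thesis by (simp only: prod_dividef)
      qed
      also have "\<dots> = T k q / q ^ (k * p)"
        using elim by (simp add: T_def field_simps)
      finally show ?case .
    qed
    ultimately show ?thesis by (rule Lim_transform_eventually)
  qed
  have T2: "((\<lambda>q. T k q / q ^ (p * (p - 1))) \<longlongrightarrow> (if k = p - 1 then 1 else 0)) at_infinity" if k: "k < p" for k
  proof -
    define d where "d = p * (p - 1 - k)"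
    have e: "k * p + d = p * (p - 1)"
    proof -
      have "k * p + d = p * (k + (p - 1 - k))" unfolding d_def by (simp only: add_mult_distrib2 mult.commute)
      thus ?thesis using k by simp
    qed
    have "((\<lambda>q :: complex. T k q / q ^ (k * p) * inverse q ^ d) \<longlongrightarrow> 1 * 0 ^ d) at_infinity"
      by (intro tendsto_intros tendsto_inverse_0 T1 k)
    \<comment> \<open>The exponent \<open>d\<close> vanishes exactly for k = p - 1, where 0 ^ 0 = 1
      keeps the term.\<close>
    moreover have "(1 * 0 ^ d :: complex) = (if k = p - 1 then 1 else 0)"
      using k assms by (auto simp: d_def)
    moreover have "T k q / q ^ (k * p) * inverse q ^ d = T k q / q ^ (p * (p - 1))" for q :: complex
      unfolding e[symmetric] power_add by (simp add: divide_simps power_inverse)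
    ultimately show ?thesis by (simp only:)
  qed
  have "((\<lambda>q. \<Sum>k<p. T k q / q ^ (p * (p - 1))) \<longlongrightarrow> (\<Sum>k<p. if k = p - 1 then 1 else 0)) at_infinity"
    by (intro tendsto_sum T2) auto
  moreover have "(\<Sum>k<p. if k = p - 1 then 1 else 0 :: complex) = 1"
    using assms by (subst sum.delta) auto
  ultimately show ?thesis by (simp add: jones_fig8_def T_def sum_divide_distrib)
qed

section \<open>The Jones polynomial as a sum over a lattice\<close>

locale fig8_kappa =
  fixes p :: nat and \<kappa> :: real and \<xi> :: complex
  assumes p_pos: "p > 0"
    and kappa_def: "\<kappa> = arcosh (3 / 2)"
    and xi_def: "\<xi> = of_real \<kappa> + 2 * of_nat p * pi * \<i>"
begin

section \<open>Numerical bounds for kappa\<close>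

lemma exp_kappa: "exp \<kappa> = (3 + sqrt 5) / 2"
proof -
  have "(3 / 2 :: real)\<^sup>2 - 1 = 5 / 4" by (simp add: power2_eq_square)
  hence "sqrt ((3 / 2 :: real)\<^sup>2 - 1) = sqrt 5 / 2" by (simp only: real_sqrt_divide) simp
  moreover have "arcosh (3 / 2) = ln (3 / 2 + sqrt ((3 / 2 :: real)\<^sup>2 - 1))"
    by (rule arcosh_real_def) simp
  ultimately have "\<kappa> = ln ((3 + sqrt 5) / 2)"
    unfolding kappa_def by (simp only: add_divide_distrib)
  moreover have "(3 + sqrt 5) / 2 > 0" by (simp add: add_pos_pos)
  ultimately show ?thesis by simp
qed

lemma exp_minus_kappa: "exp (- \<kappa>) = (3 - sqrt 5) / 2"
proof -
  have "(3 + sqrt 5) / 2 * ((3 - sqrt 5) / 2) = 1" by (simp add: field_simps)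
  moreover have "(3 + sqrt 5) / 2 \<noteq> 0" by (smt (verit) real_sqrt_ge_zero divide_eq_0_iff)
  ultimately have "inverse ((3 + sqrt 5) / 2) = (3 - sqrt 5) / 2" by (metis inverse_unique)
  thus ?thesis by (simp add: exp_minus exp_kappa)
qed

text \<open>This form of cosh kappa = 3/2 is what turns the factors of the Jones polynomial into 3 -
  2 cosh.\<close>

lemma kappa_sum: "exp (of_real \<kappa>) + exp (- of_real \<kappa>) = (3 :: complex)"
proof -
  have "exp \<kappa> + exp (- \<kappa>) = 3" unfolding exp_kappa exp_minus_kappa by (simp add: field_simps)
  hence "complex_of_real (exp \<kappa> + exp (- \<kappa>)) = of_real 3" by (simp only:)
  thus ?thesis unfolding of_real_add exp_of_real[symmetric] by simp
qed

lemma sqrt5_bounds: "2.23 \<le> sqrt (5 :: real)" "sqrt (5 :: real) \<le> 2.24"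
  by (rule real_le_rsqrt, simp add: power2_eq_square) (rule real_le_lsqrt, simp_all add: power2_eq_square)

lemma exp_minus_kappa_le: "exp (- \<kappa>) \<le> 0.39"
  unfolding exp_minus_kappa using sqrt5_bounds by simp

lemma exp_minus_2_kappa_le: "exp (- 2 * \<kappa>) \<le> 0.16"
proof -
  have "exp (- 2 * \<kappa>) = exp (- \<kappa>) * exp (- \<kappa>)" by (simp add: exp_add[symmetric])
  also have "\<dots> \<le> 0.39 * 0.39" by (intro mult_mono exp_minus_kappa_le) auto
  finally show ?thesis by simp
qed

lemma exp_minus_half_kappa_le: "exp (- \<kappa> / 2) \<le> 0.63"
proof -
  have "exp (- \<kappa> / 2) ^ 2 = exp (- \<kappa>)" by (simp add: power2_eq_square exp_add[symmetric])
  also have "\<dots> \<le> 0.63 ^ 2" using exp_minus_kappa_le by (simp add: power2_eq_square)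
  finally show ?thesis by (rule power2_le_imp_le) simp
qed

lemma kappa_ge: "0.95 \<le> \<kappa>"
proof -
  \<comment> \<open>From exp (1/20) >= 21/20 one gets exp (19/20) <= 2.72/1.05 < 2.6, which is below
    (3 + 2.23)/2.\<close>
  have "exp (19 / 20 :: real) * exp (1 / 20) = exp 1" by (simp add: exp_add[symmetric])
  moreover have "exp (1 / 20 :: real) \<ge> 21 / 20" using exp_ge_add_one_self[of "1 / 20 :: real"] by simp
  ultimately have "exp (19 / 20 :: real) * (21 / 20) \<le> 272 / 100"
    using e_less_272 mult_left_mono[of "21 / 20" "exp (1 / 20)" "exp (19 / 20 :: real)"] by simp
  hence "exp (19 / 20) \<le> exp \<kappa>" unfolding exp_kappa using sqrt5_bounds by simp
  thus ?thesis by simp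
qed

lemma kappa_le: "\<kappa> \<le> 1"
proof -
  have "exp \<kappa> \<le> 2.62" unfolding exp_kappa using sqrt5_bounds by simp
  also have "2.62 \<le> exp (1 :: real)" using abs_le_D2[OF e_approx_32] by simp
  finally show ?thesis by simp
qed

lemma kappa_pos: "\<kappa> > 0" using kappa_ge by simp

lemma Re_xi [simp]: "Re \<xi> = \<kappa>" and Im_xi [simp]: "Im \<xi> = 2 * pi * real p"
  by (simp_all add: xi_def)

lemma xi_nonzero [simp]: "\<xi> \<noteq> 0"
  using kappa_pos Re_xi by (metis less_irrefl zero_complex.simps(1))

lemma exp_xi: "exp \<xi> = exp (of_real \<kappa>)"
proof -
  have "exp (2 * of_nat p * pi * \<i>) = 1"
    using exp_integer_2pi[of "of_nat p"] by (simp add: mult_ac)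
  thus ?thesis unfolding xi_def exp_add by simp
qed

section \<open>Recurrence and quasi-periodicity of the summand function\<close>

definition mesh :: "nat \<Rightarrow> complex" where "mesh N = \<xi> / of_nat N"

lemma Re_mesh: "Re (mesh N) = \<kappa> / N" and Im_mesh: "Im (mesh N) = 2 * pi * real p / N"
  by (simp_all add: mesh_def)

lemma Re_mesh_pos: "N > 0 \<Longrightarrow> Re (mesh N) > 0"
  using kappa_pos by (simp add: Re_mesh)

lemma mesh_nonzero: "N > 0 \<Longrightarrow> mesh N \<noteq> 0"
  by (simp add: mesh_def)

text \<open>
  \<open>F N 0 = 1\<close> and \<open>F N (t + \<omega>) = (3 - 2 cosh (t + \<omega>)) F N t\<close>, where \<open>\<omega> = mesh N\<close>, so \<open>F N (k \<omega>)\<close> is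
  the \<open>k\<close>-th summand of the Jones polynomial. As \<open>N \<omega> = \<xi>\<close> differs from \<open>\<kappa>\<close> by \<open>2 \<pi> \<i> p\<close> and \<open>F N\<close> is
  quasi-periodic under \<open>2 \<pi> \<i>\<close>, the lattice can be moved to \<open>\<kappa> - j \<omega>\<close>.
\<close>

definition F :: "nat \<Rightarrow> complex \<Rightarrow> complex" where
  "F N t = exp (of_real \<kappa> * t / mesh N) * qpoch (mesh N) (exp (t - of_real \<kappa>)) / qexp (mesh N) (exp (- t - of_real \<kappa>))
     * ((1 - exp (- t - of_real \<kappa>)) / (1 - exp (- of_real \<kappa>)))"

lemma one_minus_exp_minus_kappa_nonzero: "1 - exp (- complex_of_real \<kappa>) \<noteq> 0"
proof -
  have "norm (exp (- complex_of_real \<kappa>)) < 1" using kappa_pos by simp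
  thus ?thesis by (metis eq_iff_diff_eq_0 less_irrefl norm_one)
qed

lemma F_0: "N > 0 \<Longrightarrow> F N 0 = 1"
  using kappa_pos one_minus_exp_minus_kappa_nonzero by (simp add: F_def qpoch_eq_qexp Re_mesh_pos)

text \<open>With u = t + omega, the exponential contributes exp kappa, \<open>qpoch\<close>
  contributes 1 - exp (u - kappa), and 1/\<open>qexp\<close> together with the last factor
  contributes 1 - exp (- u - kappa); the product is evaluated by \<open>kappa_sum\<close>. The bound
  on Re t keeps the arguments of \<open>qexp\<close> in the unit disc.\<close>

lemma F_shift:
  assumes N: "N > 0" and t: "Re t > - \<kappa>"
  shows "F N (t + mesh N) = (3 - exp (t + mesh N) - exp (- (t + mesh N))) * F N t"
proof -
  note w = Re_mesh_pos[OF N]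
  define u where "u = t + mesh N"
  have tu: "t = u - mesh N" by (simp add: u_def)
  define y where "y = exp (- u - of_real \<kappa>)"
  have ny: "norm (exp (mesh N) * y) < 1"
    using t unfolding y_def u_def by (simp add: norm_mult exp_add[symmetric])
  have y': "exp (- t - of_real \<kappa>) = exp (mesh N) * y"
    unfolding tu y_def by (simp add: exp_add[symmetric] algebra_simps)
  have q1: "qexp (mesh N) (exp (mesh N) * y) = (1 - exp (mesh N) * y) * qexp (mesh N) y"
    by (rule qexp_shift[OF w ny])
  have q2: "qpoch (mesh N) (exp (u - of_real \<kappa>)) = (1 - exp (u - of_real \<kappa>)) * qpoch (mesh N) (exp (t - of_real \<kappa>))"
  proof -
    have "exp (u - of_real \<kappa>) * exp (- mesh N) = exp (t - of_real \<kappa>)"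
      unfolding tu by (simp add: exp_add[symmetric] algebra_simps)
    thus ?thesis using qpoch_rec[OF w, of "exp (u - of_real \<kappa>)"] by simp
  qed
  have e: "exp (of_real \<kappa> * u / mesh N) = exp (of_real \<kappa>) * exp (of_real \<kappa> * t / mesh N)"
  proof -
    have "of_real \<kappa> * u / mesh N = of_real \<kappa> + of_real \<kappa> * t / mesh N"
      using mesh_nonzero[OF N] by (simp add: u_def field_simps)
    thus ?thesis by (simp add: exp_add)
  qed
  have nz: "1 - exp (mesh N) * y \<noteq> 0" using ny by auto
  have h: "exp (of_real \<kappa>) * (1 - exp (u - of_real \<kappa>)) * (1 - y) = 3 - exp u - exp (- u)"
  proof -
    have a: "exp (of_real \<kappa>) * exp (u - of_real \<kappa>) = exp u" by (simp add: exp_add[symmetric])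
    have b: "exp (of_real \<kappa>) * y = exp (- u)" by (simp add: y_def exp_add[symmetric])
    have c: "exp u * y = exp (- of_real \<kappa>)" by (simp add: y_def exp_add[symmetric])
    have "exp (of_real \<kappa>) * (1 - exp (u - of_real \<kappa>)) * (1 - y)
        = exp (of_real \<kappa>) - exp (of_real \<kappa>) * exp (u - of_real \<kappa>) - exp (of_real \<kappa>) * y
          + (exp (of_real \<kappa>) * exp (u - of_real \<kappa>)) * y"
      by (simp add: algebra_simps)
    also have "\<dots> = (exp (of_real \<kappa>) + exp (- of_real \<kappa>)) - exp u - exp (- u)"
      unfolding a b c by simp
    finally show ?thesis unfolding kappa_sum .
  qed
  have "F N u = (exp (of_real \<kappa>) * (1 - exp (u - of_real \<kappa>)) * (1 - y)) *
     (exp (of_real \<kappa> * t / mesh N) * qpoch (mesh N) (exp (t - of_real \<kappa>)) / qexp (mesh N) y / (1 - exp (- of_real \<kappa>)))"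
    unfolding F_def e q2 y_def[symmetric] by simp
  also have "\<dots> = (3 - exp u - exp (- u)) * F N t"
    unfolding h F_def y' q1 using nz one_minus_exp_minus_kappa_nonzero by simp
  finally show ?thesis unfolding u_def .
qed

lemma F_plus_2pi: "F N (t + 2 * pi * \<i>) = exp (2 * pi * \<i> * \<kappa> / mesh N) * F N t"
proof -
  have a: "exp (t + 2 * pi * \<i> - of_real \<kappa>) = exp (t - of_real \<kappa>)"
  proof -
    have "t + 2 * pi * \<i> - of_real \<kappa> = (t - of_real \<kappa>) + 2 * pi * \<i>" by simp
    thus ?thesis by (simp only: exp_add) simp
  qed
  have b: "exp (- (t + 2 * pi * \<i>) - of_real \<kappa>) = exp (- t - of_real \<kappa>)"
  proof -
    have "- (t + 2 * pi * \<i>) - of_real \<kappa> = (- t - of_real \<kappa>) - 2 * pi * \<i>" by simp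
    thus ?thesis by (simp only: exp_diff) simp
  qed
  have c: "exp (of_real \<kappa> * (t + 2 * pi * \<i>) / mesh N) = exp (2 * pi * \<i> * \<kappa> / mesh N) * exp (of_real \<kappa> * t / mesh N)"
  proof -
    have "of_real \<kappa> * (t + 2 * pi * \<i>) / mesh N = 2 * pi * \<i> * \<kappa> / mesh N + of_real \<kappa> * t / mesh N"
      by (simp add: algebra_simps add_divide_distrib)
    thus ?thesis by (simp add: exp_add)
  qed
  show ?thesis unfolding F_def a b c by simp
qed

lemma F_plus_2pi_nat: "F N (t + of_nat k * (2 * pi * \<i>)) = exp (2 * pi * \<i> * \<kappa> / mesh N) ^ k * F N t"
proof (induction k)
  case (Suc k)
  have "t + of_nat (Suc k) * (2 * pi * \<i>) = (t + of_nat k * (2 * pi * \<i>)) + 2 * pi * \<i>"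
    by (simp add: algebra_simps)
  thus ?case using F_plus_2pi[of N "t + of_nat k * (2 * pi * \<i>)"] Suc
    by (simp only: add.assoc[symmetric]) (simp add: mult.assoc)
qed simp

lemma F_multiple:
  assumes N: "N > 0"
  shows "F N (of_nat k * mesh N) = (\<Prod>l=1..k. 3 - exp (of_nat l * mesh N) - exp (- (of_nat l * mesh N)))"
proof (induction k)
  case 0 show ?case using F_0[OF N] by simp
next
  case (Suc k)
  have "Re (of_nat k * mesh N) > - \<kappa>"
  proof -
    have "Re (of_nat k * mesh N) = real k * Re (mesh N)" by simp
    also have "\<dots> \<ge> 0" using Re_mesh_pos[OF N] by simp
    finally show ?thesis using kappa_pos by linarith
  qed
  moreover have "of_nat (Suc k) * mesh N = of_nat k * mesh N + mesh N" by (simp add: algebra_simps)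
  ultimately show ?case using F_shift[OF N, of "of_nat k * mesh N"] Suc by simp
qed

text \<open>Distributing q^(-N) over the product turns each pair of factors into q^N + q^(-N) - q^l
  - q^(-l), and q^N = exp xi = exp kappa.\<close>

lemma jones_term_eq_F:
  assumes N: "N > 0" and k: "k < N"
  shows "inverse (exp (mesh N)) ^ (k * N) * (\<Prod>l=1..k. (1 - exp (mesh N) ^ (N - l)) * (1 - exp (mesh N) ^ (N + l)))
    = F N (of_nat k * mesh N)"
proof -
  define q where "q = exp (mesh N)"
  have [simp]: "q \<noteq> 0" by (simp add: q_def)
  have qN: "q ^ N = exp (of_real \<kappa>)"
    unfolding q_def exp_of_nat_mult[symmetric] exp_xi[symmetric] using N by (simp add: mesh_def)
  have "inverse q ^ (k * N) * (\<Prod>l=1..k. (1 - q ^ (N - l)) * (1 - q ^ (N + l)))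
      = (\<Prod>l=1..k. inverse q ^ N * ((1 - q ^ (N - l)) * (1 - q ^ (N + l))))"
    by (simp add: prod.distrib power_mult[symmetric] mult.commute)
  also have "\<dots> = (\<Prod>l=1..k. 3 - exp (of_nat l * mesh N) - exp (- (of_nat l * mesh N)))"
  proof (rule prod.cong[OF refl])
    fix l assume l: "l \<in> {1..k}"
    have e1: "exp (of_nat l * mesh N) = q ^ l" unfolding q_def by (simp add: exp_of_nat_mult)
    have e2: "exp (- (of_nat l * mesh N)) = inverse (q ^ l)" by (simp add: exp_minus e1)
    have "q ^ (N - l) * q ^ l = q ^ N" using l k by (simp add: power_add[symmetric])
    hence e3: "q ^ (N - l) = q ^ N * inverse (q ^ l)" by (simp add: field_simps)
    have "inverse q ^ N * ((1 - q ^ (N - l)) * (1 - q ^ (N + l)))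
        = q ^ N + inverse (q ^ N) - q ^ l - inverse (q ^ l)"
      unfolding e3 power_add by (simp add: field_simps power_inverse)
    also have "\<dots> = 3 - q ^ l - inverse (q ^ l)"
      unfolding qN using kappa_sum by (simp add: exp_minus)
    finally show "inverse q ^ N * ((1 - q ^ (N - l)) * (1 - q ^ (N + l)))
        = 3 - exp (of_nat l * mesh N) - exp (- (of_nat l * mesh N))" unfolding e1 e2 .
  qed
  finally show ?thesis unfolding F_multiple[OF N] q_def .
qed

lemma jones_eq_sum_F:
  assumes N: "N > 0"
  shows "jones_fig8 N (exp (\<xi> / of_nat N)) =
    exp (2 * pi * \<i> * of_nat p * \<kappa> * of_nat N / \<xi>) * (\<Sum>j=1..N. F N (of_real \<kappa> - of_nat j * mesh N))"
proof -
  have "jones_fig8 N (exp (\<xi> / of_nat N)) = (\<Sum>k<N. F N (of_nat k * mesh N))"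
    unfolding jones_fig8_def mesh_def[symmetric] by (intro sum.cong refl jones_term_eq_F N) auto
  also have "\<dots> = (\<Sum>j=1..N. F N (of_nat (N - j) * mesh N))"
    by (rule sum.reindex_bij_witness[of _ "\<lambda>j. N - j" "\<lambda>k. N - k"]) auto
  also have "\<dots> = (\<Sum>j=1..N. exp (2 * pi * \<i> * of_nat p * \<kappa> * of_nat N / \<xi>) * F N (of_real \<kappa> - of_nat j * mesh N))"
  proof (rule sum.cong[OF refl])
    fix j assume j: "j \<in> {1..N}"
    have "of_nat N * mesh N = \<xi>" using N by (simp add: mesh_def)
    hence "of_nat (N - j) * mesh N = (of_real \<kappa> - of_nat j * mesh N) + of_nat p * (2 * pi * \<i>)"
      using j by (simp add: of_nat_diff xi_def algebra_simps)
    moreover have "exp (2 * pi * \<i> * \<kappa> / mesh N) ^ p = exp (2 * pi * \<i> * of_nat p * \<kappa> * of_nat N / \<xi>)"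
      unfolding exp_of_nat_mult[symmetric] mesh_def by (simp add: field_simps)
    ultimately show "F N (of_nat (N - j) * mesh N) = exp (2 * pi * \<i> * of_nat p * \<kappa> * of_nat N / \<xi>) * F N (of_real \<kappa> - of_nat j * mesh N)"
      using F_plus_2pi_nat[of N "of_real \<kappa> - of_nat j * mesh N" p] by (simp only:)
  qed
  finally show ?thesis by (simp add: sum_distrib_left)
qed

section \<open>The dual side: \<open>jones_fig8 p\<close> at exp (4 pi^2 N / xi)\<close>

lemma Re_dual: "Re (4 * (of_real pi)\<^sup>2 / mesh N) = 4 * pi\<^sup>2 * \<kappa> / (norm \<xi>)\<^sup>2 * real N"
proof -
  have "4 * (of_real pi)\<^sup>2 / mesh N = of_real (4 * pi\<^sup>2 * real N) / \<xi>" by (simp add: mesh_def)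
  also have "Re \<dots> = 4 * pi\<^sup>2 * real N * \<kappa> / (norm \<xi>)\<^sup>2"
    by (simp add: Re_divide cmod_power2 del: of_real_mult of_real_power)
  finally show ?thesis by simp
qed

text \<open>With m = p - 1, the relation xi = kappa + 2 pi i p gives 4 pi^2 p m / xi + 2 pi i kappa
  / xi = 2 pi i p kappa / xi - 2 pi i m. After multiplication by N the last term is invisible to
  exp.\<close>

lemma jones_dual_asymp:
  "(\<lambda>N. jones_fig8 p (exp (4 * pi\<^sup>2 * of_nat N / \<xi>)) * exp (2 * of_real \<kappa> * pi * \<i> / \<xi> * of_nat N)
     / exp (2 * pi * \<i> * of_nat p * \<kappa> * of_nat N / \<xi>)) \<longlonglongrightarrow> 1"
proof -
  define Q where "Q N = exp (4 * pi\<^sup>2 * of_nat N / \<xi>)" for N :: nat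
  have "filterlim (\<lambda>N. norm (Q N)) at_top sequentially"
  proof -
    have c: "4 * pi\<^sup>2 * \<kappa> / (norm \<xi>)\<^sup>2 > 0" using kappa_pos by simp
    have "norm (Q N) = exp (4 * pi\<^sup>2 * \<kappa> / (norm \<xi>)\<^sup>2 * real N)" for N
      using Re_dual[of N] by (simp add: Q_def mesh_def)
    moreover have "filterlim (\<lambda>N. exp (4 * pi\<^sup>2 * \<kappa> / (norm \<xi>)\<^sup>2 * real N)) at_top sequentially"
      by (intro filterlim_compose[OF exp_at_top] filterlim_tendsto_pos_mult_at_top[OF tendsto_const c] filterlim_real_sequentially)
    ultimately show ?thesis by simp
  qed
  hence "filterlim Q at_infinity sequentially" by (rule filterlim_norm_at_top_imp_at_infinity)
  from filterlim_compose[OF jones_fig8_at_infinity[OF p_pos] this]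
  have "(\<lambda>N. jones_fig8 p (Q N) / Q N ^ (p * (p - 1))) \<longlonglongrightarrow> 1" .
  moreover have E: "Q N ^ (p * (p - 1)) * exp (2 * of_real \<kappa> * pi * \<i> / \<xi> * of_nat N)
      = exp (2 * pi * \<i> * of_nat p * \<kappa> * of_nat N / \<xi>)" for N
  proof -
    define m where "m = p - 1"
    have pm: "of_nat p = (of_nat m + 1 :: complex)" using p_pos by (simp add: m_def)
    have "of_nat (p * m) * (4 * pi\<^sup>2 * of_nat N / \<xi>) + 2 * of_real \<kappa> * pi * \<i> / \<xi> * of_nat N
        = 2 * pi * \<i> * of_nat p * \<kappa> * of_nat N / \<xi> - 2 * pi * \<i> * of_nat m * of_nat N * (\<xi> / \<xi>)"
    proof -
      have "of_nat (p * m) * (4 * pi\<^sup>2) + 2 * of_real \<kappa> * pi * \<i>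
          = 2 * pi * \<i> * of_nat p * \<kappa> - 2 * pi * \<i> * of_nat m * \<xi>"
        unfolding xi_def of_nat_mult pm by (simp add: algebra_simps power2_eq_square)
      from arg_cong[OF this, of "\<lambda>z. z * of_nat N / \<xi>"] show ?thesis
        by (simp add: algebra_simps add_divide_distrib diff_divide_distrib)
    qed
    hence "of_nat (p * m) * (4 * pi\<^sup>2 * of_nat N / \<xi>) + 2 * of_real \<kappa> * pi * \<i> / \<xi> * of_nat N
        = 2 * pi * \<i> * of_nat p * \<kappa> * of_nat N / \<xi> - of_int (int (m * N)) * (2 * pi) * \<i>"
      by (simp add: algebra_simps)
    moreover have "exp (of_int (int (m * N)) * (2 * pi) * \<i>) = 1"
      using exp_integer_2pi[of "of_int (int (m * N))"] by (simp add: mult_ac)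
    ultimately have "exp (of_nat (p * m) * (4 * pi\<^sup>2 * of_nat N / \<xi>) + 2 * of_real \<kappa> * pi * \<i> / \<xi> * of_nat N)
       = exp (2 * pi * \<i> * of_nat p * \<kappa> * of_nat N / \<xi>)"
      by (simp only: exp_diff div_by_1)
    thus ?thesis unfolding Q_def m_def[symmetric] exp_of_nat_mult[symmetric] exp_add[symmetric] by simp
  qed
  moreover have "jones_fig8 p (Q N) / Q N ^ (p * (p - 1)) = jones_fig8 p (Q N) * exp (2 * of_real \<kappa> * pi * \<i> / \<xi> * of_nat N) /
      (Q N ^ (p * (p - 1)) * exp (2 * of_real \<kappa> * pi * \<i> / \<xi> * of_nat N))" for N
    by simp
  ultimately have "(\<lambda>N. jones_fig8 p (Q N) * exp (2 * of_real \<kappa> * pi * \<i> / \<xi> * of_nat N) /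
      (Q N ^ (p * (p - 1)) * exp (2 * of_real \<kappa> * pi * \<i> / \<xi> * of_nat N))) \<longlonglongrightarrow> 1"
    by (simp only:)
  thus ?thesis unfolding E unfolding Q_def .
qed

end

section \<open>The potential function\<close>

lemma cosh_ge_quadratic: "cosh x \<ge> 1 + x\<^sup>2 / 2" for x :: real
proof -
  have "(\<Sum>n<3. if even n then x ^ n /\<^sub>R fact n else 0) \<le> (\<Sum>n. if even n then x ^ n /\<^sub>R fact n else 0)"
    by (rule sum_le_suminf[OF sums_summable[OF cosh_converges]]) (auto simp: zero_le_even_power)
  also have "\<dots> = cosh x" using cosh_converges[of x] by (simp add: sums_iff)
  finally have "(\<Sum>n<3. if even n then x ^ n /\<^sub>R fact n else 0) \<le> cosh x" .
  thus ?thesis by (simp add: numeral_3_eq_3 power2_eq_square)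
qed

lemma ln_cosh_upper:
  fixes x :: real
  assumes "3 - 2 * cosh x > 0"
  shows "ln (3 - 2 * cosh x) \<le> - x\<^sup>2"
  using ln_le_minus_one[OF assms] cosh_ge_quadratic[of x] by simp

text \<open>3 - 2 cos y = 1 + u with u = 4 sin^2 (y/2) and sin (y/2) >= y/4, so u >= y^2/4. As u <=
  4, ln (1 + u) >= u/(1 + u) >= u/5; hence the 20.\<close>

lemma ln_cos_lower:
  fixes y :: real
  assumes "0 \<le> y" "y \<le> pi"
  shows "ln (3 - 2 * cos y) \<ge> y\<^sup>2 / 20"
proof -
  define s where "s = sin (y / 2)"
  have c: "2 - 2 * cos y = 4 * s\<^sup>2"
    using cos_double_sin[of "y / 2"] by (simp add: s_def)
  have "\<bar>s - y / 2\<bar> \<le> \<bar>y / 2\<bar> ^ 3 / 6"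
    using Maclaurin_sin_bound[of "y / 2" 3]
    by (simp add: s_def numeral_3_eq_3 sin_coeff_def fact_numeral inverse_eq_divide)
  moreover have "\<bar>y / 2\<bar> = y / 2" using assms(1) by simp
  ultimately have s1: "s \<ge> y / 2 - (y / 2) ^ 3 / 6" by (simp only: abs_le_iff) simp
  \<comment> \<open>(3.15/2)^2 < 3, so the cubic Taylor term takes away at most half of y/2.\<close>
  have "y \<le> 3.15" using assms(2) pi_approx(2) by simp
  hence "(y / 2) * (y / 2) \<le> (3.15 / 2) * (3.15 / 2)"
    by (intro mult_mono) (use assms(1) in auto)
  hence "(y / 2) * (y / 2) * (y / 2) \<le> 3 * (y / 2)"
    by (intro mult_right_mono) (use assms(1) in auto)
  hence "(y / 2) ^ 3 \<le> 3 * (y / 2)" by (simp add: power3_eq_cube)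
  hence "s \<ge> y / 4" using s1 by simp
  hence "s\<^sup>2 \<ge> (y / 4)\<^sup>2" using assms(1) by (intro power_mono) auto
  hence z: "4 * s\<^sup>2 \<ge> y\<^sup>2 / 4" by (simp add: power_divide)
  have z1: "4 * s\<^sup>2 \<le> 4" using sin_squared_eq[of "y / 2"] by (simp add: s_def)
  have pos: "1 + 4 * s\<^sup>2 > 0" by (simp add: add_pos_nonneg)
  have "- ln (1 + 4 * s\<^sup>2) = ln (1 / (1 + 4 * s\<^sup>2))" using pos by (simp add: ln_div)
  also have "\<dots> \<le> 1 / (1 + 4 * s\<^sup>2) - 1" using pos by (intro ln_le_minus_one) simp
  also have "\<dots> = - (4 * s\<^sup>2 / (1 + 4 * s\<^sup>2))" using pos by (simp add: field_simps)
  finally have "ln (1 + 4 * s\<^sup>2) \<ge> 4 * s\<^sup>2 / (1 + 4 * s\<^sup>2)" by simp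
  moreover have "4 * s\<^sup>2 / (1 + 4 * s\<^sup>2) \<ge> 4 * s\<^sup>2 / 5"
    using z1 pos by (intro divide_left_mono) auto
  ultimately have "y\<^sup>2 / 20 \<le> ln (1 + 4 * s\<^sup>2)" using z by linarith
  moreover have "3 - 2 * cos y = 1 + 4 * s\<^sup>2" using c by simp
  ultimately show ?thesis by (simp only:)
qed

context fig8_kappa
begin

text \<open>
  \<open>N V / \<xi>\<close> is the leading exponent of \<open>F N\<close>; \<open>V' t = ln (3 - 2 cosh t)\<close>, so the critical point
  \<open>t = 0\<close> is degenerate: \<open>V t = - t ^ 3 / 3 + O (t ^ 5)\<close>. This is the origin of the power \<open>N powr (2/3)\<close>
  and of \<open>\<Gamma>(1/3)\<close>.
\<close>

definition V :: "complex \<Rightarrow> complex" where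
  "V t = of_real \<kappa> * t - dilog (exp (t - of_real \<kappa>)) + dilog (exp (- t - of_real \<kappa>))"

definition Psi :: "complex \<Rightarrow> real" where "Psi t = Re (V t / \<xi>)"

text \<open>The order N^0 of the expansion. The two quantum dilogarithms contribute half logarithms
  with opposite signs; the factor 1 - exp (- t - kappa) of \<open>F\<close> turns the second sign
  around.\<close>

definition amplitude :: "complex \<Rightarrow> complex" where
  "amplitude t = exp ((Ln (1 - exp (t - of_real \<kappa>)) + Ln (1 - exp (- t - of_real \<kappa>))) / 2) / (1 - exp (- of_real \<kappa>))"

lemma V_0: "V 0 = 0" by (simp add: V_def)

lemma amplitude_0: "amplitude 0 = 1"
  using one_minus_exp_minus_kappa_nonzero by (simp add: amplitude_def)

section \<open>Approximation of \<open>F\<close> by the potential\<close>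

lemma qpoch_eq_exp:
  assumes "N > 0" "Re t < \<kappa>"
  shows "qpoch (mesh N) (exp (t - of_real \<kappa>)) = exp (- qlog (mesh N) (exp (t - of_real \<kappa>)))"
  using qpoch_eq_qexp[OF Re_mesh_pos[OF assms(1)], of "exp (t - of_real \<kappa>)"] assms(2) by (simp add: qexp_def)

lemma F_eq_exp:
  assumes "N > 0" "Re t < \<kappa>" "Re t > - \<kappa>"
  shows "F N t = exp (of_nat N / \<xi> * (of_real \<kappa> * t) - qlog (mesh N) (exp (t - of_real \<kappa>)) + qlog (mesh N) (exp (- t - of_real \<kappa>)))
     * ((1 - exp (- t - of_real \<kappa>)) / (1 - exp (- of_real \<kappa>)))"
proof -
  have "of_real \<kappa> * t / mesh N = of_nat N / \<xi> * (of_real \<kappa> * t)" by (simp add: mesh_def)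
  thus ?thesis unfolding F_def qpoch_eq_exp[OF assms(1,2)] qexp_def
    by (simp add: exp_add exp_diff exp_minus inverse_eq_divide)
qed

text \<open>For Re t <= kappa/2 both arguments stay in the disc of radius exp (- kappa/2), where the
  sharp estimate of \<open>qlog_asymp\<close> is uniform, whatever Im t is.\<close>

lemma F_asymp_precise:
  obtains C where "C > 0"
    "\<And>N t. N > 0 \<Longrightarrow> 0 \<le> Re t \<Longrightarrow> Re t \<le> \<kappa> / 2 \<Longrightarrow>
      \<exists>E. norm E \<le> C / real N \<and> F N t = exp (of_nat N / \<xi> * V t + E) * amplitude t"
proof -
  obtain C where C: "C > 0"
    "\<And>N z. N > 0 \<Longrightarrow> norm z < 1 \<Longrightarrow>
       norm (qlog (\<xi> / of_nat N) z - (of_nat N / \<xi> * dilog z - Ln (1 - z) / 2)) \<le> C / real N * (norm z / (1 - norm z))"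
    using qlog_asymp[of \<xi>] kappa_pos unfolding Re_xi by metis
  define \<rho> where "\<rho> = exp (- \<kappa> / 2)"
  have \<rho>: "\<rho> < 1" "\<rho> > 0" using kappa_pos by (auto simp: \<rho>_def)
  define C' where "C' = 2 * C * (1 / (1 - \<rho>))"
  have C': "C' > 0" using C(1) \<rho> by (simp add: C'_def)
  have b: "norm (qlog (mesh N) z - (of_nat N / \<xi> * dilog z - Ln (1 - z) / 2)) \<le> C' / 2 / real N"
    if "N > 0" "norm z \<le> \<rho>" for N z
  proof -
    have "norm z / (1 - norm z) \<le> 1 / (1 - \<rho>)"
      using that \<rho> by (intro frac_le) auto
    hence "C / real N * (norm z / (1 - norm z)) \<le> C / real N * (1 / (1 - \<rho>))"
      using C(1) by (intro mult_left_mono) auto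
    moreover have "C / real N * (1 / (1 - \<rho>)) = C' / 2 / real N" by (simp add: C'_def divide_simps)
    moreover have "norm z < 1" using that \<rho> by linarith
    ultimately show ?thesis using C(2)[OF that(1), of z] unfolding mesh_def by linarith
  qed
  show ?thesis
  proof (rule that[OF C'])
    fix N :: nat and t assume N: "N > 0" and t: "0 \<le> Re t" "Re t \<le> \<kappa> / 2"
    define z1 where "z1 = exp (t - of_real \<kappa>)"
    define z2 where "z2 = exp (- t - of_real \<kappa>)"
    have z: "norm z1 \<le> \<rho>" "norm z2 \<le> \<rho>"
      unfolding z1_def z2_def \<rho>_def using t by auto
    define E1 where "E1 = qlog (mesh N) z1 - (of_nat N / \<xi> * dilog z1 - Ln (1 - z1) / 2)"
    define E2 where "E2 = qlog (mesh N) z2 - (of_nat N / \<xi> * dilog z2 - Ln (1 - z2) / 2)"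
    have E: "norm (E2 - E1) \<le> C' / real N"
      using norm_triangle_ineq4[of E2 E1] b[OF N z(1)] b[OF N z(2)] unfolding E1_def E2_def by simp
    have n2: "1 - z2 \<noteq> 0" using z \<rho> by auto
    have "F N t = exp (of_nat N / \<xi> * (of_real \<kappa> * t) - qlog (mesh N) z1 + qlog (mesh N) z2)
       * ((1 - z2) / (1 - exp (- of_real \<kappa>)))"
      using F_eq_exp[OF N, of t] t kappa_pos unfolding z1_def z2_def by simp
    also have "1 - z2 = exp (Ln (1 - z2))" using n2 by simp
    also have "exp (of_nat N / \<xi> * (of_real \<kappa> * t) - qlog (mesh N) z1 + qlog (mesh N) z2)
       * (exp (Ln (1 - z2)) / (1 - exp (- of_real \<kappa>))) =
       exp (of_nat N / \<xi> * (of_real \<kappa> * t) - qlog (mesh N) z1 + qlog (mesh N) z2 + Ln (1 - z2)) / (1 - exp (- of_real \<kappa>))"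
      by (simp add: exp_add)
    also have "of_nat N / \<xi> * (of_real \<kappa> * t) - qlog (mesh N) z1 + qlog (mesh N) z2 + Ln (1 - z2)
       = (of_nat N / \<xi> * V t + (E2 - E1)) + (Ln (1 - z1) + Ln (1 - z2)) / 2"
      unfolding E1_def E2_def V_def z1_def[symmetric] z2_def[symmetric] by (simp add: field_simps)
    also have "exp \<dots> / (1 - exp (- of_real \<kappa>)) = exp (of_nat N / \<xi> * V t + (E2 - E1)) * amplitude t"
      unfolding amplitude_def z1_def[symmetric] z2_def[symmetric] by (simp add: exp_add)
    finally show "\<exists>E. norm E \<le> C' / real N \<and> F N t = exp (of_nat N / \<xi> * V t + E) * amplitude t"
      using E by blast
  qed
qed

text \<open>Reaches up to distance c/N from Re t = kappa, at the price of a factor exp (epsilon N);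
  half of epsilon pays for the dilogarithms and half for the bounded last factor of
  \<open>F\<close>.\<close>

lemma F_asymp_rough:
  assumes "c > 0" "\<epsilon> > 0"
  shows "eventually (\<lambda>N. \<forall>t. 0 \<le> Re t \<longrightarrow> Re t \<le> \<kappa> - c / real N \<longrightarrow>
     norm (F N t) \<le> exp (real N * (Psi t + \<epsilon>))) sequentially"
proof -
  have x: "Re \<xi> > 0" using kappa_pos by simp
  \<comment> \<open>The minimum with kappa is for the second argument, whose modulus is only known
    to be at most exp (- kappa).\<close>
  define d where "d = min c \<kappa>"
  have d: "d > 0" "d \<le> c" "d \<le> \<kappa>" using assms(1) kappa_pos by (auto simp: d_def)
  have e4: "\<epsilon> / 4 > 0" using assms(2) by simp
  have 1: "eventually (\<lambda>N. exp (\<epsilon> / 2 * real N) \<ge> 4) sequentially"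
    using assms(2) by real_asymp
  show ?thesis
    using 1 qlog_asymp_exp[OF x d(1) e4] eventually_gt_at_top[of 0]
  proof eventually_elim
    case (elim N)
    hence N: "N > 0" by simp
    show ?case
    proof (intro allI impI)
      fix t assume t: "0 \<le> Re t" "Re t \<le> \<kappa> - c / real N"
      have cN: "c / real N > 0" "d / real N \<le> c / real N" "d / real N \<le> \<kappa>"
        using N assms(1) d by (auto simp: divide_right_mono field_simps intro: order_trans[OF d(3)])
      define z1 where "z1 = exp (t - of_real \<kappa>)"
      define z2 where "z2 = exp (- t - of_real \<kappa>)"
      have n1: "norm z1 \<le> exp (- (d / real N))" unfolding z1_def using t cN by simp
      have n2: "norm z2 \<le> exp (- (d / real N))" unfolding z2_def using t cN by simp
      define E where "E = (of_nat N / \<xi> * dilog z1 - qlog (mesh N) z1) + (qlog (mesh N) z2 - of_nat N / \<xi> * dilog z2)"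
      have "norm (of_nat N / \<xi> * dilog z1 - qlog (mesh N) z1) \<le> \<epsilon> / 4 * real N"
        using elim(2) n1 unfolding mesh_def by (metis norm_minus_commute)
      moreover have "norm (qlog (mesh N) z2 - of_nat N / \<xi> * dilog z2) \<le> \<epsilon> / 4 * real N"
        using elim(2) n2 unfolding mesh_def by blast
      ultimately have E: "norm E \<le> \<epsilon> / 2 * real N"
        unfolding E_def by (intro order_trans[OF norm_triangle_ineq]) simp
      have "F N t = exp (of_nat N / \<xi> * (of_real \<kappa> * t) - qlog (mesh N) z1 + qlog (mesh N) z2)
         * ((1 - z2) / (1 - exp (- of_real \<kappa>)))"
        using F_eq_exp[OF N, of t] t kappa_pos cN unfolding z1_def z2_def by simp
      also have "of_nat N / \<xi> * (of_real \<kappa> * t) - qlog (mesh N) z1 + qlog (mesh N) z2 = of_nat N / \<xi> * V t + E"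
        unfolding E_def V_def z1_def[symmetric] z2_def[symmetric] by (simp add: field_simps)
      finally have f: "norm (F N t) = exp (Re (of_nat N / \<xi> * V t + E)) * (norm (1 - z2) / norm (1 - exp (- complex_of_real \<kappa>)))"
        by (simp add: norm_mult norm_divide)
      have "Re (of_nat N / \<xi> * V t) = real N * Psi t"
      proof -
        have "of_nat N / \<xi> * V t = of_real (real N) * (V t / \<xi>)" by simp
        thus ?thesis unfolding Psi_def by (metis Re_complex_of_real Im_complex_of_real times_complex.simps(1) mult_zero_left diff_zero)
      qed
      hence r: "Re (of_nat N / \<xi> * V t + E) \<le> real N * Psi t + \<epsilon> / 2 * real N"
        using E complex_Re_le_cmod[of E] by simp
      have "norm (1 - z2) \<le> 2"
      proof -
        have "norm z2 \<le> 1" unfolding z2_def using t kappa_pos by simp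
        thus ?thesis using norm_triangle_ineq4[of 1 z2] by simp
      qed
      moreover have "norm (1 - exp (- complex_of_real \<kappa>)) \<ge> 1 / 2"
        using norm_triangle_ineq2[of 1 "exp (- complex_of_real \<kappa>)"] exp_minus_kappa_le by simp
      ultimately have "norm (1 - z2) / norm (1 - exp (- complex_of_real \<kappa>)) \<le> 2 / (1 / 2)"
        by (intro frac_le) auto
      also have "\<dots> \<le> exp (\<epsilon> / 2 * real N)" using elim(1) by simp
      finally have "norm (F N t) \<le> exp (real N * Psi t + \<epsilon> / 2 * real N) * exp (\<epsilon> / 2 * real N)"
        unfolding f using r by (intro mult_mono) auto
      also have "\<dots> = exp (real N * (Psi t + \<epsilon>))"
        by (simp add: exp_add[symmetric] algebra_simps)
      finally show "norm (F N t) \<le> exp (real N * (Psi t + \<epsilon>))" .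
    qed
  qed
qed

section \<open>Size and derivative of the potential\<close>

lemma Psi_eq: "Psi t = (\<kappa> * Re (V t) + 2 * pi * real p * Im (V t)) / (norm \<xi>)\<^sup>2"
  by (simp add: Psi_def Re_divide cmod_power2 algebra_simps)

lemma pi2_6_bounds: "1.64 \<le> pi\<^sup>2 / 6" "pi\<^sup>2 / 6 \<le> 1.645"
proof -
  have "pi * pi \<le> 3.1416 * 3.1416" by (intro mult_mono) (use pi_approx in auto)
  thus "pi\<^sup>2 / 6 \<le> 1.645" by (simp add: power2_eq_square)
  have "3.141 * 3.141 \<le> pi * pi" by (intro mult_mono) (use pi_approx in auto)
  thus "1.64 \<le> pi\<^sup>2 / 6" by (simp add: power2_eq_square)
qed

text \<open>At depth 3 the term kappa t beats the dilogarithms, bounded together by (1 + 0.39) *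
  1.645 < 2.287: Im V <= - 0.95 * 3 + 2.287 = - 0.563 while Re V <= 3.287. As 2 pi p >= 6.28, the
  weighted sum is at most 3.287 - 6.28 * 0.563 < - 0.2 for every p.\<close>

lemma Psi_low:
  assumes "0 \<le> Re t" "Re t \<le> \<kappa>" "Im t \<le> - 3"
  shows "Psi t \<le> - 0.2 / (norm \<xi>)\<^sup>2"
proof -
  define A where "A = dilog (exp (- t - of_real \<kappa>)) - dilog (exp (t - of_real \<kappa>))"
  have a: "norm (dilog (exp (t - of_real \<kappa>))) \<le> 1.645"
  proof -
    have n: "norm (exp (t - of_real \<kappa>)) \<le> 1" using assms by simp
    have "norm (exp (t - of_real \<kappa>)) * (pi\<^sup>2 / 6) \<le> 1 * (pi\<^sup>2 / 6)" by (rule mult_right_mono[OF n]) simp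
    thus ?thesis using norm_dilog_le[OF n] pi2_6_bounds by linarith
  qed
  have b: "norm (dilog (exp (- t - of_real \<kappa>))) \<le> 0.39 * 1.645"
  proof -
    have "norm (exp (- t - of_real \<kappa>)) \<le> exp (- \<kappa>)" using assms by simp
    hence n: "norm (exp (- t - of_real \<kappa>)) \<le> 0.39" using exp_minus_kappa_le by linarith
    have "norm (exp (- t - of_real \<kappa>)) * (pi\<^sup>2 / 6) \<le> 0.39 * 1.645"
      by (intro mult_mono n pi2_6_bounds) auto
    moreover have "norm (exp (- t - of_real \<kappa>)) \<le> 1" by (rule order_trans[OF n]) simp
    ultimately show ?thesis using norm_dilog_le[of "exp (- t - of_real \<kappa>)"] by linarith
  qed
  have A: "norm A \<le> 2.287"
    unfolding A_def using norm_triangle_ineq4[of "dilog (exp (- t - of_real \<kappa>))" "dilog (exp (t - of_real \<kappa>))"] a b by simp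
  have V: "V t = of_real \<kappa> * t + A" by (simp add: V_def A_def)
  have "\<kappa> * Re t \<le> 1 * 1" by (intro mult_mono) (use assms kappa_le kappa_pos in auto)
  hence re: "Re (V t) \<le> 3.287" unfolding V using A complex_Re_le_cmod[of A] by simp
  have r: "\<kappa> * Re (V t) \<le> 3.287"
  proof -
    have "\<kappa> * Re (V t) \<le> \<kappa> * 3.287" by (rule mult_left_mono[OF re]) (use kappa_pos in simp)
    also have "\<dots> \<le> 1 * 3.287" by (rule mult_right_mono) (use kappa_le in auto)
    finally show ?thesis by simp
  qed
  have "\<kappa> * 3 \<le> \<kappa> * (- Im t)" by (rule mult_left_mono) (use assms kappa_pos in auto)
  hence im: "Im (V t) \<le> - 0.563" unfolding V using A abs_Im_le_cmod[of A] kappa_ge by simp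
  have "6.28 \<le> 2 * pi * real p"
  proof -
    have "6.28 * 1 \<le> 2 * pi * real p" by (intro mult_mono) (use p_pos pi_approx in auto)
    thus ?thesis by simp
  qed
  hence "2 * pi * real p * Im (V t) \<le> 6.28 * (- 0.563)"
    using mult_mono[of "6.28" "2 * pi * real p" "0.563" "- Im (V t)"] im by simp
  hence "\<kappa> * Re (V t) + 2 * pi * real p * Im (V t) \<le> - 0.2" using r by simp
  thus ?thesis unfolding Psi_eq by (rule divide_right_mono) simp
qed

lemma has_field_derivative_V:
  assumes "\<bar>Re t\<bar> < \<kappa>"
  shows "(V has_field_derivative (of_real \<kappa> + Ln (1 - exp (t - of_real \<kappa>)) + Ln (1 - exp (- t - of_real \<kappa>)))) (at t)"
proof -
  have n: "norm (exp (t - of_real \<kappa>)) < 1" "norm (exp (- t - of_real \<kappa>)) < 1" using assms by auto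
  have "((\<lambda>t. of_real \<kappa> * t - dilog (exp (t - of_real \<kappa>)) + dilog (exp (- t - of_real \<kappa>))) has_field_derivative
     (of_real \<kappa> - (- Ln (1 - exp (t - of_real \<kappa>)) * 1) + (- Ln (1 - exp (- t - of_real \<kappa>)) * (- 1)))) (at t)"
    by (intro DERIV_add DERIV_diff has_field_derivative_dilog_exp n) (auto intro!: derivative_eq_intros)
  thus ?thesis unfolding V_def[abs_def] by simp
qed

lemma cosh_product: "3 - 2 * cosh x = exp \<kappa> * (1 - exp (x - \<kappa>)) * (1 - exp (- x - \<kappa>))"
proof -
  have a: "exp \<kappa> * exp (x - \<kappa>) = exp x" by (simp add: exp_add[symmetric])
  have b: "exp \<kappa> * exp (- x - \<kappa>) = exp (- x)" by (simp add: exp_add[symmetric])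
  have c: "exp x * exp (- x - \<kappa>) = exp (- \<kappa>)" by (simp add: exp_add[symmetric])
  have s: "exp \<kappa> + exp (- \<kappa>) = 3" unfolding exp_kappa exp_minus_kappa by (simp add: field_simps)
  have "exp \<kappa> * (1 - exp (x - \<kappa>)) * (1 - exp (- x - \<kappa>)) =
     exp \<kappa> - exp \<kappa> * exp (x - \<kappa>) - exp \<kappa> * exp (- x - \<kappa>) + (exp \<kappa> * exp (x - \<kappa>)) * exp (- x - \<kappa>)"
    by (simp add: algebra_simps)
  also have "\<dots> = (exp \<kappa> + exp (- \<kappa>)) - (exp x + exp (- x))" unfolding a b c by simp
  finally show ?thesis unfolding s by (simp add: cosh_field_def add_divide_distrib)
qed

lemma cosh_kappa_pos: "\<bar>x\<bar> < \<kappa> \<Longrightarrow> 3 - 2 * cosh x > 0"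
  unfolding cosh_product by (intro mult_pos_pos) auto

lemma V_derivative_real:
  assumes "\<bar>x\<bar> < \<kappa>"
  shows "of_real \<kappa> + Ln (1 - exp (of_real x - of_real \<kappa>)) + Ln (1 - exp (- of_real x - of_real \<kappa>))
     = complex_of_real (ln (3 - 2 * cosh x))"
proof -
  have p: "1 - exp (x - \<kappa>) > 0" "1 - exp (- x - \<kappa>) > 0" using assms by auto
  have "Ln (1 - exp (of_real x - of_real \<kappa>)) = of_real (ln (1 - exp (x - \<kappa>)))"
    using Ln_of_real[OF p(1)] by (simp flip: exp_of_real)
  moreover have "Ln (1 - exp (- of_real x - of_real \<kappa>)) = of_real (ln (1 - exp (- x - \<kappa>)))"
    using Ln_of_real[OF p(2)] by (simp flip: exp_of_real)
  moreover have "ln (3 - 2 * cosh x) = \<kappa> + ln (1 - exp (x - \<kappa>)) + ln (1 - exp (- x - \<kappa>))"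
    unfolding cosh_product using p by (simp add: ln_mult)
  ultimately show ?thesis by simp
qed

text \<open>On the imaginary axis the two logarithms are complex conjugates, so they add up to ln
  |z|^2 with no branch correction, and exp kappa |z|^2 = 3 - 2 cos y.\<close>

lemma V_derivative_imag:
  "of_real \<kappa> + Ln (1 - exp (- (\<i> * of_real y) - of_real \<kappa>)) + Ln (1 - exp (- (- (\<i> * of_real y)) - of_real \<kappa>))
     = complex_of_real (ln (3 - 2 * cos y))"
proof -
  define z where "z = 1 - exp (\<i> * of_real y - of_real \<kappa>)"
  have "norm (exp (\<i> * of_real y - of_real \<kappa>)) < 1" using kappa_pos by simp
  hence re: "Re z > 0" unfolding z_def
    using complex_Re_le_cmod[of "exp (\<i> * of_real y - of_real \<kappa>)"] by (simp del: norm_exp_eq_Re)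
  hence nz: "z \<noteq> 0" "z \<notin> \<real>\<^sub>\<le>\<^sub>0" by (auto simp: complex_nonpos_Reals_iff)
  have c: "1 - exp (- (\<i> * of_real y) - of_real \<kappa>) = cnj z"
    unfolding z_def by (simp add: exp_cnj)
  have "Ln (cnj z) + Ln z = cnj (Ln z) + Ln z" using cnj_Ln[OF nz(2)] by simp
  also have "\<dots> = of_real (2 * Re (Ln z))" by (simp add: complex_eq_iff)
  also have "2 * Re (Ln z) = ln ((norm z)\<^sup>2)" using nz by (simp add: Re_Ln ln_realpow)
  finally have l: "Ln (cnj z) + Ln z = of_real (ln ((norm z)\<^sup>2))" .
  have nn: "(norm z)\<^sup>2 = (1 - exp (- \<kappa>) * cos y)\<^sup>2 + (exp (- \<kappa>) * sin y)\<^sup>2"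
    unfolding cmod_power2 z_def by (simp add: Re_exp Im_exp)
  also have "\<dots> = 1 - 2 * exp (- \<kappa>) * cos y + (exp (- \<kappa>))\<^sup>2 * ((cos y)\<^sup>2 + (sin y)\<^sup>2)"
    by (simp add: power2_eq_square algebra_simps del: sin_cos_squared_add sin_cos_squared_add2 sin_cos_squared_add3)
  finally have nn: "(norm z)\<^sup>2 = 1 - 2 * exp (- \<kappa>) * cos y + (exp (- \<kappa>))\<^sup>2" by simp
  have s: "exp \<kappa> + exp (- \<kappa>) = 3" unfolding exp_kappa exp_minus_kappa by (simp add: field_simps)
  have e: "exp \<kappa> * exp (- \<kappa>) = 1" by (simp add: exp_add[symmetric])
  have "exp \<kappa> * (norm z)\<^sup>2 = exp \<kappa> - 2 * (exp \<kappa> * exp (- \<kappa>)) * cos y + (exp \<kappa> * exp (- \<kappa>)) * exp (- \<kappa>)"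
    unfolding nn by (simp add: algebra_simps power2_eq_square)
  also have "\<dots> = 3 - 2 * cos y" unfolding e using s by simp
  finally have "ln (3 - 2 * cos y) = ln (exp \<kappa> * (norm z)\<^sup>2)" by simp
  also have "\<dots> = \<kappa> + ln ((norm z)\<^sup>2)" using nz by (subst ln_mult) auto
  finally show ?thesis unfolding c using l by (simp add: z_def algebra_simps)
qed

text \<open>Real profiles of \<open>V\<close> along the two edges that meet at 0. The factor i in
  the second compensates for the direction - i of that edge; that nothing is lost by taking real
  parts is shown in \<open>V_real_eq\<close> and \<open>V_imag_eq\<close>.\<close>

definition V_on_real :: "real \<Rightarrow> real" where "V_on_real x = Re (V (of_real x))"
definition V_on_imag :: "real \<Rightarrow> real" where "V_on_imag y = Re (\<i> * V (- (\<i> * of_real y)))"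

lemma DERIV_V_real:
  assumes "\<bar>x\<bar> < \<kappa>"
  shows "((\<lambda>x. V (of_real x)) has_vector_derivative of_real (ln (3 - 2 * cosh x))) (at x)"
proof -
  have "(V has_field_derivative of_real (ln (3 - 2 * cosh x))) (at (of_real x))"
    using has_field_derivative_V[of "of_real x"] assms V_derivative_real[OF assms] by simp
  from has_vector_derivative_real_field[OF this] show ?thesis .
qed

lemma DERIV_V_imag:
  "((\<lambda>y. \<i> * V (- (\<i> * of_real y))) has_vector_derivative of_real (ln (3 - 2 * cos y))) (at y)"
proof -
  have 1: "(V has_field_derivative of_real (ln (3 - 2 * cos y))) (at (- (\<i> * of_real y)))"
    using has_field_derivative_V[of "- (\<i> * of_real y)"] kappa_pos V_derivative_imag[of y] by simp
  have "((\<lambda>z. \<i> * V (- (\<i> * z))) has_field_derivative \<i> * (of_real (ln (3 - 2 * cos y)) * (- \<i>))) (at (of_real y))"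
    by (intro DERIV_cmult DERIV_chain2[where f = V and g = "\<lambda>z. - (\<i> * z)", OF 1]) (auto intro!: derivative_eq_intros)
  hence "((\<lambda>z. \<i> * V (- (\<i> * z))) has_field_derivative of_real (ln (3 - 2 * cos y))) (at (of_real y))"
    by (rule DERIV_cong) (simp add: complex_eq_iff)
  from has_vector_derivative_real_field[OF this] show ?thesis .
qed

lemma DERIV_V_on_real: "\<bar>x\<bar> < \<kappa> \<Longrightarrow> (V_on_real has_real_derivative ln (3 - 2 * cosh x)) (at x)"
  using bounded_linear.has_vector_derivative[OF bounded_linear_Re DERIV_V_real[of x]]
  unfolding V_on_real_def[abs_def] has_real_derivative_iff_has_vector_derivative by simp

lemma DERIV_V_on_imag: "(V_on_imag has_real_derivative ln (3 - 2 * cos y)) (at y)"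
  using bounded_linear.has_vector_derivative[OF bounded_linear_Re DERIV_V_imag[of y]]
  unfolding V_on_imag_def[abs_def] has_real_derivative_iff_has_vector_derivative by simp

lemma continuous_V: "continuous_on {t. \<bar>Re t\<bar> \<le> \<kappa>} V"
  unfolding V_def[abs_def]
  by (intro continuous_intros continuous_on_compose2[OF continuous_on_dilog]) auto

text \<open>The derivative along the real axis is real, so Im V keeps the value 0 that it has at the
  origin.\<close>

lemma V_real_eq:
  assumes "0 \<le> x" "x \<le> \<kappa>" shows "V (of_real x) = of_real (V_on_real x)"
proof -
  have "Im (V (of_real x)) = Im (V (of_real 0))"
  proof (rule DERIV_isconst2[of 0 \<kappa> "\<lambda>x. Im (V (of_real x))" x])
    show "continuous_on {0..\<kappa>} (\<lambda>x. Im (V (of_real x)))"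
      by (intro continuous_intros continuous_on_compose2[OF continuous_V]) auto
    show "((\<lambda>x. Im (V (of_real x))) has_real_derivative 0) (at x)" if "0 < x" "x < \<kappa>" for x
      using bounded_linear.has_vector_derivative[OF bounded_linear_Im DERIV_V_real[of x]] that
      unfolding has_real_derivative_iff_has_vector_derivative by simp
  qed (use assms kappa_pos in auto)
  thus ?thesis by (simp add: V_on_real_def complex_eq_iff V_0)
qed

lemma V_imag_eq:
  assumes "0 \<le> y" shows "V (- (\<i> * of_real y)) = - \<i> * of_real (V_on_imag y)"
proof -
  have "Im (\<i> * V (- (\<i> * of_real y))) = Im (\<i> * V (- (\<i> * of_real 0)))"
  proof (rule DERIV_isconst_all[of "\<lambda>y. Im (\<i> * V (- (\<i> * of_real y)))"], rule allI)
    fix x show "((\<lambda>y. Im (\<i> * V (- (\<i> * of_real y)))) has_real_derivative 0) (at x)"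
      using bounded_linear.has_vector_derivative[OF bounded_linear_Im DERIV_V_imag[of x]]
      unfolding has_real_derivative_iff_has_vector_derivative by simp
  qed
  thus ?thesis by (simp add: V_on_imag_def complex_eq_iff V_0)
qed

lemma V_on_real_0: "V_on_real 0 = 0" and V_on_imag_0: "V_on_imag 0 = 0"
  by (simp_all add: V_on_real_def V_on_imag_def V_0)

text \<open>Integrates \<open>ln_cosh_upper\<close>. The bound serves twice: as domination near 0
  and as exponential decay beyond kappa/2.\<close>

lemma V_on_real_le:
  assumes "0 \<le> x" "x \<le> \<kappa>" shows "V_on_real x \<le> - (x ^ 3) / 3"
proof -
  have "(\<lambda>x. V_on_real x + x ^ 3 / 3) x \<le> (\<lambda>x. V_on_real x + x ^ 3 / 3) 0"
  proof (rule DERIV_nonpos_imp_decreasing_open[OF assms(1)])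
    show "continuous_on {0..x} (\<lambda>x. V_on_real x + x ^ 3 / 3)"
      unfolding V_on_real_def by (intro continuous_intros continuous_on_compose2[OF continuous_V]) (use assms in auto)
    fix y assume y: "0 < y" "y < x"
    have "((\<lambda>x. V_on_real x + x ^ 3 / 3) has_real_derivative (ln (3 - 2 * cosh y) + y\<^sup>2)) (at y)"
      by (rule derivative_eq_intros DERIV_V_on_real refl | use y assms in force)+
    moreover have "ln (3 - 2 * cosh y) + y\<^sup>2 \<le> 0"
      using ln_cosh_upper[OF cosh_kappa_pos, of y] y assms by simp
    ultimately show "\<exists>d. ((\<lambda>x. V_on_real x + x ^ 3 / 3) has_real_derivative d) (at y) \<and> d \<le> 0" by blast
  qed
  thus ?thesis by (simp add: V_on_real_0)
qed

text \<open>Integrates \<open>ln_cos_lower\<close>. The constant 1/60 only serves for domination;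
  the true coefficient 1/3 comes from \<open>V_on_imag_limit\<close>.\<close>

lemma V_on_imag_ge:
  assumes "0 \<le> y" "y \<le> pi" shows "V_on_imag y \<ge> y ^ 3 / 60"
proof -
  have "(\<lambda>x. V_on_imag x - x ^ 3 / 60) 0 \<le> (\<lambda>x. V_on_imag x - x ^ 3 / 60) y"
  proof (rule DERIV_nonneg_imp_nondecreasing[OF assms(1)])
    fix x assume x: "0 \<le> x" "x \<le> y"
    have "((\<lambda>x. V_on_imag x - x ^ 3 / 60) has_real_derivative (ln (3 - 2 * cos x) - x\<^sup>2 / 20)) (at x)"
      by (rule derivative_eq_intros DERIV_V_on_imag refl | simp)+
    moreover have "ln (3 - 2 * cos x) - x\<^sup>2 / 20 \<ge> 0"
      using ln_cos_lower[of x] x assms by simp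
    ultimately show "\<exists>d. ((\<lambda>x. V_on_imag x - x ^ 3 / 60) has_real_derivative d) (at x) \<and> d \<ge> 0" by blast
  qed
  thus ?thesis by (simp add: V_on_imag_0)
qed

lemma V_on_real_limit: "((\<lambda>x. V_on_real x / x ^ 3) \<longlongrightarrow> - 1 / 3) (at_right 0)"
proof (rule lhopital_right_0[where f' = "\<lambda>x. ln (3 - 2 * cosh x)" and g' = "\<lambda>x. 3 * x\<^sup>2"])
  have "isCont V_on_real 0" using DERIV_V_on_real[of 0] kappa_pos DERIV_isCont by auto
  thus "(V_on_real \<longlongrightarrow> 0) (at_right 0)" unfolding isCont_def V_on_real_0 by (rule tendsto_within_subset) simp
  show "\<forall>\<^sub>F x in at_right 0. (V_on_real has_real_derivative ln (3 - 2 * cosh x)) (at x)"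
    unfolding eventually_at_right_field using kappa_pos by (intro exI[of _ \<kappa>]) (auto intro!: DERIV_V_on_real)
  show "((\<lambda>x::real. ln (3 - 2 * cosh x) / (3 * x\<^sup>2)) \<longlongrightarrow> - 1 / 3) (at_right 0)"
    by real_asymp
  show "((\<lambda>x::real. x ^ 3) \<longlongrightarrow> 0) (at_right 0)" by real_asymp
  show "\<forall>\<^sub>F x in at_right 0. ((\<lambda>x::real. x ^ 3) has_real_derivative 3 * x\<^sup>2) (at x)"
    by (intro always_eventually allI) (auto intro!: derivative_eq_intros)
  show "\<forall>\<^sub>F x::real in at_right 0. x ^ 3 \<noteq> 0" "\<forall>\<^sub>F x::real in at_right 0. 3 * x\<^sup>2 \<noteq> 0"
    by (auto simp: eventually_at_filter)
qed

lemma V_on_imag_limit: "((\<lambda>x. V_on_imag x / x ^ 3) \<longlongrightarrow> 1 / 3) (at_right 0)"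
proof (rule lhopital_right_0[where f' = "\<lambda>x. ln (3 - 2 * cos x)" and g' = "\<lambda>x. 3 * x\<^sup>2"])
  have "isCont V_on_imag 0" using DERIV_V_on_imag[of 0] DERIV_isCont by auto
  thus "(V_on_imag \<longlongrightarrow> 0) (at_right 0)" unfolding isCont_def V_on_imag_0 by (rule tendsto_within_subset) simp
  show "\<forall>\<^sub>F x in at_right 0. (V_on_imag has_real_derivative ln (3 - 2 * cos x)) (at x)"
    by (intro always_eventually allI DERIV_V_on_imag)
  show "((\<lambda>x::real. ln (3 - 2 * cos x) / (3 * x\<^sup>2)) \<longlongrightarrow> 1 / 3) (at_right 0)"
    by real_asymp
  show "((\<lambda>x::real. x ^ 3) \<longlongrightarrow> 0) (at_right 0)" by real_asymp
  show "\<forall>\<^sub>F x in at_right 0. ((\<lambda>x::real. x ^ 3) has_real_derivative 3 * x\<^sup>2) (at x)"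
    by (intro always_eventually allI) (auto intro!: derivative_eq_intros)
  show "\<forall>\<^sub>F x::real in at_right 0. x ^ 3 \<noteq> 0" "\<forall>\<^sub>F x::real in at_right 0. 3 * x\<^sup>2 \<noteq> 0"
    by (auto simp: eventually_at_filter)
qed

end

section \<open>Analytic continuation to the right of the summation points\<close>

lemma Re_of_real_times: "Re (of_real r * z) = r * Re z" and Im_of_real_times: "Im (of_real r * z) = r * Im z"
  by simp_all

context fig8_kappa
begin

text \<open>The variable of \<open>jtheta\<close>: the summation point kappa - j omega has
  coordinate - j.\<close>

definition coord :: "nat \<Rightarrow> complex \<Rightarrow> complex" where
  "coord N t = (t - of_real \<kappa>) / mesh N"

text \<open>Consecutive rows of zeros of \<open>jtheta\<close> differ in |exp (2 pi i x)| by the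
  factor exp (\<open>dual_rate N\<close>).\<close>

definition dual_rate :: "nat \<Rightarrow> real" where
  "dual_rate N = 4 * pi\<^sup>2 * \<kappa> / (norm \<xi>)\<^sup>2 * real N"

definition Q :: "nat \<Rightarrow> complex \<Rightarrow> complex" where
  "Q N t = F N t / theta_factors (mesh N) (Suc p) (coord N t)"

text \<open>The modulus is 1 exactly on the line through kappa in direction xi, which carries the
  summation points; it is smaller to the left of this line and larger to the right.\<close>

lemma norm_exp_coord:
  "norm (exp (2 * pi * \<i> * coord N t)) = exp (2 * pi * real N / (norm \<xi>)\<^sup>2 * (2 * pi * real p * (Re t - \<kappa>) - \<kappa> * Im t))"
proof -
  have "coord N t = of_real (real N) * ((t - of_real \<kappa>) / \<xi>)" by (simp add: coord_def mesh_def)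
  hence "Im (coord N t) = real N * Im ((t - of_real \<kappa>) / \<xi>)" by (simp only: Im_of_real_times)
  also have "Im ((t - of_real \<kappa>) / \<xi>) = (Im t * \<kappa> - (Re t - \<kappa>) * (2 * pi * real p)) / (norm \<xi>)\<^sup>2"
    by (simp add: Im_divide cmod_power2)
  finally have i: "Im (coord N t) = real N * ((Im t * \<kappa> - (Re t - \<kappa>) * (2 * pi * real p)) / (norm \<xi>)\<^sup>2)" .
  have "- 2 * pi * Im (coord N t) = 2 * pi * real N / (norm \<xi>)\<^sup>2 * (2 * pi * real p * (Re t - \<kappa>) - \<kappa> * Im t)"
    unfolding i by (simp add: algebra_simps diff_divide_distrib add_divide_distrib)
  thus ?thesis by simp
qed

lemma Re_dual_dual_rate: "Re (4 * (of_real pi)\<^sup>2 / mesh N) = dual_rate N"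
  unfolding Re_dual dual_rate_def ..

definition cofactor :: "nat \<Rightarrow> complex \<Rightarrow> complex" where
  "cofactor N = (SOME h. h holomorphic_on UNIV \<and> (\<forall>z. h (z + 1) = h z) \<and>
      (\<forall>z. jtheta (mesh N) z = theta_factors (mesh N) (Suc p) z * h z))"

lemma cofactor:
  assumes "N > 0"
  shows "cofactor N holomorphic_on UNIV" "cofactor N (z + 1) = cofactor N z"
    "jtheta (mesh N) z = theta_factors (mesh N) (Suc p) z * cofactor N z"
  using someI_ex[OF jtheta_factor[OF Re_mesh_pos[OF assms], of "Suc p"], folded cofactor_def] by auto

text \<open>The argument tends to -1, and - Li2(-1) = pi^2/12. The range of s keeps its modulus
  below exp (- kappa/N), where \<open>qlog_asymp_exp\<close> applies.\<close>

lemma qexp_minus_one_bound: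
  assumes "\<epsilon> > 0"
  shows "eventually (\<lambda>N. \<forall>s. 1 \<le> s \<longrightarrow> s \<le> 2 \<longrightarrow>
    norm (qexp (mesh N) (- exp (- (of_real s * mesh N)))) \<le> exp (real N * (Re (of_real (pi\<^sup>2 / 12) / \<xi>) + \<epsilon>))) sequentially"
proof -
  have x: "Re \<xi> > 0" "norm \<xi> > 0" using kappa_pos by auto
  define \<epsilon>' where "\<epsilon>' = \<epsilon> / 2 * norm \<xi>"
  have e': "\<epsilon>' > 0" using assms x by (simp add: \<epsilon>'_def)
  obtain \<delta> where \<delta>: "\<delta> > 0"
    "\<And>z w. norm z \<le> 1 \<Longrightarrow> norm w \<le> 1 \<Longrightarrow> norm (z - w) < \<delta> \<Longrightarrow> norm (dilog z - dilog w) < \<epsilon>'"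
    using dilog_uniformly_close[OF e'] by metis
  have e2: "\<epsilon> / 2 > 0" using assms by simp
  obtain r where r: "r > 0" "\<And>z :: complex. norm z < r \<Longrightarrow> norm (exp z - 1) < \<delta>"
  proof -
    have "isCont (exp :: complex \<Rightarrow> complex) 0" by simp
    hence "\<exists>r>0. \<forall>z. dist z 0 < r \<longrightarrow> dist (exp z) (exp (0 :: complex)) < \<delta>"
      unfolding continuous_at_eps_delta using \<delta>(1) by blast
    thus ?thesis using that by (auto simp: dist_norm)
  qed
  have "(\<lambda>N. 2 * norm \<xi> / real N) \<longlonglongrightarrow> 0" by real_asymp
  hence 1: "eventually (\<lambda>N. 2 * norm \<xi> / real N < r) sequentially"
    using r(1) order_tendstoD(2) by blast
  show ?thesis
    using 1 qlog_asymp_exp[OF x(1) kappa_pos e2] eventually_gt_at_top[of 0]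
  proof eventually_elim
    case (elim N)
    show ?case
    proof (intro allI impI)
      fix s :: real assume s: "1 \<le> s" "s \<le> 2"
      define z where "z = - exp (- (of_real s * mesh N))"
      have "\<kappa> / real N \<le> s * (\<kappa> / real N)"
        using s kappa_pos by (simp add: mult_right_le_one_le divide_right_mono)
      hence nz: "norm z \<le> exp (- (\<kappa> / real N))" unfolding z_def by (simp add: Re_mesh)
      hence nz1: "norm z \<le> 1" by (rule order_trans) (use kappa_pos in simp)
      have "norm (- (of_real s * mesh N)) < r"
      proof -
        have "norm (- (of_real s * mesh N)) = s * (norm \<xi> / real N)"
          using s by (simp add: mesh_def norm_mult norm_divide)
        also have "\<dots> \<le> 2 * (norm \<xi> / real N)" by (rule mult_right_mono) (use s in auto)
        finally show ?thesis using elim(1) by simp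
      qed
      hence "norm (z - (- 1)) < \<delta>"
        using r(2)[of "- (of_real s * mesh N)"] unfolding z_def by (simp add: norm_minus_commute)
      hence d: "norm (dilog z - dilog (- 1)) < \<epsilon>'" using \<delta>(2)[of z "- 1"] nz1 by simp
      have q: "norm (qlog (mesh N) z - of_nat N / \<xi> * dilog z) \<le> \<epsilon> / 2 * real N"
        using elim(2) nz unfolding mesh_def by blast
      have "norm (of_nat N / \<xi> * dilog z - of_nat N / \<xi> * dilog (- 1)) = real N / norm \<xi> * norm (dilog z - dilog (- 1))"
        by (simp only: right_diff_distrib[symmetric] norm_mult norm_divide norm_of_nat)
      also have "\<dots> \<le> real N / norm \<xi> * \<epsilon>'" using d by (intro mult_left_mono) auto
      also have "\<dots> = \<epsilon> / 2 * real N" using x(2) by (simp add: \<epsilon>'_def)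
      finally have "norm (qlog (mesh N) z - of_nat N / \<xi> * dilog (- 1)) \<le> \<epsilon> * real N"
        using q norm_triangle_ineq[of "qlog (mesh N) z - of_nat N / \<xi> * dilog z" "of_nat N / \<xi> * dilog z - of_nat N / \<xi> * dilog (- 1)"]
        by simp
      hence "norm (- qlog (mesh N) z - of_nat N / \<xi> * of_real (pi\<^sup>2 / 12)) \<le> \<epsilon> * real N"
        by (subst norm_minus_cancel[symmetric]) (simp add: dilog_minus_1 mult.commute add.commute)
      hence "Re (- qlog (mesh N) z - of_nat N / \<xi> * of_real (pi\<^sup>2 / 12)) \<le> \<epsilon> * real N"
        using complex_Re_le_cmod order_trans by blast
      moreover have "Re (of_nat N / \<xi> * of_real (pi\<^sup>2 / 12)) = real N * Re (of_real (pi\<^sup>2 / 12) / \<xi>)"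
      proof -
        have "of_nat N / \<xi> * of_real (pi\<^sup>2 / 12) = of_real (real N) * (of_real (pi\<^sup>2 / 12) / \<xi>)" by simp
        thus ?thesis by (simp only: Re_of_real_times)
      qed
      ultimately have "Re (- qlog (mesh N) z) \<le> real N * (Re (of_real (pi\<^sup>2 / 12) / \<xi>) + \<epsilon>)"
        by (simp add: algebra_simps)
      thus "norm (qexp (mesh N) z) \<le> exp (real N * (Re (of_real (pi\<^sup>2 / 12) / \<xi>) + \<epsilon>))"
        by (simp add: qexp_def)
    qed
  qed
qed

text \<open>On this line exp (omega x) = - exp (r omega), half way between two rows of zeros. The
  Gaussian prefactor contributes - pi^2/2 to the coefficient of N/xi and each product pi^2/12, in
  total - pi^2/3.\<close>

lemma jtheta_bound:
  assumes "\<epsilon> > 0"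
  shows "eventually (\<lambda>N. \<forall>r. 0 \<le> r \<longrightarrow> r \<le> 1 \<longrightarrow>
    norm (jtheta (mesh N) (\<i> * pi / mesh N + of_real r)) \<le> exp (real N * (- Re (of_real (pi\<^sup>2 / 3) / \<xi>) + \<epsilon>))) sequentially"
proof -
  have e3: "\<epsilon> / 3 > 0" using assms by simp
  have 1: "eventually (\<lambda>N. exp (\<epsilon> / 3 * real N) \<ge> 16) sequentially"
    using assms by real_asymp
  show ?thesis
    using qexp_minus_one_bound[OF e3] 1 eventually_gt_at_top[of 0]
  proof eventually_elim
    case (elim N)
    hence N: "N > 0" by simp
    note w = Re_mesh_pos[OF N] and w0 = mesh_nonzero[OF N]
    show ?case
    proof (intro allI impI)
      fix r :: real assume r: "0 \<le> r" "r \<le> 1"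
      define x where "x = \<i> * pi / mesh N + of_real r"
      have wx: "mesh N * x = \<i> * pi + of_real r * mesh N" using w0 by (simp add: x_def field_simps)
      have e1: "exp (mesh N * x) = - exp (of_real r * mesh N)"
        unfolding wx exp_add by simp
      have e2: "exp (- (mesh N * (x + 1))) = - exp (- (of_real (1 + r) * mesh N))"
      proof -
        have "- (mesh N * (x + 1)) = - (of_real (1 + r) * mesh N) - pi * \<i>"
          using wx by (simp add: algebra_simps)
        thus ?thesis by (simp only: exp_diff exp_pi_i) simp
      qed
      have E: "\<i> * pi * x - mesh N * x\<^sup>2 / 2 - mesh N * x / 2
         = of_real (- pi\<^sup>2 / 2) / mesh N - of_real ((r\<^sup>2 + r) / 2) * mesh N - \<i> * pi / 2"
      proof -
        have "mesh N * x\<^sup>2 = (mesh N * x) * x" by (simp add: power2_eq_square)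
        thus ?thesis unfolding wx unfolding x_def using w0
          by (simp add: field_simps power2_eq_square)
      qed
      have nE: "norm (exp (\<i> * pi * x - mesh N * x\<^sup>2 / 2 - mesh N * x / 2)) \<le> exp (real N * (- Re (of_real (pi\<^sup>2 / 2) / \<xi>)))"
      proof -
        have "of_real (- pi\<^sup>2 / 2) / mesh N = of_real (real N) * (- (of_real (pi\<^sup>2 / 2) / \<xi>))" by (simp add: mesh_def)
        hence "Re (of_real (- pi\<^sup>2 / 2) / mesh N) = real N * (- Re (of_real (pi\<^sup>2 / 2) / \<xi>))"
          by (simp only: Re_of_real_times uminus_complex.simps)
        moreover have "(r\<^sup>2 + r) / 2 * Re (mesh N) \<ge> 0" using r w by simp
        ultimately show ?thesis unfolding E norm_exp_eq_Re by simp
      qed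
      \<comment> \<open>The first argument may lie outside the unit disc. Two uses of the recurrence
        lower the exponent from r to r - 2, so that 2 - r, like 1 + r, is in the range of
        \<open>qexp_minus_one_bound\<close>.\<close>
      have sm: "- exp (of_real r * mesh N) * exp (- mesh N) = - exp (of_real (r - 1) * mesh N)"
        and sm': "- exp (of_real (r - 1) * mesh N) * exp (- mesh N) = - exp (- (of_real (2 - r) * mesh N))"
        by (simp_all add: exp_add[symmetric] algebra_simps)
      have nl: "norm (- exp (- (of_real (2 - r) * mesh N))) < 1" using r w by simp
      have q1: "qpoch (mesh N) (- exp (of_real r * mesh N)) =
         (1 + exp (of_real r * mesh N)) * ((1 + exp (of_real (r - 1) * mesh N)) * qexp (mesh N) (- exp (- (of_real (2 - r) * mesh N))))"
        using qpoch_rec[OF w, of "- exp (of_real r * mesh N)"] qpoch_rec[OF w, of "- exp (of_real (r - 1) * mesh N)"]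
          qpoch_eq_qexp[OF w nl] unfolding sm sm' by simp
      have rw: "r * Re (mesh N) \<le> 1"
      proof -
        have "Re (mesh N) \<le> 1" using kappa_le N by (simp add: Re_mesh divide_le_eq)
        hence "r * Re (mesh N) \<le> 1 * 1" by (intro mult_mono) (use r w in auto)
        thus ?thesis by simp
      qed
      have "norm (1 + exp (of_real r * mesh N)) \<le> 4"
      proof -
        have "norm (exp (of_real r * mesh N)) \<le> exp 1" using rw by simp
        hence "norm (exp (of_real r * mesh N)) \<le> 3" using exp_le by linarith
        thus ?thesis using norm_triangle_ineq[of 1 "exp (of_real r * mesh N)"] unfolding norm_one by linarith
      qed
      moreover have "norm (1 + exp (of_real (r - 1) * mesh N)) \<le> 4"
      proof -
        have "(r - 1) * Re (mesh N) \<le> 0" using r w by (simp add: mult_nonpos_nonneg)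
        hence "norm (exp (of_real (r - 1) * mesh N)) \<le> 1" by simp
        thus ?thesis using norm_triangle_ineq[of 1 "exp (of_real (r - 1) * mesh N)"] unfolding norm_one by linarith
      qed
      moreover have qb: "norm (qexp (mesh N) (- exp (- (of_real (2 - r) * mesh N)))) \<le> exp (real N * (Re (of_real (pi\<^sup>2 / 12) / \<xi>) + \<epsilon> / 3))"
        "norm (qexp (mesh N) (- exp (- (of_real (1 + r) * mesh N)))) \<le> exp (real N * (Re (of_real (pi\<^sup>2 / 12) / \<xi>) + \<epsilon> / 3))"
        by (rule elim(1)[rule_format]; use r in simp)+
      ultimately have p1: "norm (qpoch (mesh N) (- exp (of_real r * mesh N))) \<le> 4 * (4 * exp (real N * (Re (of_real (pi\<^sup>2 / 12) / \<xi>) + \<epsilon> / 3)))"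
        unfolding q1 norm_mult by (intro mult_mono) auto
      have nl2: "norm (- exp (- (of_real (1 + r) * mesh N))) < 1" using r w by simp
      have p2: "norm (qpoch (mesh N) (- exp (- (of_real (1 + r) * mesh N)))) \<le> exp (real N * (Re (of_real (pi\<^sup>2 / 12) / \<xi>) + \<epsilon> / 3))"
        unfolding qpoch_eq_qexp[OF w nl2] by (rule qb(2))
      have "norm (jtheta (mesh N) x) \<le> exp (real N * (- Re (of_real (pi\<^sup>2 / 2) / \<xi>))) *
          (4 * (4 * exp (real N * (Re (of_real (pi\<^sup>2 / 12) / \<xi>) + \<epsilon> / 3)))) *
          exp (real N * (Re (of_real (pi\<^sup>2 / 12) / \<xi>) + \<epsilon> / 3))"
        unfolding jtheta_def e1 e2 norm_mult by (intro mult_mono nE p1 p2) auto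
      also have "\<dots> = 16 * exp (real N * (- Re (of_real (pi\<^sup>2 / 2) / \<xi>) + (Re (of_real (pi\<^sup>2 / 12) / \<xi>) + \<epsilon> / 3) + (Re (of_real (pi\<^sup>2 / 12) / \<xi>) + \<epsilon> / 3)))"
      proof -
        have gen: "exp (n * a) * (4 * (4 * exp (n * b))) * exp (n * c) = 16 * exp (n * (a + b + c))" for n a b c :: real
          by (simp add: exp_add distrib_left)
        show ?thesis by (rule gen)
      qed
      also have "\<dots> \<le> exp (\<epsilon> / 3 * real N) * exp (real N * (- Re (of_real (pi\<^sup>2 / 2) / \<xi>) + (Re (of_real (pi\<^sup>2 / 12) / \<xi>) + \<epsilon> / 3) + (Re (of_real (pi\<^sup>2 / 12) / \<xi>) + \<epsilon> / 3)))"
        using elim(2) by (intro mult_right_mono) auto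
      also have "\<dots> = exp (real N * (- Re (of_real (pi\<^sup>2 / 3) / \<xi>) + \<epsilon>))"
      proof -
        have "Re (of_real (pi\<^sup>2 / 2) / \<xi>) = 6 * Re (of_real (pi\<^sup>2 / 12) / \<xi>)" "Re (of_real (pi\<^sup>2 / 3) / \<xi>) = 4 * Re (of_real (pi\<^sup>2 / 12) / \<xi>)"
        proof -
          have r: "Re (of_real c / \<xi>) = c * Re (1 / \<xi>)" for c
          proof -
            have "of_real c / \<xi> = of_real c * (1 / \<xi>)" by simp
            thus ?thesis by (simp only: Re_of_real_times)
          qed
          show "Re (of_real (pi\<^sup>2 / 2) / \<xi>) = 6 * Re (of_real (pi\<^sup>2 / 12) / \<xi>)" "Re (of_real (pi\<^sup>2 / 3) / \<xi>) = 4 * Re (of_real (pi\<^sup>2 / 12) / \<xi>)"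
            unfolding r by simp_all
        qed
        thus ?thesis unfolding exp_add[symmetric] by (simp add: algebra_simps)
      qed
      finally show "norm (jtheta (mesh N) (\<i> * pi / mesh N + of_real r)) \<le> exp (real N * (- Re (of_real (pi\<^sup>2 / 3) / \<xi>) + \<epsilon>))"
        unfolding x_def .
    qed
  qed
qed

text \<open>
  Near the line \<open>Re t = \<kappa>\<close> the approximation by \<open>V\<close> breaks down, because the factor \<open>qpoch\<close> of \<open>F\<close> has its
  zeros to the right of it. Rewriting this factor by the theta function gives the same function \<open>Q\<close> without
  poles there, so that the contour may be pushed into \<open>Re t > \<kappa>\<close>.
\<close>

definition Q_right :: "nat \<Rightarrow> complex \<Rightarrow> complex" where
  "Q_right N t = exp (of_real \<kappa> * t / mesh N) / qexp (mesh N) (exp (- t - of_real \<kappa>))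
     * ((1 - exp (- t - of_real \<kappa>)) / (1 - exp (- of_real \<kappa>)))
     * (exp (mesh N * (coord N t)\<^sup>2 / 2 + mesh N * coord N t / 2 - \<i> * pi * coord N t) / qexp (mesh N) (exp (- (mesh N * (coord N t + 1)))))
     * cofactor N (coord N t)"

lemma mesh_coord: "N > 0 \<Longrightarrow> mesh N * coord N t = t - of_real \<kappa>"
  by (simp add: coord_def mesh_nonzero)

text \<open>Solves the product formula of \<open>jtheta\<close> for the \<open>qpoch\<close> factor
  of \<open>F\<close>. Right of kappa - kappa/N the other \<open>qpoch\<close> equals
  \<open>qexp\<close>, so it can be divided by.\<close>

lemma Q_right_eq_Q:
  assumes N: "N > 0" and t: "Re t > \<kappa> - \<kappa> / N" and nz: "theta_factors (mesh N) (Suc p) (coord N t) \<noteq> 0"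
  shows "Q_right N t = Q N t"
proof -
  have wx: "mesh N * (coord N t + 1) = t - of_real \<kappa> + mesh N"
    using mesh_coord[OF N, of t] by (simp add: algebra_simps)
  have "norm (exp (- (mesh N * (coord N t + 1)))) < 1"
    unfolding wx using t by (simp add: Re_mesh)
  hence q: "qpoch (mesh N) (exp (- (mesh N * (coord N t + 1)))) = qexp (mesh N) (exp (- (mesh N * (coord N t + 1))))"
    by (rule qpoch_eq_qexp[OF Re_mesh_pos[OF N]])
  define E where "E = \<i> * pi * coord N t - mesh N * (coord N t)\<^sup>2 / 2 - mesh N * coord N t / 2"
  have E': "mesh N * (coord N t)\<^sup>2 / 2 + mesh N * coord N t / 2 - \<i> * pi * coord N t = - E" by (simp add: E_def)
  have "theta_factors (mesh N) (Suc p) (coord N t) * cofactor N (coord N t) = jtheta (mesh N) (coord N t)"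
    using cofactor(3)[OF N] by simp
  also have "\<dots> = exp E * qpoch (mesh N) (exp (t - of_real \<kappa>)) * qexp (mesh N) (exp (- (mesh N * (coord N t + 1))))"
    unfolding jtheta_def q mesh_coord[OF N] E_def ..
  finally have h: "cofactor N (coord N t) = exp E * qpoch (mesh N) (exp (t - of_real \<kappa>)) * qexp (mesh N) (exp (- (mesh N * (coord N t + 1)))) / theta_factors (mesh N) (Suc p) (coord N t)"
    using nz by (simp add: field_simps)
  have ee: "exp (- E) * exp E = 1" by (simp add: exp_add[symmetric])
  define q where "q = qexp (mesh N) (exp (- (mesh N * (coord N t + 1))))"
  define P where "P = qpoch (mesh N) (exp (t - of_real \<kappa>))"
  define D where "D = theta_factors (mesh N) (Suc p) (coord N t)"
  have "q \<noteq> 0" by (simp add: q_def)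
  hence "exp (- E) / q * (exp E * P * q / D) = (exp (- E) * exp E) * (P / D)" by simp
  hence "exp (- E) / q * (exp E * P * q / D) = P / D" unfolding ee by simp
  moreover define A where "A = exp (of_real \<kappa> * t / mesh N) / qexp (mesh N) (exp (- t - of_real \<kappa>))
     * ((1 - exp (- t - of_real \<kappa>)) / (1 - exp (- of_real \<kappa>)))"
  have "Q_right N t = A * (exp (- E) / q * (exp E * P * q / D))"
    unfolding Q_right_def E' h q_def[symmetric] P_def[symmetric] D_def[symmetric] A_def by (simp only: mult.assoc)
  moreover have "Q N t = A * (P / D)"
    unfolding Q_def F_def P_def[symmetric] D_def[symmetric] A_def divide_inverse by (simp only: mult_ac)
  ultimately show ?thesis by (simp only:)
qed

text \<open>No poles arise from \<open>theta_factors\<close>, because \<open>cofactor\<close> is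
  entire; the half-plane is where the second \<open>qexp\<close> has its argument in the unit
  disc.\<close>

lemma holomorphic_Q_right:
  assumes N: "N > 0"
  shows "Q_right N holomorphic_on {t. Re t > \<kappa> - \<kappa> / N}"
proof -
  note w = Re_mesh_pos[OF N]
  have "\<kappa> / N \<le> \<kappa>" using kappa_pos N by (simp add: divide_le_eq)
  hence sub: "Re t > 0" if "Re t > \<kappa> - \<kappa> / N" for t using that by linarith
  have 1: "(qexp (mesh N) \<circ> (\<lambda>t. exp (- t - of_real \<kappa>))) holomorphic_on {t. Re t > \<kappa> - \<kappa> / N}"
    by (rule holomorphic_on_compose_gen[OF _ holomorphic_qexp[OF w]])
       (auto intro!: holomorphic_intros, smt (verit) sub kappa_pos)
  have 2: "(qexp (mesh N) \<circ> (\<lambda>t. exp (- (mesh N * (coord N t + 1))))) holomorphic_on {t. Re t > \<kappa> - \<kappa> / N}"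
  proof (rule holomorphic_on_compose_gen[OF _ holomorphic_qexp[OF w]])
    show "(\<lambda>t. exp (- (mesh N * (coord N t + 1)))) holomorphic_on {t. \<kappa> - \<kappa> / real N < Re t}"
      unfolding coord_def by (intro holomorphic_intros mesh_nonzero N)
    show "(\<lambda>t. exp (- (mesh N * (coord N t + 1)))) ` {t. \<kappa> - \<kappa> / real N < Re t} \<subseteq> ball 0 1"
    proof (rule image_subsetI)
      fix t assume "t \<in> {t. \<kappa> - \<kappa> / real N < Re t}"
      moreover have wx: "mesh N * (coord N t + 1) = t - of_real \<kappa> + mesh N"
        using mesh_coord[OF N, of t] by (simp add: algebra_simps)
      ultimately show "exp (- (mesh N * (coord N t + 1))) \<in> ball 0 1" unfolding wx by (simp add: Re_mesh)
    qed
  qed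
  have 3: "(cofactor N \<circ> coord N) holomorphic_on {t. Re t > \<kappa> - \<kappa> / N}"
    by (rule holomorphic_on_compose_gen[OF _ cofactor(1)[OF N]])
       (auto simp: coord_def[abs_def] intro!: holomorphic_intros mesh_nonzero N)
  have 4: "coord N holomorphic_on {t. Re t > \<kappa> - \<kappa> / N}"
    unfolding coord_def[abs_def] by (intro holomorphic_intros mesh_nonzero N)
  show ?thesis unfolding Q_right_def[abs_def]
    by (intro holomorphic_intros 1[unfolded o_def] 2[unfolded o_def] 3[unfolded o_def] 4 mesh_nonzero N
        qexp_nonzero one_minus_exp_minus_kappa_nonzero) auto
qed

text \<open>
  Exponent of \<open>Q_right\<close>: the contribution \<open>- \<pi>\<^sup>2 / 3\<close> comes from \<open>jtheta_bound\<close>.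
\<close>

definition Phi :: "nat \<Rightarrow> complex \<Rightarrow> complex" where
  "Phi N t = of_real \<kappa> * t + (t - of_real \<kappa>)\<^sup>2 / 2 - \<i> * pi * (t - of_real \<kappa>) - of_real (pi\<^sup>2 / 3)
     + dilog (exp (- t - of_real \<kappa>)) + dilog (exp (- (t - of_real \<kappa> + mesh N)))"

text \<open>\<open>jtheta_quotient_bound\<close> carries \<open>jtheta_bound\<close> from one line
  to the cofactor on the whole box, and \<open>qlog_asymp_exp\<close> treats both
  \<open>qexp\<close> factors. Starting at kappa - kappa/(2N) keeps the second argument below exp (-
  kappa/(2N)).\<close>

lemma Q_right_bound:
  assumes "\<epsilon> > 0"
  shows "eventually (\<lambda>N. \<forall>t. \<kappa> - \<kappa> / (2 * real N) \<le> Re t \<longrightarrow> Re t \<le> \<kappa> + \<kappa> / 2 \<longrightarrow> - pi \<le> Im t \<longrightarrow> Im t \<le> 0 \<longrightarrow>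
     norm (Q_right N t) \<le> exp (real N * (Re (Phi N t / \<xi>) + \<epsilon>))) sequentially"
proof -
  have x: "Re \<xi> > 0" "norm \<xi> > 0" using kappa_pos by auto
  have e4: "\<epsilon> / 4 > 0" using assms by simp
  have k2: "\<kappa> / 2 > 0" using kappa_pos by simp
  define K where "K = 4 * exp (\<kappa> / 2) * 2 ^ Suc p"
  have 1: "eventually (\<lambda>N. exp (\<epsilon> / 4 * real N) \<ge> K) sequentially"
    using assms by real_asymp
  have "filterlim dual_rate at_top sequentially"
    unfolding dual_rate_def[abs_def]
    by (intro filterlim_tendsto_pos_mult_at_top[OF tendsto_const] filterlim_real_sequentially) (use x kappa_pos in simp)
  hence 2: "eventually (\<lambda>N. dual_rate N \<ge> 2) sequentially" by (simp add: filterlim_at_top)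
  show ?thesis
    using jtheta_bound[OF e4] 1 2 qlog_asymp_exp[OF x(1) k2 e4] eventually_gt_at_top[of 0] eventually_ge_at_top[of p]
  proof eventually_elim
    case (elim N)
    hence N: "N > 0" and Np: "N \<ge> p" by auto
    note w = Re_mesh_pos[OF N] and w0 = mesh_nonzero[OF N]
    show ?case
    proof (intro allI impI)
      fix t assume t: "\<kappa> - \<kappa> / (2 * real N) \<le> Re t" "Re t \<le> \<kappa> + \<kappa> / 2" "- pi \<le> Im t" "Im t \<le> 0"
      define c where "c = 2 * pi * real N / (norm \<xi>)\<^sup>2"
      have c: "c > 0" using N x by (simp add: c_def)
      have T: "dual_rate N = c * (2 * pi * \<kappa>)" by (simp add: dual_rate_def c_def power2_eq_square)
      have nX: "norm (exp (2 * pi * \<i> * coord N t)) = exp (c * (2 * pi * real p * (Re t - \<kappa>) - \<kappa> * Im t))"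
        unfolding norm_exp_coord c_def ..
      \<comment> \<open>Going left of kappa by at most kappa/(2N), with N >= p, lowers the exponent
        by no more than c pi kappa, which is half of \<open>dual_rate N\<close>.\<close>
      have X1: "exp (- dual_rate N / 2) \<le> norm (exp (2 * pi * \<i> * coord N t))"
      proof -
        have "\<kappa> / (2 * real N) * real p \<le> \<kappa> / 2" using Np N kappa_pos by (simp add: field_simps)
        moreover have "(\<kappa> - Re t) * real p \<le> \<kappa> / (2 * real N) * real p" by (rule mult_right_mono) (use t in auto)
        ultimately have a: "(\<kappa> - Re t) * real p \<le> \<kappa> / 2" by linarith
        have "2 * pi * ((\<kappa> - Re t) * real p) \<le> 2 * pi * (\<kappa> / 2)" by (rule mult_left_mono[OF a]) simp
        moreover have "\<kappa> * Im t \<le> 0" using t kappa_pos by (simp add: mult_nonneg_nonpos)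
        ultimately have "- (pi * \<kappa>) \<le> 2 * pi * real p * (Re t - \<kappa>) - \<kappa> * Im t" by (simp add: algebra_simps)
        hence "c * (- (pi * \<kappa>)) \<le> c * (2 * pi * real p * (Re t - \<kappa>) - \<kappa> * Im t)" by (rule mult_left_mono) (use c in simp)
        thus ?thesis unfolding nX T by simp
      qed
      \<comment> \<open>Here the p + 1 factors are seen to be enough: the exponent is at most c pi
        kappa (p + 1), whereas the strip of P = p + 1 rows reaches up to c pi kappa (2 p +
        1).\<close>
      have X2: "norm (exp (2 * pi * \<i> * coord N t)) \<le> exp (dual_rate N * (real (Suc p) - 1 / 2))"
      proof -
        have "real p * (Re t - \<kappa>) \<le> real p * (\<kappa> / 2)" by (rule mult_left_mono) (use t in auto)
        hence "2 * pi * (real p * (Re t - \<kappa>)) \<le> 2 * pi * (real p * (\<kappa> / 2))" by (rule mult_left_mono) simp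
        moreover have "\<kappa> * (- Im t) \<le> \<kappa> * pi" by (rule mult_left_mono) (use t kappa_pos in auto)
        moreover have "2 * pi * real p * (Re t - \<kappa>) = 2 * pi * (real p * (Re t - \<kappa>))"
          "pi * \<kappa> * (real p + 1) = 2 * pi * (real p * (\<kappa> / 2)) + \<kappa> * pi" by (simp_all add: algebra_simps)
        ultimately have "2 * pi * real p * (Re t - \<kappa>) - \<kappa> * Im t \<le> pi * \<kappa> * (real p + 1)" by linarith
        also have "\<dots> \<le> pi * \<kappa> * (2 * real p + 1)" using kappa_pos by (intro mult_left_mono) auto
        finally have "c * (2 * pi * real p * (Re t - \<kappa>) - \<kappa> * Im t) \<le> c * (pi * \<kappa> * (2 * real p + 1))"
          by (rule mult_left_mono) (use c in simp)
        thus ?thesis unfolding nX T by (simp add: algebra_simps)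
      qed
      define B where "B = exp (real N * (- Re (of_real (pi\<^sup>2 / 3) / \<xi>) + \<epsilon> / 4))"
      have B: "B > 0" by (simp add: B_def)
      have "norm (cofactor N (coord N t)) \<le> B / (1 - exp (- dual_rate N / 2)) ^ Suc p"
        by (rule jtheta_quotient_bound[OF w cofactor[OF N], of B, unfolded Re_dual_dual_rate])
           (use elim(1) X1 X2 in \<open>auto simp: B_def\<close>)
      also have "\<dots> \<le> B / (1 / 2) ^ Suc p"
      proof (rule divide_left_mono)
        have "exp (- dual_rate N / 2) \<le> exp (- 1)" using elim(3) by simp
        also have "exp (- 1) \<le> (1 / 2 :: real)"
          using exp_ge_add_one_self[of "1 :: real"] by (simp add: exp_minus inverse_eq_divide field_simps)
        finally have "1 / 2 \<le> 1 - exp (- dual_rate N / 2)" by simp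
        thus "(1 / 2) ^ Suc p \<le> (1 - exp (- dual_rate N / 2)) ^ Suc p" by (rule power_mono) simp
        have "0 < 1 - exp (- dual_rate N / 2)" using \<open>1 / 2 \<le> 1 - exp (- dual_rate N / 2)\<close> by linarith
        thus "0 < (1 - exp (- dual_rate N / 2)) ^ Suc p * (1 / 2) ^ Suc p" by simp
      qed (use B in simp)
      finally have hb: "norm (cofactor N (coord N t)) \<le> B * 2 ^ Suc p" by (simp add: power_divide)
      define z1 where "z1 = exp (- t - of_real \<kappa>)"
      define z2 where "z2 = exp (- (t - of_real \<kappa> + mesh N))"
      have wx: "mesh N * (coord N t + 1) = t - of_real \<kappa> + mesh N"
        using mesh_coord[OF N, of t] by (simp add: algebra_simps)
      have kN: "\<kappa> / (2 * real N) \<le> \<kappa> / 2" using N kappa_pos by (intro divide_left_mono) auto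
      have t0: "Re t \<ge> 0" using t kN kappa_pos by linarith
      have kN': "\<kappa> / 2 / real N \<le> \<kappa>" using N kappa_pos by (simp add: divide_le_eq)
      have n1: "norm z1 \<le> exp (- (\<kappa> / 2 / real N))"
        unfolding z1_def using t0 kN' by simp
      have n2: "norm z2 \<le> exp (- (\<kappa> / 2 / real N))"
        unfolding z2_def using t by (simp add: Re_mesh field_simps)
      have q1: "norm (qlog (mesh N) z1 - of_nat N / \<xi> * dilog z1) \<le> \<epsilon> / 4 * real N"
        and q2: "norm (qlog (mesh N) z2 - of_nat N / \<xi> * dilog z2) \<le> \<epsilon> / 4 * real N"
        using elim(4) n1 n2 unfolding mesh_def by blast+
      define G where "G = of_real \<kappa> * t / mesh N + qlog (mesh N) z1 + (mesh N * (coord N t)\<^sup>2 / 2 + mesh N * coord N t / 2 - \<i> * pi * coord N t) + qlog (mesh N) z2"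
      have QG: "Q_right N t = exp G * ((1 - z1) / (1 - exp (- of_real \<kappa>))) * cofactor N (coord N t)"
      proof -
        have gen: "exp a / exp (- b) * c * (exp d / exp (- e)) * h = exp (a + b + d + e) * c * h" for a b c d e h :: complex
          by (simp add: exp_add exp_minus divide_inverse)
        show ?thesis
          unfolding Q_right_def wx qexp_def z1_def[symmetric] z2_def[symmetric] G_def by (rule gen)
      qed
      \<comment> \<open>The term omega x / 2 = (t - kappa)/2 carries no factor N and costs only
        kappa/4.\<close>
      have ReG: "Re G \<le> real N * (Re (Phi N t / \<xi>) + Re (of_real (pi\<^sup>2 / 3) / \<xi>)) + \<kappa> / 4 + \<epsilon> / 2 * real N"
      proof -
        define w' where "w' = t - of_real \<kappa>"
        have x': "coord N t = of_nat N / \<xi> * w'" by (simp add: coord_def w'_def mesh_def)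
        have "mesh N * (coord N t)\<^sup>2 = (mesh N * coord N t) * coord N t" by (simp add: power2_eq_square)
        hence sq: "mesh N * (coord N t)\<^sup>2 = of_nat N / \<xi> * w'\<^sup>2"
          unfolding mesh_coord[OF N] w'_def[symmetric] by (simp add: x' power2_eq_square)
        have "G = of_nat N / \<xi> * (Phi N t + of_real (pi\<^sup>2 / 3)) + w' / 2
            + ((qlog (mesh N) z1 - of_nat N / \<xi> * dilog z1) + (qlog (mesh N) z2 - of_nat N / \<xi> * dilog z2))"
          unfolding G_def sq mesh_coord[OF N] unfolding x' Phi_def w'_def[symmetric] z1_def[symmetric] z2_def[folded w'_def, symmetric]
          by (simp add: mesh_def algebra_simps add_divide_distrib diff_divide_distrib)
        moreover have "Re (of_nat N / \<xi> * (Phi N t + of_real (pi\<^sup>2 / 3))) = real N * (Re (Phi N t / \<xi>) + Re (of_real (pi\<^sup>2 / 3) / \<xi>))"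
        proof -
          have "of_nat N / \<xi> * (A + B) = of_real (real N) * (A / \<xi> + B / \<xi>)" for A B
            by (simp add: algebra_simps add_divide_distrib)
          from this[of "Phi N t" "of_real (pi\<^sup>2 / 3)"]
          have "of_nat N / \<xi> * (Phi N t + of_real (pi\<^sup>2 / 3)) = of_real (real N) * (Phi N t / \<xi> + of_real (pi\<^sup>2 / 3) / \<xi>)" .
          thus ?thesis by (simp only: Re_of_real_times plus_complex.simps)
        qed
        moreover have "Re (w' / 2) \<le> \<kappa> / 4" using t by (simp add: w'_def)
        moreover have "Re (qlog (mesh N) z1 - of_nat N / \<xi> * dilog z1) \<le> \<epsilon> / 4 * real N"
          "Re (qlog (mesh N) z2 - of_nat N / \<xi> * dilog z2) \<le> \<epsilon> / 4 * real N"
          using q1 q2 complex_Re_le_cmod order_trans by blast+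
        ultimately show ?thesis by simp
      qed
      have cst: "norm ((1 - z1) / (1 - exp (- complex_of_real \<kappa>))) \<le> 4"
      proof -
        have "norm z1 \<le> 1" unfolding z1_def using t0 kappa_pos by simp
        hence "norm (1 - z1) \<le> 2" using norm_triangle_ineq4[of 1 z1] by simp
        moreover have "norm (1 - exp (- complex_of_real \<kappa>)) \<ge> 1 / 2"
          using norm_triangle_ineq2[of 1 "exp (- complex_of_real \<kappa>)"] exp_minus_kappa_le by simp
        ultimately have "norm (1 - z1) / norm (1 - exp (- complex_of_real \<kappa>)) \<le> 2 / (1 / 2)"
          by (intro frac_le) auto
        thus ?thesis by (simp add: norm_divide)
      qed
      have "norm (Q_right N t) \<le> exp (real N * (Re (Phi N t / \<xi>) + Re (of_real (pi\<^sup>2 / 3) / \<xi>)) + \<kappa> / 4 + \<epsilon> / 2 * real N) * 4 * (B * 2 ^ Suc p)"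
        unfolding QG norm_mult norm_exp_eq_Re by (intro mult_mono hb cst) (use ReG in auto)
      also have "\<dots> = (4 * exp (\<kappa> / 4) * 2 ^ Suc p) * exp (real N * (Re (Phi N t / \<xi>) + 3 / 4 * \<epsilon>))"
      proof -
        have "real N * (Re (Phi N t / \<xi>) + Re (of_real (pi\<^sup>2 / 3) / \<xi>)) + \<kappa> / 4 + \<epsilon> / 2 * real N + real N * (- Re (of_real (pi\<^sup>2 / 3) / \<xi>) + \<epsilon> / 4)
            = \<kappa> / 4 + real N * (Re (Phi N t / \<xi>) + 3 / 4 * \<epsilon>)" by (simp add: algebra_simps)
        hence "exp (real N * (Re (Phi N t / \<xi>) + Re (of_real (pi\<^sup>2 / 3) / \<xi>)) + \<kappa> / 4 + \<epsilon> / 2 * real N) * B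
            = exp (\<kappa> / 4) * exp (real N * (Re (Phi N t / \<xi>) + 3 / 4 * \<epsilon>))"
          unfolding B_def exp_add[symmetric] by (rule arg_cong)
        thus ?thesis by (simp add: mult_ac)
      qed
      also have "\<dots> \<le> exp (\<epsilon> / 4 * real N) * exp (real N * (Re (Phi N t / \<xi>) + 3 / 4 * \<epsilon>))"
      proof (rule mult_right_mono)
        have "4 * exp (\<kappa> / 4) * 2 ^ Suc p \<le> K" unfolding K_def using kappa_pos by (intro mult_right_mono mult_left_mono) auto
        thus "4 * exp (\<kappa> / 4) * 2 ^ Suc p \<le> exp (\<epsilon> / 4 * real N)" using elim(2) by linarith
      qed simp
      also have "\<dots> = exp (real N * (Re (Phi N t / \<xi>) + \<epsilon>))"
        unfolding exp_add[symmetric] by (simp add: algebra_simps)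
      finally show "norm (Q_right N t) \<le> exp (real N * (Re (Phi N t / \<xi>) + \<epsilon>))" .
    qed
  qed
qed

end

section \<open>The right-hand contour\<close>

lemma Im_dilog_of_real:
  assumes "\<bar>r\<bar> \<le> 1" shows "Im (dilog (of_real r)) = 0"
proof -
  have "(\<lambda>n. Im (of_real r ^ Suc n / of_nat (Suc n) ^ 2)) sums Im (dilog (of_real r))"
    using dilog_sums[of "of_real r"] assms unfolding sums_complex_iff by simp
  moreover have "Im (of_real r ^ Suc n / of_nat (Suc n) ^ 2) = 0" for n
  proof -
    have "(of_real r ^ Suc n / of_nat (Suc n) ^ 2 :: complex) = of_real (r ^ Suc n / real (Suc n) ^ 2)" by simp
    thus ?thesis by (simp only: Im_complex_of_real)
  qed
  ultimately have "(\<lambda>n :: nat. 0) sums Im (dilog (of_real r))" by (simp only:)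
  thus ?thesis using sums_zero sums_unique2 by blast
qed

lemma contour_integral_rectpath_split:
  fixes f :: "complex \<Rightarrow> complex"
  assumes "Re a \<le> Re b" "Im a \<le> Im b" "continuous_on (cbox a b - box a b) f"
  shows "contour_integral (rectpath a b) f = contour_integral (linepath a (Complex (Re b) (Im a))) f
     + contour_integral (linepath (Complex (Re b) (Im a)) b) f + contour_integral (linepath b (Complex (Re a) (Im b))) f
     + contour_integral (linepath (Complex (Re a) (Im b)) a) f"
proof -
  define a2 a4 where "a2 = Complex (Re b) (Im a)" and "a4 = Complex (Re a) (Im b)"
  have img: "path_image (rectpath a b) = closed_segment a a2 \<union> closed_segment a2 b \<union> closed_segment b a4 \<union> closed_segment a4 a"
    by (simp add: rectpath_def Let_def path_image_join a2_def a4_def Un_assoc)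
  hence c: "continuous_on (closed_segment a a2) f" "continuous_on (closed_segment a2 b) f"
    "continuous_on (closed_segment b a4) f" "continuous_on (closed_segment a4 a) f"
    using assms(3) unfolding path_image_rectpath_cbox_minus_box[OF assms(1,2), symmetric]
    by (auto intro: continuous_on_subset)
  note i = c[THEN contour_integrable_continuous_linepath]
  show ?thesis unfolding rectpath_def Let_def a2_def[symmetric] a4_def[symmetric]
    using i by (simp add: valid_path_join contour_integrable_joinI)
qed

lemma contour_integral_linepath_imag:
  "contour_integral (linepath 0 (- (\<i> * of_real \<eta>))) f = - \<i> * integral {0..\<eta>} (\<lambda>y. f (- (\<i> * of_real y)))"
  if "\<eta> > 0"
proof -
  have "contour_integral (linepath 0 (- (\<i> * of_real \<eta>))) f = contour_integral (linepath 0 (of_real \<eta>)) (\<lambda>z. - \<i> * f (- (\<i> * z)))"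
    unfolding contour_integral_integral
    by (intro integral_cong) (simp add: linepath_def scaleR_conv_of_real mult_ac)
  also have "\<dots> = integral {0..\<eta>} (\<lambda>y. - \<i> * f (- (\<i> * of_real y)))"
    using contour_integral_linepath_Reals_eq[of 0 "of_real \<eta>" "\<lambda>z. - \<i> * f (- (\<i> * z))"] that by simp
  also have "\<dots> = - \<i> * integral {0..\<eta>} (\<lambda>y. f (- (\<i> * of_real y)))"
    by (rule integral_mult_right)
  finally show ?thesis .
qed

text \<open>A primitive on the convex set makes the integral from a to d independent of the route;
  this allows the detour to the right of the right edge.\<close>

lemma holomorphic_convex_rectangle:
  fixes f :: "complex \<Rightarrow> complex"
  assumes "convex S" "open S" "f holomorphic_on S" "a \<in> S" "b \<in> S" "c \<in> S" "d \<in> S"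
  shows "contour_integral (linepath a d) f = contour_integral (linepath a b) f
     + contour_integral (linepath b c) f + contour_integral (linepath c d) f"
proof -
  obtain g where g: "\<And>x. x \<in> S \<Longrightarrow> (g has_field_derivative f x) (at x within S)"
    using holomorphic_convex_primitive'[OF assms(1-3)] by blast
  have "contour_integral (linepath u v) f = g v - g u" if "u \<in> S" "v \<in> S" for u v
    using contour_integral_primitive[of S g f "linepath u v"] g closed_segment_subset[OF that assms(1)]
    by (simp add: contour_integral_unique)
  thus ?thesis using assms by simp
qed

context fig8_kappa
begin

text \<open>
  The lower edge of the contour, at height \<open>- cut_height N\<close>, passes half way between the summation
  points of index \<open>cut_index N\<close> and \<open>cut_index N + 1\<close>.
\<close>

definition cut_index :: "nat \<Rightarrow> nat" where "cut_index N = nat \<lfloor>real N / (2 * real p) - 1 / 2\<rfloor>"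
definition cut_height :: "nat \<Rightarrow> real" where "cut_height N = (real (cut_index N) + 1 / 2) * (2 * pi * real p / real N)"

text \<open>Rounding to a half-integer index loses at most 2 pi p / N in height. For N >= 50 p this
  is at most pi/25, so the height remains above 3, the depth required by \<open>Psi_low\<close> and
  \<open>Phi_edges\<close>.\<close>

lemma cut_index_height:
  assumes "N \<ge> 50 * p"
  shows "N > 0" "cut_height N \<le> pi" "cut_height N \<ge> 3" "(real (cut_index N) + 1) * real p \<le> real N" "cut_index N < N"
proof -
  have p: "real p \<ge> 1" using p_pos by simp
  show N: "N > 0" using assms p_pos by simp
  have Np: "real N \<ge> 50 * real p" using assms by (metis of_nat_le_iff of_nat_mult of_nat_numeral)
  have "real N / (2 * real p) - 1 / 2 \<ge> 0" using Np p by (simp add: field_simps)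
  hence M: "real (cut_index N) \<le> real N / (2 * real p) - 1 / 2" "real (cut_index N) > real N / (2 * real p) - 1 / 2 - 1"
    unfolding cut_index_def by linarith+
  have "(real (cut_index N) + 1 / 2) * (2 * pi * real p / real N) \<le> (real N / (2 * real p)) * (2 * pi * real p / real N)"
    by (rule mult_right_mono) (use M in auto)
  also have "\<dots> = pi" using N p by simp
  finally show "cut_height N \<le> pi" unfolding cut_height_def .
  have "pi - 2 * pi * (real p / real N) = (real N / (2 * real p) - 1) * (2 * pi * real p / real N)"
    using N p by (simp add: field_simps)
  also have "\<dots> \<le> cut_height N" unfolding cut_height_def by (rule mult_right_mono) (use M in auto)
  finally have "pi - 2 * pi * (real p / real N) \<le> cut_height N" .
  moreover have "real p / real N \<le> 1 / 50" using Np N by (simp add: field_simps)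
  hence "2 * pi * (real p / real N) \<le> 2 * pi * (1 / 50)" by (intro mult_left_mono) auto
  ultimately show "cut_height N \<ge> 3" using pi_approx by simp
  have "(real (cut_index N) + 1) * real p \<le> (real N / (2 * real p) + 1 / 2) * real p"
    by (rule mult_right_mono) (use M in auto)
  also have "\<dots> \<le> real N" using Np p by (simp add: field_simps)
  finally show 1: "(real (cut_index N) + 1) * real p \<le> real N" .
  have "(real (cut_index N) + 1) * 1 \<le> (real (cut_index N) + 1) * real p" by (rule mult_left_mono) (use p in auto)
  hence "real (cut_index N) + 1 \<le> (real (cut_index N) + 1) * real p" by (simp only: mult_1_right)
  also note 1
  finally have "real (cut_index N) < real N" by simp
  thus "cut_index N < N" by (simp only: of_nat_less_iff)
qed

text \<open>The condition on t describes the three sides of the detour. With x = Re t - kappa and y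
  = - Im t, the gain comes from - pi^2/3 in the real part on the upper side, from - pi x in the
  imaginary part on the far side x = kappa/2, and from - kappa y in the imaginary part on the lower
  side.\<close>

lemma Phi_edges:
  "eventually (\<lambda>N. \<forall>t. \<kappa> - \<kappa> / (2 * real N) \<le> Re t \<longrightarrow> Re t \<le> \<kappa> + \<kappa> / 2 \<longrightarrow> - pi \<le> Im t \<longrightarrow> Im t \<le> 0 \<longrightarrow>
      (Im t = 0 \<or> Re t = \<kappa> + \<kappa> / 2 \<or> Im t \<le> - 3) \<longrightarrow> Re (Phi N t / \<xi>) \<le> - 0.1 / (norm \<xi>)\<^sup>2) sequentially"
proof -
  \<comment> \<open>On the upper side the second dilogarithm is real only up to the rotation by Im
    omega. This tolerance keeps its imaginary part, after multiplication by 2 pi p, below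
    0.05.\<close>
  define e where "e = 0.05 / (2 * pi * real p)"
  have pp: "2 * pi * real p > 0" using p_pos by simp
  have e: "e > 0" using pp by (simp add: e_def)
  obtain \<delta> where \<delta>: "\<delta> > 0"
    "\<And>z w. norm z \<le> 1 \<Longrightarrow> norm w \<le> 1 \<Longrightarrow> norm (z - w) < \<delta> \<Longrightarrow> norm (dilog z - dilog w) < e"
    using dilog_uniformly_close[OF e] by metis
  have "(\<lambda>N. norm (exp (- (\<i> * of_real (2 * pi * real p / real N))) - 1)) \<longlonglongrightarrow> norm (exp (- (\<i> * of_real 0)) - 1 :: complex)"
  proof -
    have t0: "(\<lambda>N. 2 * pi * real p / real N) \<longlonglongrightarrow> 0" by real_asymp
    show ?thesis by (rule tendsto_intros t0)+
  qed
  hence 1: "eventually (\<lambda>N. norm (exp (- (\<i> * of_real (2 * pi * real p / real N))) - 1) < \<delta>) sequentially"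
    using \<delta>(1) order_tendstoD(2) by fastforce
  \<comment> \<open>The box protrudes to the left of kappa by s = kappa/(2N), where - pi x has the
    wrong sign; for large N this costs less than 0.05.\<close>
  have "(\<lambda>N. \<kappa> / (2 * real N) * (1 + 2 * pi\<^sup>2 * real p)) \<longlonglongrightarrow> 0" by real_asymp
  hence 2: "eventually (\<lambda>N. \<kappa> / (2 * real N) * (1 + 2 * pi\<^sup>2 * real p) < 0.05) sequentially"
    by (rule order_tendstoD(2)) simp
  have "(\<lambda>N. exp (\<kappa> / (2 * real N))) \<longlonglongrightarrow> exp 0" by real_asymp
  hence 3: "eventually (\<lambda>N. exp (\<kappa> / (2 * real N)) < 1.05) sequentially"
    by (rule order_tendstoD(2)) simp
  show ?thesis
    using 1 2 3 eventually_gt_at_top[of 0]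
  proof eventually_elim
    case (elim N)
    hence N: "N > 0" by simp
    define s where "s = \<kappa> / (2 * real N)"
    have s: "s > 0" using kappa_pos N by (simp add: s_def)
    have sp: "s * (1 + 2 * pi\<^sup>2 * real p) < 0.05" using elim(2) by (simp add: s_def)
    have "s * (1 + 19) \<le> s * (1 + 2 * pi\<^sup>2 * real p)"
    proof (intro mult_left_mono add_left_mono)
      have "9.6 * 1 \<le> pi\<^sup>2 * real p" by (intro mult_mono) (use pi2_6_bounds p_pos in auto)
      thus "19 \<le> 2 * pi\<^sup>2 * real p" by simp
    qed (use s in auto)
    hence s20: "s \<le> 0.0025" using sp by simp
    show ?case
    proof (intro allI impI)
      fix t assume t: "\<kappa> - \<kappa> / (2 * real N) \<le> Re t" "Re t \<le> \<kappa> + \<kappa> / 2" "- pi \<le> Im t" "Im t \<le> 0"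
        "Im t = 0 \<or> Re t = \<kappa> + \<kappa> / 2 \<or> Im t \<le> - 3"
      define x where "x = Re t - \<kappa>"
      define y where "y = - Im t"
      have x: "- s \<le> x" "x \<le> \<kappa> / 2" and y: "0 \<le> y" "y \<le> pi" using t by (auto simp: x_def y_def s_def)
      define d1 where "d1 = dilog (exp (- t - of_real \<kappa>))"
      define d2 where "d2 = dilog (exp (- (t - of_real \<kappa> + mesh N)))"
      have Rt: "Re t = \<kappa> + x" and It: "Im t = - y" by (simp_all add: x_def y_def)
      have RePhi: "Re (Phi N t) = \<kappa>\<^sup>2 + \<kappa> * x + (x\<^sup>2 - y\<^sup>2) / 2 - pi * y - pi\<^sup>2 / 3 + Re d1 + Re d2"
        unfolding Phi_def d1_def[symmetric] d2_def[symmetric]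
        by (simp add: Rt It power2_eq_square algebra_simps)
      have RePhi': "Re (Phi N t) \<le> \<kappa>\<^sup>2 + \<kappa> * x + x\<^sup>2 / 2 - pi * y - pi\<^sup>2 / 3 + Re d1 + Re d2"
        unfolding RePhi by (simp add: diff_divide_distrib)
      have ImPhi: "Im (Phi N t) = - (\<kappa> * y) - x * y - pi * x + Im d1 + Im d2"
        unfolding Phi_def d1_def[symmetric] d2_def[symmetric]
        by (simp add: Rt It power2_eq_square algebra_simps)
      have RePx: "Re (Phi N t / \<xi>) = (\<kappa> * Re (Phi N t) + 2 * pi * real p * Im (Phi N t)) / (norm \<xi>)\<^sup>2"
        by (simp add: Re_divide cmod_power2 algebra_simps)
      have n1: "norm (exp (- t - of_real \<kappa>)) = exp (- 2 * \<kappa>) * exp (- x)"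
        by (simp add: Rt exp_add[symmetric])
      have n2: "norm (exp (- (t - of_real \<kappa> + mesh N))) = exp (- x - 2 * s)"
        by (simp add: Rt Re_mesh s_def)
      have D: "norm (dilog z) \<le> b * 1.645" if "norm z \<le> b" "b \<le> 1" for z b
      proof -
        have b0: "0 \<le> b" using that(1) norm_ge_zero[of z] by linarith
        have "norm (dilog z) \<le> norm z * (pi\<^sup>2 / 6)" by (rule norm_dilog_le) (use that in linarith)
        also have "\<dots> \<le> b * 1.645" by (intro mult_mono that pi2_6_bounds b0) auto
        finally show ?thesis .
      qed
      have ex: "exp (- x) \<le> 1.05"
      proof -
        have "exp (- x) \<le> exp s" using x by simp
        thus ?thesis using elim(3)[folded s_def] by linarith
      qed
      have "exp (- 2 * \<kappa>) * exp (- x) \<le> 0.16 * 1.05" by (intro mult_mono exp_minus_2_kappa_le ex) auto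
      hence "norm (exp (- t - of_real \<kappa>)) \<le> 0.168" unfolding n1 by simp
      hence d1: "norm d1 \<le> 0.168 * 1.645" unfolding d1_def by (rule D) simp
      have d2: "norm d2 \<le> 1 * 1.645" unfolding d2_def
      proof (rule D)
        show "norm (exp (- (t - of_real \<kappa> + mesh N))) \<le> 1" unfolding n2 using x s by simp
      qed simp
      have rd: "Re d1 \<le> norm d1" "Re d2 \<le> norm d2" "Im d1 \<le> norm d1" "Im d2 \<le> norm d2"
        by (auto intro: complex_Re_le_cmod order_trans[OF abs_ge_self abs_Im_le_cmod])
      have k2: "\<kappa>\<^sup>2 \<le> 1" using kappa_le kappa_pos by (simp add: power_le_one)
      have kx: "\<kappa> * x \<le> 0.5"
      proof (cases "x \<ge> 0")
        case True
        have "\<kappa> * x \<le> 1 * (1 / 2)" by (intro mult_mono) (use x kappa_le kappa_pos True in auto)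
        thus ?thesis by simp
      next
        case False thus ?thesis using mult_nonneg_nonpos[of \<kappa> x] kappa_pos by simp
      qed
      have x1: "\<bar>x\<bar> \<le> 0.5" using x s20 kappa_le by simp
      have "\<bar>x\<bar>\<^sup>2 \<le> 0.5\<^sup>2" by (rule power_mono[OF x1]) simp
      hence xx: "x\<^sup>2 \<le> 0.25" by (simp add: power2_eq_square)
      have y2: "0 \<le> y\<^sup>2" "0 \<le> pi * y" using y by auto
      have kap: "0 < \<kappa>" by (rule kappa_pos)
      have pi3: "pi\<^sup>2 / 3 \<ge> 3.28" using pi2_6_bounds by simp
      have "\<kappa> * Re (Phi N t) + 2 * pi * real p * Im (Phi N t) \<le> - 0.1"
        using t(5)
      proof (elim disjE)
        assume "Im t = 0"
        hence y0: "y = 0" by (simp add: y_def)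
        have i1: "Im d1 = 0"
        proof -
          have "exp (- t - of_real \<kappa>) = of_real (exp (- 2 * \<kappa> - x))"
          proof -
            have "- t - of_real \<kappa> = of_real (- 2 * \<kappa> - x)" by (rule complex_eqI) (use y0 in \<open>auto simp: Rt It\<close>)
            thus ?thesis by (simp only: exp_of_real)
          qed
          moreover have "\<bar>exp (- 2 * \<kappa> - x)\<bar> \<le> 1" using x s20 kappa_ge by simp
          ultimately show ?thesis unfolding d1_def using Im_dilog_of_real by metis
        qed
        have i2: "Im d2 \<le> e"
        proof -
          define u where "u = exp (- x - 2 * s)"
          have u: "0 < u" "u \<le> 1" using x s by (auto simp: u_def)
          have z: "exp (- (t - of_real \<kappa> + mesh N)) = of_real u * exp (- (\<i> * of_real (2 * pi * real p / real N)))"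
          proof -
            have "- (t - of_real \<kappa> + mesh N) = of_real (- x - 2 * s) + - (\<i> * of_real (2 * pi * real p / real N))"
              by (rule complex_eqI) (use y0 in \<open>auto simp: Rt It Re_mesh Im_mesh s_def\<close>)
            thus ?thesis unfolding u_def by (simp only: exp_add exp_of_real)
          qed
          have "norm (exp (- (t - of_real \<kappa> + mesh N)) - of_real u) = u * norm (exp (- (\<i> * of_real (2 * pi * real p / real N))) - 1)"
          proof -
            have "exp (- (t - of_real \<kappa> + mesh N)) - of_real u = of_real u * (exp (- (\<i> * of_real (2 * pi * real p / real N))) - 1)"
              unfolding z by (simp only: right_diff_distrib mult_1_right)
            thus ?thesis using u by (simp only: norm_mult norm_of_real)
          qed
          also have "\<dots> \<le> 1 * norm (exp (- (\<i> * of_real (2 * pi * real p / real N))) - 1)"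
            by (rule mult_right_mono) (use u in auto)
          finally have "norm (exp (- (t - of_real \<kappa> + mesh N)) - of_real u) < \<delta>" using elim(1) by simp
          moreover have "norm (exp (- (t - of_real \<kappa> + mesh N))) \<le> 1" unfolding n2 using x s by simp
          ultimately have "norm (d2 - dilog (of_real u)) < e"
            unfolding d2_def using u by (intro \<delta>(2)) auto
          moreover have "Im (dilog (of_real u)) = 0" using u by (intro Im_dilog_of_real) simp
          ultimately show ?thesis using abs_Im_le_cmod[of "d2 - dilog (of_real u)"] by simp
        qed
        have "2 * pi * real p * Im d2 \<le> 2 * pi * real p * e" by (rule mult_left_mono[OF i2]) (use pp in simp)
        also have "\<dots> = 0.05" using p_pos unfolding e_def by simp
        finally have i3: "2 * pi * real p * Im d2 \<le> 0.05" .
        \<comment> \<open>The number bounds 1 - 3.28 + 0.168 * 1.645 + 1.645, from kappa^2, pi^2/3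
          and the two dilogarithms.\<close>
        have "Re (Phi N t) \<le> - 0.35 + (\<kappa> * x + x\<^sup>2 / 2)"
          using RePhi rd d1 d2 k2 pi3 y0 by simp
        hence "\<kappa> * Re (Phi N t) \<le> \<kappa> * (- 0.35 + (\<kappa> * x + x\<^sup>2 / 2))" by (rule mult_left_mono) (use kap in simp)
        also have "\<dots> = - 0.35 * \<kappa> + \<kappa> * (\<kappa> * x + x\<^sup>2 / 2)" by (simp add: algebra_simps)
        also have "\<dots> \<le> - 0.33 + \<kappa> * (\<kappa> * x + x\<^sup>2 / 2)" using kappa_ge by simp
        finally have r: "\<kappa> * Re (Phi N t) \<le> - 0.33 + \<kappa> * (\<kappa> * x + x\<^sup>2 / 2)" .
        have m: "2 * pi * real p * Im (Phi N t) = 2 * pi * real p * Im d2 - 2 * pi\<^sup>2 * real p * x"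
          unfolding ImPhi y0 i1 by (simp add: algebra_simps power2_eq_square)
        have pp2: "19 \<le> 2 * pi\<^sup>2 * real p"
        proof -
          have "9.6 * 1 \<le> pi\<^sup>2 * real p" by (intro mult_mono) (use pi2_6_bounds p_pos in auto)
          thus ?thesis by simp
        qed
        have "\<kappa> * (\<kappa> * x + x\<^sup>2 / 2) - 2 * pi\<^sup>2 * real p * x \<le> 0.05"
        proof (cases "x \<ge> 0")
          case True
          have "x\<^sup>2 = x * x" by (simp add: power2_eq_square)
          also have "\<dots> \<le> 0.5 * x" using x1 True by (intro mult_right_mono) auto
          finally have "x\<^sup>2 \<le> 0.5 * x" .
          moreover have "\<kappa> * x \<le> 1 * x" by (rule mult_right_mono) (use kappa_le True in auto)
          ultimately have "\<kappa> * x + x\<^sup>2 / 2 \<le> 1.25 * x" by simp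
          hence "\<kappa> * (\<kappa> * x + x\<^sup>2 / 2) \<le> 1 * (1.25 * x)"
            by (intro mult_mono) (use kappa_le kap True in auto)
          moreover have "19 * x \<le> 2 * pi\<^sup>2 * real p * x" by (rule mult_right_mono) (use pp2 True in auto)
          ultimately show ?thesis using True by simp
        next
          case False
          have "x\<^sup>2 = (- x) * (- x)" by (simp add: power2_eq_square)
          also have "\<dots> \<le> 0.5 * (- x)" using x1 False by (intro mult_right_mono) auto
          finally have a: "x\<^sup>2 \<le> 0.5 * (- x)" .
          have "\<kappa> * x \<le> 0" using kap False by (simp add: mult_nonneg_nonpos)
          hence "\<kappa> * x + x\<^sup>2 / 2 \<le> - x" using a False by simp
          hence "\<kappa> * (\<kappa> * x + x\<^sup>2 / 2) \<le> \<kappa> * (- x)" by (rule mult_left_mono) (use kap in simp)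
          also have "\<dots> \<le> 1 * (- x)" by (rule mult_right_mono) (use kappa_le False in auto)
          finally have "\<kappa> * (\<kappa> * x + x\<^sup>2 / 2) - 2 * pi\<^sup>2 * real p * x \<le> (- x) * (1 + 2 * pi\<^sup>2 * real p)"
            by (simp add: algebra_simps)
          also have "\<dots> \<le> s * (1 + 2 * pi\<^sup>2 * real p)" by (rule mult_right_mono) (use x pp2 in auto)
          finally show ?thesis using sp by simp
        qed
        thus ?thesis using r m i3 by simp
      next
        assume "Re t = \<kappa> + \<kappa> / 2"
        hence xk: "x = \<kappa> / 2" by (simp add: x_def)
        have e1: "exp (- x) \<le> 0.63" unfolding xk using exp_minus_half_kappa_le by simp
        have "exp (- 2 * \<kappa>) * exp (- x) \<le> 0.16 * 0.63" by (intro mult_mono exp_minus_2_kappa_le e1) auto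
        hence "norm (exp (- t - of_real \<kappa>)) \<le> 0.101" unfolding n1 by simp
        hence d1: "norm d1 \<le> 0.101 * 1.645" unfolding d1_def by (rule D) simp
        have "exp (- x - 2 * s) \<le> exp (- x)" using s by simp
        hence "exp (- x - 2 * s) \<le> 0.63" using e1 by linarith
        hence "norm (exp (- (t - of_real \<kappa> + mesh N))) \<le> 0.63" unfolding n2 .
        hence d2: "norm d2 \<le> 0.63 * 1.645" unfolding d2_def by (rule D) simp
        have "Re (Phi N t) \<le> 0" using RePhi' rd d1 d2 k2 kx xx pi3 y2 by simp
        hence r: "\<kappa> * Re (Phi N t) \<le> 0" using kap by (simp add: mult_nonneg_nonpos)
        have "3.14 * 0.475 \<le> pi * x" by (intro mult_mono) (use pi_approx xk kappa_ge in auto)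
        moreover have "0 \<le> \<kappa> * y" "0 \<le> x * y" using kap y xk by auto
        ultimately have im: "Im (Phi N t) \<le> - 0.2" using ImPhi rd d1 d2 by simp
        have "6 * 0.2 \<le> 2 * pi * real p * (- Im (Phi N t))"
        proof (rule mult_mono)
          have "6 * 1 \<le> 2 * pi * real p" by (intro mult_mono) (use pi_approx p_pos in auto)
          thus "6 \<le> 2 * pi * real p" by simp
        qed (use im pp in auto)
        thus ?thesis using r by simp
      next
        assume "Im t \<le> - 3"
        hence y3: "y \<ge> 3" by (simp add: y_def)
        have "3 * 3 \<le> pi * y" by (intro mult_mono) (use pi_gt3 y3 in auto)
        hence "Re (Phi N t) \<le> 0" using RePhi' rd d1 d2 k2 kx xx pi3 y2 by simp
        hence r: "\<kappa> * Re (Phi N t) \<le> 0" using kap by (simp add: mult_nonneg_nonpos)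
        have "0.95 * 3 \<le> \<kappa> * y" by (intro mult_mono) (use kappa_ge y3 kap in auto)
        moreover have "- (0.05) \<le> x * y + pi * x"
        proof (cases "x \<ge> 0")
          case True
          hence "0 \<le> x * y" "0 \<le> pi * x" using y by auto
          thus ?thesis by simp
        next
          case False
          have "(- x) * (y + pi) \<le> 0.0025 * (4 + 4)" by (intro mult_mono) (use x s20 y pi_less_4 False in auto)
          thus ?thesis by (simp add: algebra_simps)
        qed
        moreover have "Im d1 \<le> 0.3" "Im d2 \<le> 1.7" using d1 d2 rd by simp_all
        moreover have "Im (Phi N t) = - (\<kappa> * y) - (x * y + pi * x) + Im d1 + Im d2" unfolding ImPhi by simp
        moreover define a b where "a = \<kappa> * y" and "b = x * y + pi * x"
        ultimately have "57 / 20 \<le> a" "- 1 / 20 \<le> b" "Im d1 \<le> 3 / 10" "Im d2 \<le> 17 / 10"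
          "Im (Phi N t) = - a - b + Im d1 + Im d2" by simp_all
        hence "Im (Phi N t) \<le> - 1 / 5" by linarith
        hence im: "Im (Phi N t) \<le> - 0.2" by simp
        have "6 * 0.2 \<le> 2 * pi * real p * (- Im (Phi N t))"
        proof (rule mult_mono)
          have "6 * 1 \<le> 2 * pi * real p" by (intro mult_mono) (use pi_approx p_pos in auto)
          thus "6 \<le> 2 * pi * real p" by simp
        qed (use im pp in auto)
        thus ?thesis using r by simp
      qed
      thus "Re (Phi N t / \<xi>) \<le> - 0.1 / (norm \<xi>)\<^sup>2" unfolding RePx by (rule divide_right_mono) simp
    qed
  qed
qed

text \<open>\<open>Q_right\<close> is holomorphic across Re t = kappa, so the edge is replaced by
  the three other sides of a rectangle reaching to 3 kappa / 2. Half of the rate 0.1 is spent on the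
  error in \<open>Q_right_bound\<close>, and each side has length at most 4.\<close>

lemma right_edge:
  "\<exists>c>0. eventually (\<lambda>N. norm (contour_integral (linepath (Complex (\<kappa> - \<kappa> / (2 * real N)) (- cut_height N)) (of_real (\<kappa> - \<kappa> / (2 * real N)))) (Q_right N))
     \<le> 20 * exp (- c * real N)) sequentially"
proof -
  define c where "c = 0.05 / (norm \<xi>)\<^sup>2"
  have c: "c > 0" by (simp add: c_def)
  show ?thesis
  proof (rule exI[of _ c], rule conjI[OF c])
    show "eventually (\<lambda>N. norm (contour_integral (linepath (Complex (\<kappa> - \<kappa> / (2 * real N)) (- cut_height N)) (of_real (\<kappa> - \<kappa> / (2 * real N)))) (Q_right N))
     \<le> 20 * exp (- c * real N)) sequentially"
      using Phi_edges Q_right_bound[OF c] eventually_ge_at_top[of "50 * p"]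
    proof eventually_elim
      case (elim N)
      note M = cut_index_height[OF elim(3)]
      define s where "s = \<kappa> / (2 * real N)"
      have s: "s > 0" "s < \<kappa> / real N" "s \<le> \<kappa> / 2"
        using kappa_pos M(1) unfolding s_def by (auto intro: divide_left_mono simp: field_simps)
      define S where "S = {t. Re t > \<kappa> - \<kappa> / real N}"
      have S: "convex S" "open S" "Q_right N holomorphic_on S"
        unfolding S_def using holomorphic_Q_right[OF M(1)] by (auto simp: convex_halfspace_Re_gt open_halfspace_Re_gt)
      have b: "norm (Q_right N t) \<le> exp (- c * real N)"
        if "\<kappa> - s \<le> Re t" "Re t \<le> \<kappa> + \<kappa> / 2" "- pi \<le> Im t" "Im t \<le> 0" "Im t = 0 \<or> Re t = \<kappa> + \<kappa> / 2 \<or> Im t \<le> - 3" for t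
      proof -
        have "Re (Phi N t / \<xi>) \<le> - 0.1 / (norm \<xi>)\<^sup>2" using elim(1) that unfolding s_def by blast
        hence "real N * (Re (Phi N t / \<xi>) + c) \<le> real N * (- c)" by (intro mult_left_mono) (auto simp: c_def)
        moreover have "norm (Q_right N t) \<le> exp (real N * (Re (Phi N t / \<xi>) + c))" using elim(2) that unfolding s_def by blast
        ultimately show ?thesis by (smt (verit) exp_le_cancel_iff mult.commute mult_minus_left)
      qed
      define A where "A = Complex (\<kappa> - s) (- cut_height N)"
      define B where "B = Complex (\<kappa> + \<kappa> / 2) (- cut_height N)"
      define C where "C = Complex (\<kappa> + \<kappa> / 2) 0"
      define D where "D = complex_of_real (\<kappa> - s)"
      have inS: "A \<in> S" "B \<in> S" "C \<in> S" "D \<in> S" using s kappa_pos by (auto simp: A_def B_def C_def D_def S_def)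
      have int: "Q_right N contour_integrable_on linepath u v" if "u \<in> S" "v \<in> S" for u v
        using S closed_segment_subset[OF that S(1)]
        by (intro contour_integrable_continuous_linepath holomorphic_on_imp_continuous_on) (auto intro: holomorphic_on_subset)
      have e0: "exp (- c * real N) \<ge> 0" by simp
      have k: "\<kappa> + s \<ge> 0" "\<kappa> / 2 + s \<le> 1" using s kappa_pos kappa_le by auto
      have 1: "norm (contour_integral (linepath A B) (Q_right N)) \<le> exp (- c * real N) * norm (B - A)"
      proof (rule contour_integral_bound_linepath[OF int[OF inS(1,2)] e0])
        fix t assume "t \<in> closed_segment A B"
        hence "Im t = - cut_height N" "Re t \<in> closed_segment (\<kappa> - s) (\<kappa> + \<kappa> / 2)"
          unfolding A_def B_def by (auto simp: closed_segment_same_Im)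
        thus "norm (Q_right N t) \<le> exp (- c * real N)" using M s kappa_pos pi_gt_zero
          by (intro b) (auto simp: closed_segment_eq_real_ivl split: if_splits)
      qed
      have 2: "norm (contour_integral (linepath B C) (Q_right N)) \<le> exp (- c * real N) * norm (C - B)"
      proof (rule contour_integral_bound_linepath[OF int[OF inS(2,3)] e0])
        fix t assume "t \<in> closed_segment B C"
        hence "Re t = \<kappa> + \<kappa> / 2" "Im t \<in> closed_segment (- cut_height N) 0"
          unfolding B_def C_def by (auto simp: closed_segment_same_Re)
        thus "norm (Q_right N t) \<le> exp (- c * real N)" using M s kappa_pos pi_gt_zero
          by (intro b) (auto simp: closed_segment_eq_real_ivl split: if_splits)
      qed
      have 3: "norm (contour_integral (linepath C D) (Q_right N)) \<le> exp (- c * real N) * norm (D - C)"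
      proof (rule contour_integral_bound_linepath[OF int[OF inS(3,4)] e0])
        fix t assume "t \<in> closed_segment C D"
        hence "Im t = 0" "Re t \<in> closed_segment (\<kappa> + \<kappa> / 2) (\<kappa> - s)"
          unfolding C_def D_def by (auto simp: closed_segment_same_Im)
        thus "norm (Q_right N t) \<le> exp (- c * real N)" using M s kappa_pos pi_gt_zero
          by (intro b) (auto simp: closed_segment_eq_real_ivl split: if_splits)
      qed
      have n: "norm (B - A) \<le> 4" "norm (C - B) \<le> 4" "norm (D - C) \<le> 4"
      proof -
        have "norm (B - A) \<le> \<bar>Re (B - A)\<bar> + \<bar>Im (B - A)\<bar>" by (rule cmod_le)
        thus "norm (B - A) \<le> 4" using k s kappa_pos by (simp add: A_def B_def)
        have "norm (C - B) \<le> \<bar>Re (C - B)\<bar> + \<bar>Im (C - B)\<bar>" by (rule cmod_le)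
        thus "norm (C - B) \<le> 4" using M pi_less_4 by (simp add: C_def B_def)
        have "norm (D - C) \<le> \<bar>Re (D - C)\<bar> + \<bar>Im (D - C)\<bar>" by (rule cmod_le)
        thus "norm (D - C) \<le> 4" using k s kappa_pos by (simp add: C_def D_def)
      qed
      have "norm (contour_integral (linepath A D) (Q_right N)) \<le> norm (contour_integral (linepath A B) (Q_right N))
          + norm (contour_integral (linepath B C) (Q_right N)) + norm (contour_integral (linepath C D) (Q_right N))"
        unfolding holomorphic_convex_rectangle[OF S inS]
        using norm_triangle_ineq[of "contour_integral (linepath A B) (Q_right N) + contour_integral (linepath B C) (Q_right N)" "contour_integral (linepath C D) (Q_right N)"]
          norm_triangle_ineq[of "contour_integral (linepath A B) (Q_right N)" "contour_integral (linepath B C) (Q_right N)"] by linarith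
      also have "\<dots> \<le> exp (- c * real N) * 4 + exp (- c * real N) * 4 + exp (- c * real N) * 4"
        using 1 2 3 n e0 by (intro add_mono) (auto intro: order_trans mult_left_mono)
      also have "\<dots> \<le> 20 * exp (- c * real N)" using e0 by simp
      finally show ?case unfolding A_def D_def s_def .
    qed
  qed
qed


section \<open>Residues and reduction to two integrals\<close>

text \<open>The factors with n = 1, ..., p. Only the factor n = 0, split off here, vanishes inside
  the rectangle of the residue theorem.\<close>

definition theta_rest :: "nat \<Rightarrow> complex \<Rightarrow> complex" where
  "theta_rest N x = (\<Prod>n<p. 1 - exp (2 * pi * \<i> * x - of_nat (Suc n) * (4 * (of_real pi)\<^sup>2 / mesh N)))"

lemma theta_factors_eq_theta_rest: "theta_factors (mesh N) (Suc p) x = (1 - exp (2 * pi * \<i> * x)) * theta_rest N x"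
  unfolding theta_factors_def theta_rest_def prod.lessThan_Suc_shift by simp

lemma norm_exp_theta_rest: "norm (exp (2 * pi * \<i> * x - of_nat (Suc n) * (4 * (of_real pi)\<^sup>2 / mesh N)))
   = norm (exp (2 * pi * \<i> * x)) * exp (- (real (Suc n) * dual_rate N))"
proof -
  have "Re (of_nat (Suc n) * (4 * (of_real pi)\<^sup>2 / mesh N)) = real (Suc n) * dual_rate N"
    using Re_dual_dual_rate[of N] Re_of_real_times[of "real (Suc n)"] by (metis of_real_of_nat_eq)
  thus ?thesis unfolding exp_diff norm_divide norm_exp_eq_Re by (simp only: exp_minus divide_inverse)
qed

lemma dual_rate_nonneg: "dual_rate N \<ge> 0"
  using kappa_pos by (simp add: dual_rate_def)

lemma norm_exp_theta_rest_le:
  "norm (exp (2 * pi * \<i> * x - of_nat (Suc n) * (4 * (of_real pi)\<^sup>2 / mesh N))) \<le> norm (exp (2 * pi * \<i> * x)) * exp (- dual_rate N)"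
proof -
  have "1 * dual_rate N \<le> real (Suc n) * dual_rate N" by (intro mult_right_mono dual_rate_nonneg) auto
  thus ?thesis unfolding norm_exp_theta_rest by (intro mult_left_mono) auto
qed

lemma theta_rest_plus_of_int: "theta_rest N (x + of_int m) = theta_rest N x"
proof -
  have "exp (2 * pi * \<i> * (x + of_int m)) = exp (2 * pi * \<i> * x) * exp (2 * of_int m * pi * \<i>)"
    unfolding exp_add[symmetric] by (simp add: algebra_simps)
  hence "exp (2 * pi * \<i> * (x + of_int m)) = exp (2 * pi * \<i> * x)"
    using exp_integer_2pi[of "of_int m"] by (simp add: mult_ac)
  thus ?thesis unfolding theta_rest_def exp_diff by simp
qed

lemma theta_rest_0_norm_le: "norm (theta_rest N 0) \<le> 2 ^ p"
proof -
  have "norm (1 - exp (2 * pi * \<i> * 0 - of_nat (Suc n) * (4 * (of_real pi)\<^sup>2 / mesh N))) \<le> 2" for n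
  proof -
    have "norm (exp (2 * pi * \<i> * 0 - of_nat (Suc n) * (4 * (of_real pi)\<^sup>2 / mesh N))) \<le> 1 * exp (- dual_rate N)"
      using norm_exp_theta_rest_le[where x = 0 and n = n and N = N] by simp
    also have "\<dots> \<le> 1" using dual_rate_nonneg by simp
    finally show ?thesis
      using norm_triangle_ineq4[of 1 "exp (2 * pi * \<i> * 0 - of_nat (Suc n) * (4 * (of_real pi)\<^sup>2 / mesh N))"]
      unfolding norm_one by linarith
  qed
  hence "(\<Prod>n<p. norm (1 - exp (2 * pi * \<i> * 0 - of_nat (Suc n) * (4 * (of_real pi)\<^sup>2 / mesh N)))) \<le> (\<Prod>n<p. 2)"
    by (intro prod_mono) auto
  thus ?thesis by (simp add: theta_rest_def prod_norm)
qed

lemma theta_factors_zero: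
  assumes N: "N > 0" and z: "theta_factors (mesh N) (Suc p) (coord N t) = 0"
  obtains m :: int and n :: nat where "t = of_real \<kappa> + of_int m * mesh N - of_nat n * (2 * pi * \<i>)"
proof -
  note w = mesh_nonzero[OF N]
  obtain n where "exp (2 * pi * \<i> * coord N t - of_nat n * (4 * (of_real pi)\<^sup>2 / mesh N)) = 1"
    using z unfolding theta_factors_def by auto
  hence "exp (2 * pi * \<i> * coord N t) = exp (of_nat n * (4 * (of_real pi)\<^sup>2 / mesh N))"
    by (simp add: exp_diff)
  then obtain m :: int where m: "2 * pi * \<i> * coord N t = of_nat n * (4 * (of_real pi)\<^sup>2 / mesh N) + of_int (2 * m) * pi * \<i>"
    unfolding exp_eq by blast
  have "(2 * pi * \<i>) * (t - of_real \<kappa>) = mesh N * (2 * pi * \<i> * coord N t)"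
    using mesh_coord[OF N, of t] by (simp add: mult_ac)
  also have "\<dots> = (2 * pi * \<i>) * (of_int m * mesh N - of_nat n * (2 * pi * \<i>))"
    unfolding m using w by (simp add: field_simps power2_eq_square)
  finally have "t - of_real \<kappa> = of_int m * mesh N - of_nat n * (2 * pi * \<i>)"
    by (subst (asm) mult_cancel_left) auto
  hence "t = of_real \<kappa> + of_int m * mesh N - of_nat n * (2 * pi * \<i>)" by (simp add: algebra_simps)
  thus ?thesis by (rule that)
qed

text \<open>The zeros have real part kappa + m kappa/N with an integer m; the line sits half way
  between two such values.\<close>

lemma theta_factors_nonzero_line:
  assumes N: "N > 0" and t: "Re t = \<kappa> - \<kappa> / (2 * real N)"
  shows "theta_factors (mesh N) (Suc p) (coord N t) \<noteq> 0"
proof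
  assume "theta_factors (mesh N) (Suc p) (coord N t) = 0"
  from theta_factors_zero[OF N this] obtain m :: int and n :: nat
    where "t = of_real \<kappa> + of_int m * mesh N - of_nat n * (2 * pi * \<i>)" by metis
  hence "Re t = \<kappa> + of_int m * (\<kappa> / real N)" by (simp add: Re_mesh)
  hence "- (\<kappa> / (2 * real N)) = of_int m * (\<kappa> / real N)" using t by simp
  hence "\<kappa> * of_int (2 * m + 1) = 0" using N by (simp add: field_simps)
  hence "of_int (2 * m + 1) = (0 :: real)" using kappa_pos by (metis less_irrefl mult_eq_0_iff)
  hence "2 * m + 1 = 0" by (simp only: of_int_eq_0_iff)
  thus False by presburger
qed

lemma holomorphic_F:
  assumes N: "N > 0" shows "F N holomorphic_on {t. Re t > - \<kappa>}"
proof -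
  note w = Re_mesh_pos[OF N]
  have 1: "(qpoch (mesh N) \<circ> (\<lambda>t. exp (t - of_real \<kappa>))) holomorphic_on {t. Re t > - \<kappa>}"
    by (intro holomorphic_on_compose holomorphic_qpoch w holomorphic_intros)
  have 2: "(qexp (mesh N) \<circ> (\<lambda>t. exp (- t - of_real \<kappa>))) holomorphic_on {t. Re t > - \<kappa>}"
    by (rule holomorphic_on_compose_gen[OF _ holomorphic_qexp[OF w]]) (auto intro!: holomorphic_intros)
  show ?thesis unfolding F_def[abs_def]
    by (intro holomorphic_intros 1[unfolded o_def] 2[unfolded o_def] mesh_nonzero N qexp_nonzero
        one_minus_exp_minus_kappa_nonzero)
qed

lemma holomorphic_theta_rest_coord: "N > 0 \<Longrightarrow> (\<lambda>t. theta_rest N (coord N t)) holomorphic_on A"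
  unfolding theta_rest_def coord_def by (intro holomorphic_intros) (auto simp: mesh_nonzero)

lemma exp_coord_shift:
  assumes N: "N > 0"
  shows "exp (2 * pi * \<i> * coord N (of_real \<kappa> - of_nat j * mesh N)) = 1" "theta_rest N (coord N (of_real \<kappa> - of_nat j * mesh N)) = theta_rest N 0"
proof -
  have x: "coord N (of_real \<kappa> - of_nat j * mesh N) = 0 + of_int (- int j)"
    using mesh_nonzero[OF N] by (simp add: coord_def)
  have "2 * pi * \<i> * (0 + of_int (- int j)) = 2 * of_int (- int j) * pi * \<i>" by simp
  thus "exp (2 * pi * \<i> * coord N (of_real \<kappa> - of_nat j * mesh N)) = 1"
    unfolding x using exp_integer_2pi[of "of_int (- int j)"] by (metis Ints_of_int mult.assoc)
  show "theta_rest N (coord N (of_real \<kappa> - of_nat j * mesh N)) = theta_rest N 0"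
    unfolding x by (rule theta_rest_plus_of_int)
qed

text \<open>The factor 1 - exp (2 pi i x) has derivative - 2 pi i / omega at each summation point,
  and \<open>theta_rest\<close>, being 1-periodic, takes its value at 0 at all of them. Poles on the
  rows n >= 1 lie too low, since (\<open>cut_index N\<close> + 1) times the vertical spacing u is at
  most 2 pi.\<close>

lemma residue_sum:
  assumes N: "N \<ge> 50 * p"
  defines "a \<equiv> Complex 0 (- cut_height N)" and "b \<equiv> Complex (\<kappa> - \<kappa> / (2 * real N)) 0"
  shows "continuous_on (cbox a b - box a b) (Q N)"
    "contour_integral (rectpath a b) (Q N) = - (mesh N / theta_rest N 0) * (\<Sum>j=1..cut_index N. F N (of_real \<kappa> - of_nat j * mesh N))"
proof -
  note M = cut_index_height[OF N]
  note w0 = mesh_nonzero[OF M(1)]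
  have N0: "real N > 0" using M(1) by simp
  have p1: "real p \<ge> 1" using p_pos by simp
  define u where "u = 2 * pi * real p / real N"
  have u: "u > 0" using p1 N0 by (simp add: u_def)
  have Mu: "(real (cut_index N) + 1) * u \<le> 2 * pi"
  proof -
    have "(real (cut_index N) + 1) * u = 2 * pi * (((real (cut_index N) + 1) * real p) / real N)" by (simp add: u_def)
    also have "\<dots> \<le> 2 * pi * 1" by (rule mult_left_mono) (use M(4) N0 in \<open>auto simp: divide_le_eq\<close>)
    finally show ?thesis by simp
  qed
  have eta: "cut_height N = (real (cut_index N) + 1 / 2) * u" by (simp add: cut_height_def u_def)
  \<comment> \<open>The lower bound of this neighbourhood is the height of the first excluded
    summation point; being open, \<open>S\<close> contains exactly the first
    \<open>cut_index N\<close> points as poles.\<close>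
  define S where "S = {t. Re t > - \<kappa>} \<inter> {t. Re t < \<kappa>} \<inter> {t. Im t > - ((real (cut_index N) + 1) * u)} \<inter> {t. Im t < 1}"
  define tj where "tj j = of_real \<kappa> - of_nat j * mesh N" for j
  have Retj: "Re (tj j) = \<kappa> - real j * (\<kappa> / real N)" and Imtj: "Im (tj j) = - (real j * u)" for j
    by (simp_all add: tj_def Re_mesh Im_mesh u_def)
  define pts where "pts = tj ` {1..cut_index N}"
  have oS: "open S" unfolding S_def
    by (intro open_Int open_halfspace_Re_gt open_halfspace_Re_lt open_halfspace_Im_gt open_halfspace_Im_lt)
  have cS: "convex S" unfolding S_def
    by (intro convex_Int convex_halfspace_Re_gt convex_halfspace_Re_lt convex_halfspace_Im_gt convex_halfspace_Im_lt)
  have kN: "\<kappa> / real N > 0" using kappa_pos N0 by simp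
  have inj: "inj_on tj {1..cut_index N}"
    by (rule inj_onI) (use w0 in \<open>auto simp: tj_def\<close>)
  have tjbox: "tj j \<in> box a b" and tjS: "tj j \<in> S" if "j \<in> {1..cut_index N}" for j
  proof -
    have j: "1 \<le> real j" "real j \<le> real (cut_index N)" using that by auto
    have "real (cut_index N) < real N" using M(5) by simp
    hence "real j < real N" using j by linarith
    hence "real j * (\<kappa> / real N) < real N * (\<kappa> / real N)" by (rule mult_strict_right_mono) (rule kN)
    hence r1: "real j * (\<kappa> / real N) < \<kappa>" using N0 by simp
    have "1 * (\<kappa> / real N) \<le> real j * (\<kappa> / real N)" by (rule mult_right_mono) (use j kN in auto)
    moreover have "\<kappa> / (2 * real N) < \<kappa> / real N" using kappa_pos N0 by (simp add: field_simps)
    ultimately have r2: "real j * (\<kappa> / real N) > \<kappa> / (2 * real N)" by linarith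
    have "real j * u \<le> real (cut_index N) * u" by (rule mult_right_mono) (use j u in auto)
    also have "real (cut_index N) * u < (real (cut_index N) + 1 / 2) * u" by (rule mult_strict_right_mono) (use u in auto)
    finally have i1: "real j * u < (real (cut_index N) + 1 / 2) * u" .
    have i2: "real j * u > 0" using j u by simp
    show "tj j \<in> box a b"
      using r1 r2 i1 i2 by (simp add: in_box_complex_iff a_def b_def Retj Imtj eta)
    have "real j * (\<kappa> / real N) > 0" by (intro mult_pos_pos kN) (use j in linarith)
    thus "tj j \<in> S" using r1 i1 i2 kappa_pos u by (simp add: S_def Retj Imtj algebra_simps)
  qed
  have zeros: "t \<in> pts" if t: "t \<in> S" "theta_factors (mesh N) (Suc p) (coord N t) = 0" for t
  proof -
    from theta_factors_zero[OF M(1) t(2)] obtain m :: int and n :: nat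
      where tm: "t = of_real \<kappa> + of_int m * mesh N - of_nat n * (2 * pi * \<i>)" by metis
    have Ret: "Re t = \<kappa> + of_int m * (\<kappa> / real N)" and Imt: "Im t = of_int m * u - 2 * pi * real n"
      unfolding tm by (simp_all add: Re_mesh Im_mesh u_def)
    have "of_int m * (\<kappa> / real N) < 0" using t(1) Ret by (simp add: S_def)
    hence "real_of_int m < 0" unfolding mult_less_0_iff using kN by linarith
    hence m: "m < 0" by simp
    have "of_int m * u < 0" using \<open>real_of_int m < 0\<close> u by (simp add: mult_neg_pos)
    hence n0: "n = 0"
    proof -
      assume a: "of_int m * u < 0"
      have "of_int m * u - 2 * pi * real n > - ((real (cut_index N) + 1) * u)" using t(1) Imt by (simp add: S_def)
      hence "2 * pi * real n < 2 * pi * 1" using a Mu by linarith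
      hence "real n < 1" by (subst (asm) mult_less_cancel_left_pos) auto
      thus "n = 0" by simp
    qed
    have "of_int m * u > - ((real (cut_index N) + 1) * u)" using t(1) Imt n0 by (simp add: S_def)
    hence "(- of_int m) * u < (real (cut_index N) + 1) * u" by simp
    hence "- real_of_int m < real (cut_index N) + 1" using u by (subst (asm) mult_less_cancel_right_pos) auto
    hence "nat (- m) \<in> {1..cut_index N}" using m by auto
    moreover have "t = tj (nat (- m))" using m n0 by (simp add: tm tj_def)
    ultimately show ?thesis unfolding pts_def by blast
  qed
  have hF: "F N holomorphic_on S"
    by (rule holomorphic_on_subset[OF holomorphic_F[OF M(1)]]) (auto simp: S_def)
  have hx: "coord N holomorphic_on A" for A unfolding coord_def[abs_def] by (intro holomorphic_intros w0)
  have hX: "(\<lambda>t. 1 - exp (2 * pi * \<i> * coord N t)) holomorphic_on A" for A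
    by (intro holomorphic_intros hx)
  have hd: "(\<lambda>t. theta_factors (mesh N) (Suc p) (coord N t)) holomorphic_on A" for A
    unfolding theta_factors_eq_theta_rest by (intro holomorphic_intros hx holomorphic_theta_rest_coord M(1))
  have hQ: "Q N holomorphic_on S - pts"
    unfolding Q_def[abs_def]
    by (intro holomorphic_on_divide holomorphic_on_subset[OF hF] hd) (use zeros in auto)
  have eN: "cut_height N < (real (cut_index N) + 1) * u" "cut_height N > 0" using eta u M(3) by (auto simp: algebra_simps)
  have sN: "\<kappa> / (2 * real N) > 0" "\<kappa> / (2 * real N) \<le> \<kappa> / 2" using kappa_pos M(1) by (auto simp: field_simps)
  have cb: "cbox a b \<subseteq> S"
  proof
    fix t assume "t \<in> cbox a b"
    hence "0 \<le> Re t" "Re t \<le> \<kappa> - \<kappa> / (2 * real N)" "- cut_height N \<le> Im t" "Im t \<le> 0"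
      by (auto simp: in_cbox_complex_iff a_def b_def)
    thus "t \<in> S" using eN sN kappa_pos by (simp add: S_def)
  qed
  have ptsbox: "pts \<subseteq> box a b" using tjbox by (auto simp: pts_def)
  have sub: "cbox a b - box a b \<subseteq> S - pts" using cb ptsbox by auto
  show "continuous_on (cbox a b - box a b) (Q N)"
    using holomorphic_on_imp_continuous_on[OF hQ] sub continuous_on_subset by blast
  have le: "Re a \<le> Re b" "Im a \<le> Im b" using eN sN kappa_pos by (auto simp: a_def b_def)
  have res: "residue (Q N) (tj j) = - (mesh N / (2 * pi * \<i>)) * (F N (tj j) / theta_rest N 0)" if j: "j \<in> {1..cut_index N}" for j
  proof -
    define S' where "S' = S - {t. theta_rest N (coord N t) = 0}"
    have D0: "theta_rest N (coord N (tj j)) = theta_rest N 0" and X1: "exp (2 * pi * \<i> * coord N (tj j)) = 1"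
      using exp_coord_shift[OF M(1), of j] by (auto simp: tj_def)
    have dnz: "theta_rest N (coord N t) \<noteq> 0" if "t \<in> S" for t
    proof
      assume z: "theta_rest N (coord N t) = 0"
      hence "theta_factors (mesh N) (Suc p) (coord N t) = 0" by (simp add: theta_factors_eq_theta_rest)
      hence "t \<in> pts" using zeros that by blast
      then obtain i where "t = tj i" by (auto simp: pts_def)
      hence "theta_rest N 0 = 0" using z exp_coord_shift(2)[OF M(1), of i] by (simp add: tj_def)
      then obtain n where "exp (2 * pi * \<i> * 0 - of_nat (Suc n) * (4 * (of_real pi)\<^sup>2 / mesh N)) = 1"
        unfolding theta_rest_def by auto
      hence "norm (exp (2 * pi * \<i> * 0 - of_nat (Suc n) * (4 * (of_real pi)\<^sup>2 / mesh N))) = 1" by simp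
      hence "real (Suc n) * dual_rate N = 0" unfolding norm_exp_theta_rest by simp
      moreover have "dual_rate N > 0" using kappa_pos N0 by (simp add: dual_rate_def)
      ultimately show False by simp
    qed
    have hf: "(\<lambda>t. F N t / theta_rest N (coord N t)) holomorphic_on S"
      by (intro holomorphic_on_divide hF holomorphic_theta_rest_coord M(1) dnz)
    \<comment> \<open>The residue formula for a simple pole asks for a nonzero numerator.\<close>
    have Fnz: "F N (tj j) \<noteq> 0"
    proof -
      have "Re (tj j) < \<kappa>" "Re (tj j) > - \<kappa>" using tjS[OF j] by (auto simp: S_def)
      moreover have "norm (exp (- tj j - of_real \<kappa>)) < 1" using calculation by simp
      hence "1 - exp (- tj j - of_real \<kappa>) \<noteq> 0" by (metis eq_iff_diff_eq_0 less_irrefl norm_one)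
      ultimately show ?thesis
        using F_eq_exp[OF M(1), of "tj j"] one_minus_exp_minus_kappa_nonzero by simp
    qed
    have der: "((\<lambda>t. 1 - exp (2 * pi * \<i> * coord N t)) has_field_derivative - (2 * pi * \<i> / mesh N)) (at (tj j))"
    proof -
      have "((\<lambda>t. 1 - exp (2 * pi * \<i> * coord N t)) has_field_derivative (0 - exp (2 * pi * \<i> * coord N (tj j)) * (2 * pi * \<i> * (1 / mesh N)))) (at (tj j))"
        unfolding coord_def using w0 by (auto intro!: derivative_eq_intros)
      thus ?thesis unfolding X1 by simp
    qed
    have Qe: "Q N = (\<lambda>t. (F N t / theta_rest N (coord N t)) / (1 - exp (2 * pi * \<i> * coord N t)))"
      by (auto simp: Q_def theta_factors_eq_theta_rest mult.commute)
    have "residue (Q N) (tj j) = (F N (tj j) / theta_rest N (coord N (tj j))) / (- (2 * pi * \<i> / mesh N))"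
      unfolding Qe
      by (rule residue_simple_pole_deriv[OF hf hX oS convex_connected[OF cS] tjS[OF j] der])
         (use Fnz dnz[OF tjS[OF j]] X1 w0 in auto)
    thus ?thesis unfolding D0 using w0 by (simp add: divide_simps mult_ac)
  qed
  have "contour_integral (rectpath a b) (Q N) = 2 * pi * \<i> * (\<Sum>t\<in>pts. winding_number (rectpath a b) t * residue (Q N) t)"
  proof (rule Residue_theorem[OF oS convex_connected[OF cS] _ hQ])
    show "finite pts" by (simp add: pts_def)
    show "path_image (rectpath a b) \<subseteq> S - pts"
      unfolding path_image_rectpath_cbox_minus_box[OF le] by (rule sub)
    show "\<forall>z. z \<notin> S \<longrightarrow> winding_number (rectpath a b) z = 0"
      using winding_number_rectpath_outside[OF le] cb by blast
  qed auto
  also have "(\<Sum>t\<in>pts. winding_number (rectpath a b) t * residue (Q N) t)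
      = (\<Sum>j=1..cut_index N. - (mesh N / (2 * pi * \<i>)) * (F N (tj j) / theta_rest N 0))"
    unfolding pts_def by (subst sum.reindex[OF inj]) (simp add: winding_number_rectpath[OF tjbox] res)
  also have "\<dots> = - (mesh N / (2 * pi * \<i>)) * ((\<Sum>j=1..cut_index N. F N (tj j)) / theta_rest N 0)"
    by (simp only: sum_distrib_left[symmetric] sum_divide_distrib[symmetric])
  also have "2 * pi * \<i> * \<dots> = - (mesh N / theta_rest N 0) * (\<Sum>j=1..cut_index N. F N (tj j))"
    by (simp add: field_simps)
  finally show "contour_integral (rectpath a b) (Q N) = - (mesh N / theta_rest N 0) * (\<Sum>j=1..cut_index N. F N (of_real \<kappa> - of_nat j * mesh N))"
    unfolding tj_def .
qed

section \<open>Negligible edges and the tail of the sum\<close>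

lemma exp_dual_rate_tendsto: "(\<lambda>N. exp (- (dual_rate N / 2))) \<longlonglongrightarrow> 0"
proof -
  have c: "4 * pi\<^sup>2 * \<kappa> / (norm \<xi>)\<^sup>2 / 2 > 0" using kappa_pos by simp
  have "(\<lambda>N. exp (- (c * real N))) \<longlonglongrightarrow> 0" if "c > 0" for c
    using that by real_asymp
  from this[OF c] have "(\<lambda>N. exp (- (4 * pi\<^sup>2 * \<kappa> / (norm \<xi>)\<^sup>2 / 2 * real N))) \<longlonglongrightarrow> 0" .
  moreover have "dual_rate N / 2 = 4 * pi\<^sup>2 * \<kappa> / (norm \<xi>)\<^sup>2 / 2 * real N" for N by (simp add: dual_rate_def)
  ultimately show ?thesis by (simp only:)
qed

text \<open>Down to Im t = - pi the modulus of exp (2 pi i x) is at most exp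
  (\<open>dual_rate N\<close> / 2), half way to the row n = 1, so every factor of
  \<open>theta_rest\<close> stays close to at least 1 in modulus.\<close>

lemma theta_rest_lower:
  "eventually (\<lambda>N. \<forall>t. Re t \<le> \<kappa> \<longrightarrow> - pi \<le> Im t \<longrightarrow> norm (theta_rest N (coord N t)) \<ge> 1 / 2) sequentially"
proof -
  have "(\<lambda>N. (1 - exp (- (dual_rate N / 2))) ^ p) \<longlonglongrightarrow> (1 - 0) ^ p"
    by (intro tendsto_intros exp_dual_rate_tendsto)
  hence "eventually (\<lambda>N. (1 - exp (- (dual_rate N / 2))) ^ p > 1 / 2) sequentially"
    by (rule order_tendstoD(1)) simp
  thus ?thesis
  proof eventually_elim
    case (elim N)
    show ?case
    proof (intro allI impI)
      fix t assume t: "Re t \<le> \<kappa>" "- pi \<le> Im t"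
      have X: "norm (exp (2 * pi * \<i> * coord N t)) \<le> exp (dual_rate N / 2)"
      proof -
        have "2 * pi * real p * (Re t - \<kappa>) \<le> 0" using t by (simp add: mult_nonneg_nonpos)
        moreover have "\<kappa> * (- Im t) \<le> \<kappa> * pi" by (rule mult_left_mono) (use t kappa_pos in auto)
        ultimately have "2 * pi * real p * (Re t - \<kappa>) - \<kappa> * Im t \<le> \<kappa> * pi" by linarith
        hence "2 * pi * real N / (norm \<xi>)\<^sup>2 * (2 * pi * real p * (Re t - \<kappa>) - \<kappa> * Im t) \<le> 2 * pi * real N / (norm \<xi>)\<^sup>2 * (\<kappa> * pi)"
          by (rule mult_left_mono) simp
        also have "\<dots> = dual_rate N / 2" by (simp add: dual_rate_def power2_eq_square)
        finally show ?thesis unfolding norm_exp_coord by simp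
      qed
      have "(\<Prod>n<p. 1 - exp (- (dual_rate N / 2))) \<le> (\<Prod>n<p. norm (1 - exp (2 * pi * \<i> * coord N t - of_nat (Suc n) * (4 * (of_real pi)\<^sup>2 / mesh N))))"
      proof (rule prod_mono)
        fix n
        have "norm (exp (2 * pi * \<i> * coord N t - of_nat (Suc n) * (4 * (of_real pi)\<^sup>2 / mesh N))) \<le> exp (dual_rate N / 2) * exp (- dual_rate N)"
          by (rule order_trans[OF norm_exp_theta_rest_le]) (rule mult_right_mono[OF X], simp)
        also have "\<dots> = exp (- (dual_rate N / 2))" unfolding exp_add[symmetric] by simp
        finally have "1 - exp (- (dual_rate N / 2)) \<le> norm (1 - exp (2 * pi * \<i> * coord N t - of_nat (Suc n) * (4 * (of_real pi)\<^sup>2 / mesh N)))"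
          using norm_triangle_ineq2[of 1 "exp (2 * pi * \<i> * coord N t - of_nat (Suc n) * (4 * (of_real pi)\<^sup>2 / mesh N))"]
          unfolding norm_one by linarith
        thus "0 \<le> 1 - exp (- (dual_rate N / 2)) \<and> 1 - exp (- (dual_rate N / 2)) \<le> norm (1 - exp (2 * pi * \<i> * coord N t - of_nat (Suc n) * (4 * (of_real pi)\<^sup>2 / mesh N)))"
          using dual_rate_nonneg[of N] by simp
      qed
      hence "(1 - exp (- (dual_rate N / 2))) ^ p \<le> norm (theta_rest N (coord N t))" by (simp add: theta_rest_def prod_norm)
      thus "1 / 2 \<le> norm (theta_rest N (coord N t))" using elim by linarith
    qed
  qed
qed

text \<open>For |rho| <= 1 the phase rho kappa stays within a right angle, so the exponential has
  nonnegative real part; for larger |rho| its modulus is far from 1.\<close>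

lemma norm_one_plus_exp_ge:
  fixes \<rho> :: real
  shows "norm (1 + exp (of_real \<rho> * Complex (2 * pi * real p) \<kappa>)) \<ge> 1 / 2"
proof -
  define E where "E = exp (of_real \<rho> * Complex (2 * pi * real p) \<kappa>)"
  have nE: "norm E = exp (\<rho> * (2 * pi * real p))" by (simp add: E_def)
  have p6: "6 \<le> 2 * pi * real p"
  proof -
    have "6 * 1 \<le> 2 * pi * real p" by (intro mult_mono) (use pi_approx p_pos in auto)
    thus ?thesis by simp
  qed
  consider "\<bar>\<rho>\<bar> \<le> 1" | "\<rho> > 1" | "\<rho> < - 1" by linarith
  hence "norm (1 + E) \<ge> 1 / 2"
  proof cases
    case 1
    have "\<bar>\<rho> * \<kappa>\<bar> \<le> 1 * 1" unfolding abs_mult by (intro mult_mono) (use 1 kappa_le kappa_pos in auto)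
    hence "\<bar>\<rho> * \<kappa>\<bar> \<le> pi / 2" using pi_approx by simp
    hence "cos (\<rho> * \<kappa>) \<ge> 0" by (intro cos_ge_zero) auto
    hence "Re E \<ge> 0" by (simp add: E_def Re_exp)
    hence "Re (1 + E) \<ge> 1" by simp
    thus ?thesis using complex_Re_le_cmod[of "1 + E"] by linarith
  next
    case 2
    have "1 * 6 \<le> \<rho> * (2 * pi * real p)" by (intro mult_mono) (use 2 p6 in auto)
    hence "norm E \<ge> 7" unfolding nE using exp_ge_add_one_self[of "\<rho> * (2 * pi * real p)"] by linarith
    thus ?thesis using norm_triangle_ineq2[of E "- 1"] by (simp add: add.commute)
  next
    case 3
    have "1 * 6 \<le> (- \<rho>) * (2 * pi * real p)" by (intro mult_mono) (use 3 p6 in auto)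
    hence "exp (\<rho> * (2 * pi * real p)) \<le> exp (- 1)" by simp
    also have "exp (- 1) \<le> (1 / 2 :: real)"
      using exp_ge_add_one_self[of "1 :: real"] by (simp add: exp_minus inverse_eq_divide field_simps)
    finally show ?thesis using norm_triangle_ineq2[of 1 "- E"] unfolding nE[symmetric] by simp
  qed
  thus ?thesis unfolding E_def .
qed

text \<open>This is where the half-integer position of the cut is used: it turns exp (2 pi i x) into
  minus an exponential whose phase is small while its modulus is near 1.\<close>

lemma bottom_kernel:
  assumes N: "N > 0" and t: "Im t = - cut_height N"
  shows "norm (1 - exp (2 * pi * \<i> * coord N t)) \<ge> 1 / 2"
proof -
  define r where "r = Re t - \<kappa> + (real (cut_index N) + 1 / 2) * (\<kappa> / real N)"
  have tr: "t - of_real \<kappa> = - (of_real (real (cut_index N) + 1 / 2) * mesh N) + of_real r"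
    by (rule complex_eqI) (use N t in \<open>auto simp: r_def Re_mesh Im_mesh cut_height_def\<close>)
  have x: "coord N t = - of_real (real (cut_index N) + 1 / 2) + of_real r * of_nat N / \<xi>"
  proof -
    have "coord N t = - of_real (real (cut_index N) + 1 / 2) + of_real r / mesh N"
      unfolding coord_def tr using mesh_nonzero[OF N] by (simp add: diff_divide_distrib del: of_real_add)
    thus ?thesis by (simp add: mesh_def)
  qed
  define \<rho> where "\<rho> = 2 * pi * r * real N / (norm \<xi>)\<^sup>2"
  have inv: "1 / \<xi> = Complex \<kappa> (- (2 * pi * real p)) / of_real ((norm \<xi>)\<^sup>2)"
  proof -
    have "cnj \<xi> = Complex \<kappa> (- (2 * pi * real p))" by (rule complex_eqI) auto
    thus ?thesis using complex_div_cnj[of 1 \<xi>] by simp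
  qed
  have "2 * pi * \<i> * (of_real r * of_nat N / \<xi>) = of_real (2 * pi * r * real N) * (\<i> * (1 / \<xi>))" by simp
  also have "\<dots> = of_real \<rho> * Complex (2 * pi * real p) \<kappa>"
    unfolding inv \<rho>_def by (simp add: complex_eq_iff Re_divide_of_real Im_divide_of_real)
  finally have e1: "2 * pi * \<i> * (of_real r * of_nat N / \<xi>) = of_real \<rho> * Complex (2 * pi * real p) \<kappa>" .
  have "2 * pi * \<i> * coord N t = 2 * pi * \<i> * (of_real r * of_nat N / \<xi>) - (pi * \<i> + 2 * of_int (int (cut_index N)) * pi * \<i>)"
    unfolding x by (simp add: algebra_simps)
  also have "exp \<dots> = exp (2 * pi * \<i> * (of_real r * of_nat N / \<xi>)) / (exp (pi * \<i>) * exp (2 * of_int (int (cut_index N)) * pi * \<i>))"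
    by (simp only: exp_diff exp_add)
  also have "exp (2 * of_int (int (cut_index N)) * pi * \<i>) = 1" using exp_integer_2pi[of "of_int (int (cut_index N))"] by simp
  finally have "exp (2 * pi * \<i> * coord N t) = - exp (of_real \<rho> * Complex (2 * pi * real p) \<kappa>)"
    unfolding e1 by simp
  thus ?thesis using norm_one_plus_exp_ge[of \<rho>] by simp
qed


text \<open>The points beyond the cut have Im t <= - 3, where \<open>Psi_low\<close> gives the rate
  - 0.2; half of it pays for the error of \<open>F_asymp_rough\<close>.\<close>

lemma tail_bound:
  "eventually (\<lambda>N. norm (\<Sum>j=Suc (cut_index N)..N. F N (of_real \<kappa> - of_nat j * mesh N)) \<le> real N * exp (- (0.1 / (norm \<xi>)\<^sup>2 * real N))) sequentially"
proof -
  define c where "c = 0.1 / (norm \<xi>)\<^sup>2"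
  have c: "c > 0" by (simp add: c_def)
  show ?thesis
    using F_asymp_rough[OF kappa_pos c] eventually_ge_at_top[of "50 * p"]
  proof eventually_elim
    case (elim N)
    note M = cut_index_height[OF elim(2)]
    have b: "norm (F N (of_real \<kappa> - of_nat j * mesh N)) \<le> exp (- (c * real N))" if j: "j \<in> {Suc (cut_index N)..N}" for j
    proof -
      define t where "t = of_real \<kappa> - of_nat j * mesh N"
      have Ret: "Re t = \<kappa> - real j * (\<kappa> / real N)" and Imt: "Im t = - (real j * (2 * pi * real p / real N))"
        by (simp_all add: t_def Re_mesh Im_mesh)
      have kN: "\<kappa> / real N > 0" using kappa_pos M(1) by simp
      have "1 * (\<kappa> / real N) \<le> real j * (\<kappa> / real N)" by (rule mult_right_mono) (use j kN in auto)
      hence 1: "Re t \<le> \<kappa> - \<kappa> / real N" unfolding Ret by simp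
      have "real j * (\<kappa> / real N) \<le> real N * (\<kappa> / real N)" by (rule mult_right_mono) (use j kN in auto)
      hence 2: "0 \<le> Re t" unfolding Ret using M(1) by simp
      have "(real (cut_index N) + 1 / 2) * (2 * pi * real p / real N) \<le> real j * (2 * pi * real p / real N)"
        by (rule mult_right_mono) (use j in auto)
      hence 3: "Im t \<le> - 3" unfolding Imt using M(3) by (simp add: cut_height_def)
      have "Psi t \<le> - 0.2 / (norm \<xi>)\<^sup>2" by (rule Psi_low) (use 1 2 3 kN in auto)
      hence "real N * (Psi t + c) \<le> real N * (- c)" by (intro mult_left_mono) (auto simp: c_def)
      moreover have "norm (F N t) \<le> exp (real N * (Psi t + c))" using elim(1) 1 2 by blast
      moreover have "real N * (- c) = - (c * real N)" by simp
      ultimately have "norm (F N t) \<le> exp (- (c * real N))" by (metis exp_le_cancel_iff order_trans)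
      thus ?thesis unfolding t_def .
    qed
    have "norm (\<Sum>j=Suc (cut_index N)..N. F N (of_real \<kappa> - of_nat j * mesh N)) \<le> (\<Sum>j=Suc (cut_index N)..N. exp (- (c * real N)))"
      by (rule sum_norm_le[OF b])
    also have "\<dots> = real (card {Suc (cut_index N)..N}) * exp (- (c * real N))" by simp
    also have "\<dots> \<le> real N * exp (- (c * real N))" by (intro mult_right_mono) auto
    finally show ?case unfolding c_def .
  qed
qed

lemma bottom_bound:
  "eventually (\<lambda>N. norm (contour_integral (linepath (Complex 0 (- cut_height N)) (Complex (\<kappa> - \<kappa> / (2 * real N)) (- cut_height N))) (Q N))
     \<le> 4 * exp (- (0.1 / (norm \<xi>)\<^sup>2 * real N))) sequentially"
proof -
  define c where "c = 0.1 / (norm \<xi>)\<^sup>2"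
  have c: "c > 0" by (simp add: c_def)
  have k2: "\<kappa> / 2 > 0" using kappa_pos by simp
  show ?thesis
    using F_asymp_rough[OF k2 c] theta_rest_lower eventually_ge_at_top[of "50 * p"]
  proof eventually_elim
    case (elim N)
    note M = cut_index_height[OF elim(3)]
    define a where "a = Complex 0 (- cut_height N)"
    define a2 where "a2 = Complex (\<kappa> - \<kappa> / (2 * real N)) (- cut_height N)"
    have sN: "\<kappa> / (2 * real N) > 0" "\<kappa> / (2 * real N) \<le> \<kappa>" using kappa_pos M(1) by (auto simp: field_simps)
    have seg: "Im t = - cut_height N" "0 \<le> Re t" "Re t \<le> \<kappa> - \<kappa> / (2 * real N)" if "t \<in> closed_segment a a2" for t
      using that sN by (auto simp: a_def a2_def closed_segment_same_Im closed_segment_eq_real_ivl split: if_splits)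
    have cont: "continuous_on (closed_segment a a2) (Q N)"
    proof (rule continuous_on_subset[OF residue_sum(1)[OF elim(3)]], rule subsetI)
      fix t assume t: "t \<in> closed_segment a a2"
      show "t \<in> cbox (Complex 0 (- cut_height N)) (Complex (\<kappa> - \<kappa> / (2 * real N)) 0) - box (Complex 0 (- cut_height N)) (Complex (\<kappa> - \<kappa> / (2 * real N)) 0)"
        using seg[OF t] M(3) by (auto simp: in_cbox_complex_iff in_box_complex_iff)
    qed
    have b: "norm (Q N t) \<le> 4 * exp (- (c * real N))" if t: "t \<in> closed_segment a a2" for t
    proof -
      note s = seg[OF t]
      have "\<kappa> / 2 / real N = \<kappa> / (2 * real N)" by simp
      hence "norm (F N t) \<le> exp (real N * (Psi t + c))" using elim(1) s by metis
      moreover have "Psi t \<le> - 0.2 / (norm \<xi>)\<^sup>2" by (rule Psi_low) (use s sN M(3) in auto)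
      hence "real N * (Psi t + c) \<le> real N * (- c)" by (intro mult_left_mono) (auto simp: c_def)
      moreover have "real N * (- c) = - (c * real N)" by simp
      ultimately have F: "norm (F N t) \<le> exp (- (c * real N))" by (metis exp_le_cancel_iff order_trans)
      have "norm (theta_rest N (coord N t)) \<ge> 1 / 2" using elim(2) s sN M(2) by auto
      moreover have "norm (1 - exp (2 * pi * \<i> * coord N t)) \<ge> 1 / 2" by (rule bottom_kernel[OF M(1) s(1)])
      ultimately have d: "norm (theta_factors (mesh N) (Suc p) (coord N t)) \<ge> 1 / 2 * (1 / 2)"
        unfolding theta_factors_eq_theta_rest norm_mult by (intro mult_mono) auto
      have "norm (Q N t) \<le> exp (- (c * real N)) / (1 / 2 * (1 / 2))"
        unfolding Q_def norm_divide by (rule frac_le) (use F d in auto)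
      thus ?thesis by simp
    qed
    have "norm (contour_integral (linepath a a2) (Q N)) \<le> 4 * exp (- (c * real N)) * norm (a2 - a)"
      by (rule contour_integral_bound_linepath[OF contour_integrable_continuous_linepath[OF cont] _ b]) auto
    also have "norm (a2 - a) \<le> 1"
    proof -
      have "a2 - a = of_real (\<kappa> - \<kappa> / (2 * real N))" by (simp add: a_def a2_def complex_eq_iff)
      hence "norm (a2 - a) = \<bar>\<kappa> - \<kappa> / (2 * real N)\<bar>" by (simp only: norm_of_real)
      thus ?thesis using sN kappa_le by linarith
    qed
    hence "4 * exp (- (c * real N)) * norm (a2 - a) \<le> 4 * exp (- (c * real N)) * 1" by (intro mult_left_mono) auto
    finally show ?case unfolding a_def a2_def c_def by simp
  qed
qed

text \<open>\<open>F\<close> decays because V has dropped by a fixed amount at kappa/2. The kernel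
  exp (2 pi i x) does not tend to 0 near the right end, but kappa/(2N) left of kappa its modulus is
  still at most \<open>x0\<close> < 1, independently of N.\<close>

lemma top_far_bound:
  "\<exists>c>0. \<exists>K. eventually (\<lambda>N. norm (integral {\<kappa> / 2..\<kappa> - \<kappa> / (2 * real N)} (\<lambda>x. Q N (of_real x))) \<le> K * exp (- (c * real N))) sequentially"
proof -
  define c where "c = \<kappa> * (\<kappa> / 2) ^ 3 / 3 / (norm \<xi>)\<^sup>2 / 2"
  have c: "c > 0" using kappa_pos by (simp add: c_def)
  have k2: "\<kappa> / 2 > 0" using kappa_pos by simp
  define x0 where "x0 = exp (- (2 * pi\<^sup>2 * real p * \<kappa> / (norm \<xi>)\<^sup>2))"
  have x0: "x0 < 1" using p_pos kappa_pos by (simp add: x0_def)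
  define K where "K = 1 / ((1 - x0) * (1 / 2))"
  have K: "K > 0" using x0 by (simp add: K_def)
  show ?thesis
  proof (rule exI[of _ c], rule conjI[OF c], rule exI[of _ K])
    show "eventually (\<lambda>N. norm (integral {\<kappa> / 2..\<kappa> - \<kappa> / (2 * real N)} (\<lambda>x. Q N (of_real x))) \<le> K * exp (- (c * real N))) sequentially"
      using F_asymp_rough[OF k2 c] theta_rest_lower eventually_ge_at_top[of "50 * p"]
    proof eventually_elim
      case (elim N)
      note M = cut_index_height[OF elim(3)]
      have sN: "\<kappa> / (2 * real N) > 0" "\<kappa> / (2 * real N) \<le> \<kappa> / 2" using kappa_pos M(1) by (auto simp: field_simps)
      have b: "norm (Q N (of_real x)) \<le> K * exp (- (c * real N))" if x: "x \<in> {\<kappa> / 2..\<kappa> - \<kappa> / (2 * real N)}" for x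
      proof -
        have xs: "0 \<le> x" "x \<le> \<kappa>" "\<kappa> / 2 \<le> x" using x sN kappa_pos by auto
        have "\<kappa> / 2 / real N = \<kappa> / (2 * real N)" by simp
        hence F1: "norm (F N (of_real x)) \<le> exp (real N * (Psi (of_real x) + c))" using elim(1) x xs by auto
        have "Psi (of_real x) = \<kappa> * V_on_real x / (norm \<xi>)\<^sup>2"
          unfolding Psi_eq V_real_eq[OF xs(1,2)] by simp
        also have "\<dots> \<le> \<kappa> * (- ((\<kappa> / 2) ^ 3) / 3) / (norm \<xi>)\<^sup>2"
        proof (intro divide_right_mono mult_left_mono)
          have "(\<kappa> / 2) ^ 3 \<le> x ^ 3" by (rule power_mono) (use xs kappa_pos in auto)
          thus "V_on_real x \<le> - ((\<kappa> / 2) ^ 3) / 3" using V_on_real_le[OF xs(1,2)] by simp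
        qed (use kappa_pos in auto)
        also have "\<dots> = - c - c" by (simp add: c_def)
        finally have "real N * (Psi (of_real x) + c) \<le> real N * (- c)" by (intro mult_left_mono) auto
        moreover have "real N * (- c) = - (c * real N)" by simp
        ultimately have F: "norm (F N (of_real x)) \<le> exp (- (c * real N))" using F1 by (metis exp_le_cancel_iff order_trans)
        have "norm (exp (2 * pi * \<i> * coord N (of_real x))) \<le> x0"
        proof -
          have "2 * pi * real p * (x - \<kappa>) \<le> 2 * pi * real p * (- (\<kappa> / (2 * real N)))"
            by (rule mult_left_mono) (use x in auto)
          hence "2 * pi * real N / (norm \<xi>)\<^sup>2 * (2 * pi * real p * (x - \<kappa>)) \<le> 2 * pi * real N / (norm \<xi>)\<^sup>2 * (2 * pi * real p * (- (\<kappa> / (2 * real N))))"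
            by (rule mult_left_mono) simp
          also have "\<dots> = - (2 * pi\<^sup>2 * real p * \<kappa> / (norm \<xi>)\<^sup>2)"
            using M(1) by (simp add: power2_eq_square)
          finally show ?thesis unfolding norm_exp_coord x0_def by simp
        qed
        hence X: "norm (1 - exp (2 * pi * \<i> * coord N (of_real x))) \<ge> 1 - x0"
          using norm_triangle_ineq2[of 1 "exp (2 * pi * \<i> * coord N (of_real x))"] unfolding norm_one by linarith
        have "norm (theta_rest N (coord N (of_real x))) \<ge> 1 / 2" using elim(2) xs by auto
        hence d: "norm (theta_factors (mesh N) (Suc p) (coord N (of_real x))) \<ge> (1 - x0) * (1 / 2)"
          unfolding theta_factors_eq_theta_rest norm_mult using X x0 by (intro mult_mono) auto
        have "norm (Q N (of_real x)) \<le> exp (- (c * real N)) / ((1 - x0) * (1 / 2))"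
          unfolding Q_def norm_divide by (rule frac_le) (use F d x0 in auto)
        thus ?thesis by (simp add: K_def mult.commute)
      qed
      have cont: "continuous_on {\<kappa> / 2..\<kappa> - \<kappa> / (2 * real N)} (\<lambda>x. Q N (of_real x))"
        by (rule continuous_on_compose2[OF residue_sum(1)[OF elim(3)]])
           (use M sN kappa_pos in \<open>auto intro!: continuous_intros simp: in_cbox_complex_iff in_box_complex_iff\<close>)
      have "norm (integral {\<kappa> / 2..\<kappa> - \<kappa> / (2 * real N)} (\<lambda>x. Q N (of_real x))) \<le> K * exp (- (c * real N)) * (\<kappa> - \<kappa> / (2 * real N) - \<kappa> / 2)"
        by (rule integral_bound[OF _ cont]) (use b sN in auto)
      also have "\<dots> \<le> K * exp (- (c * real N)) * 1"
        by (rule mult_left_mono) (use sN kappa_le kappa_pos K in auto)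
      finally show ?case by simp
    qed
  qed
qed

text \<open>The rectangle runs counterclockwise, so its upper edge gives - (I1 + I3) and its left
  edge, traversed downwards, gives - i I2; the minus sign in \<open>residue_sum\<close> makes both
  positive. The prefactor grows only linearly in N and is absorbed by the exponentially small
  pieces.\<close>

lemma main_decomp:
  "(\<lambda>N. (\<Sum>j=1..N. F N (of_real \<kappa> - of_nat j * mesh N))
      - theta_rest N 0 / mesh N * (integral {0..\<kappa> / 2} (\<lambda>x. Q N (of_real x)) + \<i> * integral {0..cut_height N} (\<lambda>y. Q N (- (\<i> * of_real y))))) \<longlonglongrightarrow> 0"
proof -
  obtain c1 where c1: "c1 > 0" "eventually (\<lambda>N. norm (contour_integral (linepath (Complex (\<kappa> - \<kappa> / (2 * real N)) (- cut_height N)) (of_real (\<kappa> - \<kappa> / (2 * real N)))) (Q_right N))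
     \<le> 20 * exp (- c1 * real N)) sequentially"
    using right_edge by blast
  obtain c2 K where c2: "c2 > 0" "eventually (\<lambda>N. norm (integral {\<kappa> / 2..\<kappa> - \<kappa> / (2 * real N)} (\<lambda>x. Q N (of_real x))) \<le> K * exp (- (c2 * real N))) sequentially"
    using top_far_bound by blast
  define c0 where "c0 = 0.1 / (norm \<xi>)\<^sup>2"
  have c0: "c0 > 0" by (simp add: c0_def)
  define E where "E N = real N * exp (- (c0 * real N)) + 2 ^ p * (real N / norm \<xi>) * (K * exp (- (c2 * real N)) + 4 * exp (- (c0 * real N)) + 20 * exp (- c1 * real N))" for N
  have "E \<longlonglongrightarrow> 0"
  proof -
    have l: "(\<lambda>N. real N * exp (- (c * real N))) \<longlonglongrightarrow> 0" if "c > 0" for c using that by real_asymp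
    have "(\<lambda>N. real N * exp (- (c0 * real N)) + 2 ^ p / norm \<xi> * (K * (real N * exp (- (c2 * real N))) + 4 * (real N * exp (- (c0 * real N))) + 20 * (real N * exp (- (c1 * real N)))))
       \<longlonglongrightarrow> 0 + 2 ^ p / norm \<xi> * (K * 0 + 4 * 0 + 20 * 0)"
      by (intro tendsto_intros l c0 c1 c2)
    thus ?thesis unfolding E_def by (simp add: algebra_simps add_divide_distrib)
  qed
  moreover have "eventually (\<lambda>N. norm ((\<Sum>j=1..N. F N (of_real \<kappa> - of_nat j * mesh N))
      - theta_rest N 0 / mesh N * (integral {0..\<kappa> / 2} (\<lambda>x. Q N (of_real x)) + \<i> * integral {0..cut_height N} (\<lambda>y. Q N (- (\<i> * of_real y))))) \<le> E N) sequentially"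
    using c1(2) c2(2) tail_bound bottom_bound theta_rest_lower eventually_ge_at_top[of "50 * p"]
  proof eventually_elim
    case (elim N)
    note M = cut_index_height[OF elim(6)]
    define s where "s = \<kappa> / (2 * real N)"
    have sN: "s > 0" "s \<le> \<kappa> / 2" "s < \<kappa> / real N" using kappa_pos M(1) unfolding s_def by (auto simp: field_simps)
    define a where "a = Complex 0 (- cut_height N)"
    define b where "b = Complex (\<kappa> - s) 0"
    define a2 where "a2 = Complex (\<kappa> - s) (- cut_height N)"
    have cont: "continuous_on (cbox a b - box a b) (Q N)" unfolding a_def b_def s_def by (rule residue_sum(1)[OF elim(6)])
    have le: "Re a \<le> Re b" "Im a \<le> Im b" using sN kappa_pos M(3) by (auto simp: a_def b_def)
    define B R where "B = contour_integral (linepath a a2) (Q N)" and "R = contour_integral (linepath a2 b) (Q N)"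
    define I1 I2 I3 where "I1 = integral {0..\<kappa> / 2} (\<lambda>x. Q N (of_real x))"
      and "I2 = integral {0..cut_height N} (\<lambda>y. Q N (- (\<i> * of_real y)))"
      and "I3 = integral {\<kappa> / 2..\<kappa> - s} (\<lambda>x. Q N (of_real x))"
    have top: "contour_integral (linepath b 0) (Q N) = - (I1 + I3)"
    proof -
      have seg: "closed_segment b 0 \<subseteq> cbox a b - box a b"
      proof
        fix t assume "t \<in> closed_segment b 0"
        hence "Im t = 0" "0 \<le> Re t" "Re t \<le> \<kappa> - s" using sN kappa_pos
          by (auto simp: b_def closed_segment_same_Im closed_segment_eq_real_ivl split: if_splits)
        thus "t \<in> cbox a b - box a b" using M(3) by (auto simp: in_cbox_complex_iff in_box_complex_iff a_def b_def)
      qed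
      have "contour_integral (linepath b 0) (Q N) = - contour_integral (linepath 0 b) (Q N)"
        by (rule contour_integral_reverse_linepath[OF continuous_on_subset[OF cont seg]])
      also have "contour_integral (linepath 0 b) (Q N) = integral {0..\<kappa> - s} (\<lambda>x. Q N (of_real x))"
      proof -
        have "b \<in> \<real>" by (simp add: b_def complex_is_Real_iff)
        thus ?thesis using contour_integral_linepath_Reals_eq[of 0 b "Q N"] sN kappa_pos by (simp add: b_def)
      qed
      also have "\<dots> = I1 + I3" unfolding I1_def I3_def
      proof (rule Henstock_Kurzweil_Integration.integral_combine[symmetric])
        have "continuous_on {0..\<kappa> - s} (\<lambda>x. Q N (of_real x))"
          by (rule continuous_on_compose2[OF cont])
             (use M sN kappa_pos in \<open>auto intro!: continuous_intros simp: in_cbox_complex_iff in_box_complex_iff a_def b_def\<close>)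
        thus "(\<lambda>x. Q N (of_real x)) integrable_on {0..\<kappa> - s}" by (rule integrable_continuous_real)
      qed (use sN kappa_pos in auto)
      finally show ?thesis .
    qed
    have left: "contour_integral (linepath 0 a) (Q N) = - \<i> * I2"
    proof -
      have "a = - (\<i> * of_real (cut_height N))" by (simp add: a_def complex_eq_iff)
      thus ?thesis using contour_integral_linepath_imag[of "cut_height N" "Q N"] M(3) by (simp add: I2_def)
    qed
    have "contour_integral (rectpath a b) (Q N) = B + R + contour_integral (linepath b 0) (Q N) + contour_integral (linepath 0 a) (Q N)"
    proof -
      have "Complex (Re b) (Im a) = a2" "Complex (Re a) (Im b) = 0" by (simp_all add: a_def b_def a2_def complex_eq_iff)
      thus ?thesis using contour_integral_rectpath_split[OF le cont] by (simp add: B_def R_def)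
    qed
    hence rect: "- (mesh N / theta_rest N 0) * (\<Sum>j=1..cut_index N. F N (of_real \<kappa> - of_nat j * mesh N)) = B + R - (I1 + I3) - \<i> * I2"
      using residue_sum(2)[OF elim(6), folded s_def a_def b_def] top left by simp
    have d0: "theta_rest N 0 \<noteq> 0"
    proof -
      have "norm (theta_rest N (coord N (of_real \<kappa>))) \<ge> 1 / 2" using elim(5) by simp
      thus ?thesis by (auto simp: coord_def)
    qed
    have w0: "mesh N \<noteq> 0" by (rule mesh_nonzero[OF M(1)])
    define Z where "Z = theta_rest N 0 / mesh N"
    have SM: "(\<Sum>j=1..cut_index N. F N (of_real \<kappa> - of_nat j * mesh N)) = Z * (I1 + \<i> * I2) + Z * (I3 - B - R)"
    proof -
      have "(\<Sum>j=1..cut_index N. F N (of_real \<kappa> - of_nat j * mesh N)) = - Z * (- (mesh N / theta_rest N 0) * (\<Sum>j=1..cut_index N. F N (of_real \<kappa> - of_nat j * mesh N)))"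
        unfolding Z_def using d0 w0 by simp
      also have "\<dots> = Z * (I1 + \<i> * I2) + Z * (I3 - B - R)" unfolding rect by (simp add: algebra_simps)
      finally show ?thesis .
    qed
    define Tl where "Tl = (\<Sum>j=Suc (cut_index N)..N. F N (of_real \<kappa> - of_nat j * mesh N))"
    have "(\<Sum>j=1..N. F N (of_real \<kappa> - of_nat j * mesh N)) = (\<Sum>j=1..cut_index N. F N (of_real \<kappa> - of_nat j * mesh N)) + Tl"
      unfolding Tl_def
      using sum.ub_add_nat[of 1 "cut_index N" "\<lambda>j. F N (of_real \<kappa> - of_nat j * mesh N)" "N - cut_index N"] M(5) by simp
    hence "(\<Sum>j=1..N. F N (of_real \<kappa> - of_nat j * mesh N)) - Z * (I1 + \<i> * I2) = Tl + Z * (I3 - B - R)"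
      unfolding SM by simp
    hence "norm ((\<Sum>j=1..N. F N (of_real \<kappa> - of_nat j * mesh N)) - Z * (I1 + \<i> * I2)) \<le> norm Tl + norm Z * norm (I3 - B - R)"
      using norm_triangle_ineq[of Tl "Z * (I3 - B - R)"] by (simp add: norm_mult)
    moreover have "norm (I3 - B - R) \<le> norm I3 + norm B + norm R"
      using norm_triangle_ineq4[of "I3 - B" R] norm_triangle_ineq4[of I3 B] by linarith
    moreover have "norm I3 + norm B + norm R \<le> K * exp (- (c2 * real N)) + 4 * exp (- (c0 * real N)) + 20 * exp (- c1 * real N)"
    proof (intro add_mono)
      show "norm I3 \<le> K * exp (- (c2 * real N))" using elim(2) by (simp add: I3_def s_def)
      show "norm B \<le> 4 * exp (- (c0 * real N))" using elim(4) by (simp add: B_def a_def a2_def s_def c0_def)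
      have "R = contour_integral (linepath a2 b) (Q_right N)" unfolding R_def
      proof (rule contour_integral_eq)
        fix t assume "t \<in> path_image (linepath a2 b)"
        hence Ret: "Re t = \<kappa> - s" by (auto simp: a2_def b_def closed_segment_same_Re)
        show "Q N t = Q_right N t"
          by (rule Q_right_eq_Q[OF M(1) _ theta_factors_nonzero_line[OF M(1)], symmetric]) (use Ret sN in \<open>auto simp: s_def\<close>)
      qed
      moreover have "b = of_real (\<kappa> - s)" by (simp add: b_def complex_eq_iff)
      ultimately show "norm R \<le> 20 * exp (- c1 * real N)" using elim(1) by (simp add: a2_def s_def)
    qed
    moreover have nZ: "norm Z \<le> 2 ^ p * (real N / norm \<xi>)"
    proof -
      have "norm Z = norm (theta_rest N 0) * (real N / norm \<xi>)" by (simp add: Z_def mesh_def norm_divide norm_mult)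
      thus ?thesis using mult_right_mono[OF theta_rest_0_norm_le[of N], of "real N / norm \<xi>"] by simp
    qed
    moreover have "norm Tl \<le> real N * exp (- (c0 * real N))" using elim(3) by (simp add: Tl_def c0_def)
    moreover have "norm Z * norm (I3 - B - R) \<le> 2 ^ p * (real N / norm \<xi>) * (K * exp (- (c2 * real N)) + 4 * exp (- (c0 * real N)) + 20 * exp (- c1 * real N))"
      by (rule mult_mono[OF nZ order_trans[OF calculation(2,3)]]) auto
    ultimately have "norm ((\<Sum>j=1..N. F N (of_real \<kappa> - of_nat j * mesh N)) - Z * (I1 + \<i> * I2)) \<le> E N"
      unfolding E_def by linarith
    thus ?case unfolding Z_def I1_def I2_def .
  qed
  ultimately show ?thesis by (rule Lim_null_comparison[rotated])
qed

end

section \<open>Laplace asymptotics at a cubic critical point\<close>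

text \<open>The integrand is the exponential majorant supplied by \<open>exp_minus_cube_le\<close>,
  hence the factor exp c.\<close>

lemma integrable_exp_minus_cube:
  assumes "c > 0" shows "(\<lambda>x :: real. C * (exp c * exp (- c * x))) integrable_on {0..}"
  by (rule has_integral_integrable[OF has_integral_mult_right[OF has_integral_mult_right[OF
        has_integral_exp_minus_to_infinity[OF assms, of 0]]]])

text \<open>Turns integrals over growing intervals into integrals over one fixed domain, as
  dominated convergence needs.\<close>

lemma integral_restrict_to:
  fixes f :: "'a :: euclidean_space \<Rightarrow> 'b :: banach"
  assumes "f integrable_on S" "S \<subseteq> T"
  shows "(\<lambda>x. if x \<in> S then f x else 0) integrable_on T" "integral T (\<lambda>x. if x \<in> S then f x else 0) = integral S f"
proof -
  have "((\<lambda>x. if x \<in> S then f x else 0) has_integral integral S f) T"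
    unfolding has_integral_restrict[OF assms(2)] by (rule integrable_integral[OF assms(1)])
  thus "(\<lambda>x. if x \<in> S then f x else 0) integrable_on T" "integral T (\<lambda>x. if x \<in> S then f x else 0) = integral S f"
    by (auto simp: integrable_on_def integral_unique)
qed

lemma exp_minus_cube_le:
  fixes x :: real
  assumes "c > 0" "x \<ge> 0" shows "exp (- c * x ^ 3) \<le> exp c * exp (- c * x)"
proof -
  have "x - 1 \<le> x ^ 3"
  proof (cases "x \<le> 1")
    case True
    have "0 \<le> x ^ 3" using assms(2) by simp
    thus ?thesis using True by linarith
  next
    case False
    have "x ^ 1 \<le> x ^ 3" by (rule power_increasing) (use False in auto)
    thus ?thesis by simp
  qed
  hence "c * (x - 1) \<le> c * x ^ 3" by (rule mult_left_mono) (use assms in simp)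
  thus ?thesis unfolding exp_add[symmetric] by (simp add: algebra_simps)
qed

lemma integral_atLeast_0_limit:
  fixes f :: "real \<Rightarrow> complex"
  assumes cont: "continuous_on {0..} f" and c: "c > 0" and b: "\<And>x. x \<ge> 0 \<Longrightarrow> norm (f x) \<le> exp (- c * x ^ 3)"
  shows "(\<lambda>n. integral {0..real n} f) \<longlonglongrightarrow> integral {0..} f"
proof -
  define g where "g n x = (if x \<in> {0..real n} then f x else 0)" for n x
  have int: "f integrable_on {0..real n}" for n
    by (intro integrable_continuous_real continuous_on_subset[OF cont]) auto
  have "(\<lambda>n. integral {0..} (g n)) \<longlonglongrightarrow> integral {0..} f"
  proof (rule dominated_convergence(2)[OF _ integrable_exp_minus_cube[OF c, of 1]])
    fix n
    show "g n integrable_on {0..}" unfolding g_def[abs_def] by (rule integral_restrict_to[OF int]) auto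
  next
    fix n and x :: real assume x: "x \<in> {0..}"
    have "norm (g n x) \<le> exp (- c * x ^ 3)" using b[of x] x by (simp add: g_def)
    also have "\<dots> \<le> exp c * exp (- c * x)" by (rule exp_minus_cube_le[OF c]) (use x in simp)
    finally show "norm (g n x) \<le> 1 * (exp c * exp (- c * x))" by simp
  next
    fix x :: real assume x: "x \<in> {0..}"
    have "eventually (\<lambda>n. g n x = f x) sequentially"
      using eventually_ge_at_top[of "nat \<lceil>x\<rceil>"]
    proof eventually_elim
      case (elim n)
      hence "x \<le> real n" by linarith
      thus ?case using x by (simp add: g_def)
    qed
    thus "(\<lambda>n. g n x) \<longlonglongrightarrow> f x" by (rule tendsto_eventually)
  qed
  moreover have "integral {0..} (g n) = integral {0..real n} f" for n
    unfolding g_def[abs_def] by (rule integral_restrict_to[OF int]) auto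
  ultimately show ?thesis by simp
qed

lemma integral_exp_minus_cube_limit:
  assumes "filterlim R at_top sequentially"
  shows "(\<lambda>n. integral {0..R n} (\<lambda>x :: real. exp (- (x ^ 3)))) \<longlonglongrightarrow> Gamma (1 / 3) / 3"
proof -
  define h where "h t = t powr (1 / 3 - 1) / exp t" for t :: real
  have H: "(h has_integral Gamma (1 / 3)) {0..}" unfolding h_def by (rule Gamma_integral_real) simp
  have sub: "integral {0..r} (\<lambda>x :: real. exp (- (x ^ 3))) = 1 / 3 * integral {0..r ^ 3} h" if r: "r > 0" for r
  proof -
    have r3: "(r ^ 3) powr (1 / 3) = r" using r by (simp add: powr_powr flip: powr_numeral)
    have "((\<lambda>t. (1 / 3 * t powr (1 / 3 - 1)) *\<^sub>R exp (- ((t powr (1 / 3)) ^ 3))) has_integral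
       (integral {0 powr (1 / 3)..(r ^ 3) powr (1 / 3)} (\<lambda>x. exp (- (x ^ 3)))
        - integral {(r ^ 3) powr (1 / 3)..0 powr (1 / 3)} (\<lambda>x. exp (- (x ^ 3))))) {0..r ^ 3}"
    \<comment> \<open>Substitution t = x^3 in the Gamma integral; 0 is an exceptional point because
      the cube root is not differentiable there.\<close>
    proof (rule has_integral_substitution_general[of "{0}" 0 "r ^ 3" _ 0 r])
      show "(\<lambda>t. t powr (1 / 3)) ` {0..r ^ 3} \<subseteq> {0..r}"
      proof (rule image_subsetI)
        fix t assume t: "t \<in> {0..r ^ 3}"
        have "t powr (1 / 3) \<le> (r ^ 3) powr (1 / 3)" by (rule powr_mono2) (use t in auto)
        thus "t powr (1 / 3) \<in> {0..r}" unfolding r3 by simp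
      qed
      show "continuous_on {0..r ^ 3} (\<lambda>t. t powr (1 / 3))" by (intro continuous_on_powr') (auto intro!: continuous_intros)
      fix t assume "t \<in> {0..r ^ 3} - {0}"
      hence t: "t > 0" by auto
      show "((\<lambda>t. t powr (1 / 3)) has_real_derivative 1 / 3 * t powr (1 / 3 - 1)) (at t within {0..r ^ 3})"
        using t by (auto intro!: derivative_eq_intros)
    qed (use r in \<open>auto intro!: continuous_intros\<close>)
    moreover have "integral {r..0} (\<lambda>x. exp (- (x ^ 3))) = 0" using r by simp
    ultimately have "((\<lambda>t. (1 / 3 * t powr (1 / 3 - 1)) *\<^sub>R exp (- ((t powr (1 / 3)) ^ 3))) has_integral integral {0..r} (\<lambda>x. exp (- (x ^ 3)))) {0..r ^ 3}"
      unfolding r3 by simp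
    moreover have "(1 / 3 * t powr (1 / 3 - 1)) *\<^sub>R exp (- ((t powr (1 / 3)) ^ 3)) = 1 / 3 * h t" if "t \<in> {0..r ^ 3}" for t
    proof -
      have t3: "(t powr (1 / 3)) ^ 3 = t"
      proof (cases "t = 0")
        case False
        hence "t > 0" using that by simp
        hence "(t powr (1 / 3)) ^ 3 = (t powr (1 / 3)) powr 3" by (simp add: powr_numeral)
        thus ?thesis using \<open>t > 0\<close> by (simp add: powr_powr)
      qed simp
      show ?thesis unfolding t3 h_def by (simp only: real_scaleR_def exp_minus divide_inverse mult.assoc)
    qed
    ultimately have "((\<lambda>t. 1 / 3 * h t) has_integral integral {0..r} (\<lambda>x. exp (- (x ^ 3)))) {0..r ^ 3}"
      by (rule has_integral_eq[rotated])
    hence "integral {0..r ^ 3} (\<lambda>t. 1 / 3 * h t) = integral {0..r} (\<lambda>x. exp (- (x ^ 3)))" by (rule integral_unique)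
    thus ?thesis by (simp only: integral_mult_right)
  qed
  have "(\<lambda>n. integral {0..R n ^ 3} h) \<longlonglongrightarrow> integral {0..} h"
  proof -
    define g where "g n x = (if x \<in> {0..R n ^ 3} then h x else 0)" for n x
    have hi: "h integrable_on {0..}" using H by (auto simp: integrable_on_def)
    have int: "h integrable_on {0..R n ^ 3}" for n by (rule integrable_on_subinterval[OF hi]) auto
    have "(\<lambda>n. integral {0..} (g n)) \<longlonglongrightarrow> integral {0..} h"
    proof (rule dominated_convergence(2)[OF _ hi])
      fix n
      show "g n integrable_on {0..}" unfolding g_def[abs_def] by (rule integral_restrict_to[OF int]) auto
      show "norm (g n x) \<le> h x" if "x \<in> {0..}" for x
        by (simp add: g_def h_def)
    next
      fix x :: real assume x: "x \<in> {0..}"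
      have "filterlim (\<lambda>n. R n ^ 3) at_top sequentially"
        by (intro filterlim_pow_at_top assms) simp
      hence "eventually (\<lambda>n. x \<le> R n ^ 3) sequentially" by (simp add: filterlim_at_top)
      hence "eventually (\<lambda>n. g n x = h x) sequentially"
        by eventually_elim (use x in \<open>simp add: g_def\<close>)
      thus "(\<lambda>n. g n x) \<longlonglongrightarrow> h x" by (rule tendsto_eventually)
    qed
    moreover have "integral {0..} (g n) = integral {0..R n ^ 3} h" for n
      unfolding g_def[abs_def] by (rule integral_restrict_to[OF int]) auto
    ultimately show ?thesis by simp
  qed
  hence "(\<lambda>n. 1 / 3 * integral {0..R n ^ 3} h) \<longlonglongrightarrow> 1 / 3 * Gamma (1 / 3)"
    using H by (intro tendsto_intros) (simp add: integral_unique)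
  moreover have "eventually (\<lambda>n. 1 / 3 * integral {0..R n ^ 3} h = integral {0..R n} (\<lambda>x. exp (- (x ^ 3)))) sequentially"
    using assms unfolding filterlim_at_top_dense by (rule allE[of _ 0]) (auto elim!: eventually_mono simp: sub)
  ultimately show ?thesis by (auto dest: Lim_transform_eventually)
qed

text \<open>Rotation of the ray: the hypothesis means |arg zeta| < pi/6, the sector around the
  positive axis where Re (s^3) > 0. With a primitive of exp (- s^3), the values at zeta n and Re
  zeta n are compared along the vertical segment that joins them.\<close>

lemma integral_exp_minus_cube_complex:
  fixes \<zeta> :: complex
  assumes z: "sqrt 3 * \<bar>Im \<zeta>\<bar> < Re \<zeta>"
  shows "Re (\<zeta> ^ 3) > 0" "integral {0..} (\<lambda>x. exp (- ((\<zeta> * of_real x) ^ 3))) = of_real (Gamma (1 / 3)) / (3 * \<zeta>)"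
proof -
  define r where "r = Re \<zeta>"
  have "0 \<le> sqrt 3 * \<bar>Im \<zeta>\<bar>" by simp
  hence r: "r > 0" using z unfolding r_def by linarith
  hence \<zeta>0: "\<zeta> \<noteq> 0" by (auto simp: r_def)
  have sq: "3 * (Im \<zeta>)\<^sup>2 < r\<^sup>2"
  proof -
    have "(sqrt 3 * \<bar>Im \<zeta>\<bar>)\<^sup>2 < r\<^sup>2" using z unfolding r_def by (intro power_strict_mono) auto
    thus ?thesis by (simp add: power_mult_distrib)
  qed
  have cube: "Re (v ^ 3) = Re v * ((Re v)\<^sup>2 - 3 * (Im v)\<^sup>2)" for v :: complex
    by (simp add: power3_eq_cube power2_eq_square algebra_simps)
  define \<delta> where "\<delta> = Re (\<zeta> ^ 3)"
  show d: "Re (\<zeta> ^ 3) > 0" unfolding cube using r sq by (simp add: r_def)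
  hence \<delta>: "\<delta> > 0" by (simp add: \<delta>_def)
  obtain P :: "complex \<Rightarrow> complex" where P: "\<And>s. (P has_field_derivative exp (- (s ^ 3))) (at s)"
  proof -
    have h: "(\<lambda>s :: complex. exp (- (s ^ 3))) holomorphic_on UNIV" by (intro holomorphic_intros)
    show thesis
    proof (rule holomorphic_convex_primitive'[OF convex_UNIV open_UNIV h])
      fix g :: "complex \<Rightarrow> complex" assume "\<And>x :: complex. x \<in> UNIV \<Longrightarrow> (g has_field_derivative exp (- (x ^ 3))) (at x within UNIV)"
      thus thesis by (intro that[of g]) auto
    qed
  qed
  have ci: "contour_integral (linepath u v) (\<lambda>s. exp (- (s ^ 3))) = P v - P u" for u v
    using contour_integral_primitive[of UNIV P "\<lambda>s. exp (- (s ^ 3))" "linepath u v"] P by (auto simp: contour_integral_unique)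
  have 1: "\<zeta> * integral {0..real n} (\<lambda>x. exp (- ((\<zeta> * of_real x) ^ 3))) = P (\<zeta> * of_nat n) - P 0" for n
  proof -
    have "((\<lambda>x. exp (- ((\<zeta> * of_real x) ^ 3)) * \<zeta>) has_integral (P (\<zeta> * of_real (real n)) - P (\<zeta> * of_real 0))) {0..real n}"
    proof (rule fundamental_theorem_of_calculus)
      fix x :: real
      have "((\<lambda>w. P (\<zeta> * w)) has_field_derivative exp (- ((\<zeta> * of_real x) ^ 3)) * \<zeta>) (at (of_real x))"
        by (rule DERIV_chain2[OF P]) (auto intro!: derivative_eq_intros)
      thus "((\<lambda>x. P (\<zeta> * of_real x)) has_vector_derivative exp (- ((\<zeta> * of_real x) ^ 3)) * \<zeta>) (at x within {0..real n})"
        by (rule has_vector_derivative_at_within[OF has_vector_derivative_real_field])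
    qed simp
    from integral_unique[OF this] show ?thesis by (simp add: mult.commute)
  qed
  have 2: "of_real (integral {0..r * real n} (\<lambda>x. exp (- (x ^ 3)))) = P (of_real (r * real n)) - P 0" for n
  proof -
    have A: "((\<lambda>x. complex_of_real (exp (- (x ^ 3)))) has_integral (P (of_real (r * real n)) - P (of_real 0))) {0..r * real n}"
    proof (rule fundamental_theorem_of_calculus)
      fix x :: real
      have "complex_of_real (exp (- (x ^ 3))) = exp (- (of_real x ^ 3))" by (simp flip: exp_of_real)
      thus "((\<lambda>x. P (of_real x)) has_vector_derivative complex_of_real (exp (- (x ^ 3)))) (at x within {0..r * real n})"
        using has_vector_derivative_at_within[OF has_vector_derivative_real_field[OF P[of "of_real x"]]] by simp
    qed (use r in simp)
    have "(\<lambda>x. exp (- (x ^ 3))) integrable_on {0..r * real n}"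
      by (intro integrable_continuous_real continuous_intros)
    hence B: "((\<lambda>x. complex_of_real (exp (- (x ^ 3)))) has_integral of_real (integral {0..r * real n} (\<lambda>x. exp (- (x ^ 3))))) {0..r * real n}"
      by (intro has_integral_of_real integrable_integral)
    show ?thesis using has_integral_unique[OF B A] by simp
  qed
  have 3: "(\<lambda>n. P (\<zeta> * of_nat n) - P (of_real (r * real n))) \<longlonglongrightarrow> 0"
  proof (rule Lim_null_comparison)
    have "(\<lambda>n. exp (- (\<delta> * real n ^ 3)) * (real n * \<bar>Im \<zeta>\<bar>)) \<longlonglongrightarrow> 0" using \<delta> by real_asymp
    thus "(\<lambda>n. exp (- (\<delta> * real n ^ 3)) * (real n * \<bar>Im \<zeta>\<bar>)) \<longlonglongrightarrow> 0" .
    show "eventually (\<lambda>n. norm (P (\<zeta> * of_nat n) - P (of_real (r * real n))) \<le> exp (- (\<delta> * real n ^ 3)) * (real n * \<bar>Im \<zeta>\<bar>)) sequentially"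
    proof (intro always_eventually allI)
      fix n :: nat
      have "norm (contour_integral (linepath (of_real (r * real n)) (\<zeta> * of_nat n)) (\<lambda>s. exp (- (s ^ 3)))) \<le>
         exp (- (\<delta> * real n ^ 3)) * norm (\<zeta> * of_nat n - of_real (r * real n))"
      proof (rule contour_integral_bound_linepath)
        show "(\<lambda>s. exp (- (s ^ 3))) contour_integrable_on linepath (of_real (r * real n)) (\<zeta> * of_nat n)"
          by (intro contour_integrable_continuous_linepath continuous_intros)
        fix s assume "s \<in> closed_segment (of_real (r * real n)) (\<zeta> * of_nat n)"
        then obtain u where u: "0 \<le> u" "u \<le> 1" "s = (1 - u) *\<^sub>R of_real (r * real n) + u *\<^sub>R (\<zeta> * of_nat n)"
          by (auto simp: closed_segment_def)
        have Res: "Re s = r * real n" and Ims: "Im s = u * (Im \<zeta> * real n)"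
          unfolding u(3) by (simp_all add: r_def algebra_simps)
        \<comment> \<open>Along the segment Re s is fixed, so Re (s^3) is smallest where |Im s| is
          largest, at the end zeta n.\<close>
        have "u\<^sup>2 * (Im \<zeta>)\<^sup>2 \<le> 1 * (Im \<zeta>)\<^sup>2" by (rule mult_right_mono) (use u in \<open>auto simp: power_le_one\<close>)
        hence "r * (r\<^sup>2 - 3 * (Im \<zeta>)\<^sup>2) \<le> r * (r\<^sup>2 - 3 * (u\<^sup>2 * (Im \<zeta>)\<^sup>2))"
          using r by (intro mult_left_mono) auto
        hence "\<delta> \<le> r * (r\<^sup>2 - 3 * (u\<^sup>2 * (Im \<zeta>)\<^sup>2))" unfolding \<delta>_def cube r_def .
        hence "\<delta> * real n ^ 3 \<le> r * (r\<^sup>2 - 3 * (u\<^sup>2 * (Im \<zeta>)\<^sup>2)) * real n ^ 3"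
          by (rule mult_right_mono) simp
        also have "\<dots> = Re (s ^ 3)" unfolding cube Res Ims by (simp add: power2_eq_square power3_eq_cube algebra_simps)
        finally show "norm (exp (- (s ^ 3))) \<le> exp (- (\<delta> * real n ^ 3))" by simp
      qed simp
      moreover have "norm (\<zeta> * of_nat n - of_real (r * real n)) = real n * \<bar>Im \<zeta>\<bar>"
      proof -
        have "\<zeta> * of_nat n - of_real (r * real n) = \<i> * of_real (Im \<zeta> * real n)"
          by (rule complex_eqI) (auto simp: r_def)
        thus ?thesis by (simp add: norm_mult abs_mult del: of_real_mult)
      qed
      ultimately show "norm (P (\<zeta> * of_nat n) - P (of_real (r * real n))) \<le> exp (- (\<delta> * real n ^ 3)) * (real n * \<bar>Im \<zeta>\<bar>)"
        unfolding ci by simp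
    qed
  qed
  have "filterlim (\<lambda>n. r * real n) at_top sequentially"
    by (intro filterlim_tendsto_pos_mult_at_top[OF tendsto_const r] filterlim_real_sequentially)
  from tendsto_of_real[OF integral_exp_minus_cube_limit[OF this], where 'a = complex]
  have "(\<lambda>n. P (of_real (r * real n)) - P 0) \<longlonglongrightarrow> of_real (Gamma (1 / 3) / 3)" unfolding 2 .
  from tendsto_add[OF this 3] have "(\<lambda>n. P (\<zeta> * of_nat n) - P 0) \<longlonglongrightarrow> of_real (Gamma (1 / 3) / 3)" by simp
  hence A: "(\<lambda>n. \<zeta> * integral {0..real n} (\<lambda>x. exp (- ((\<zeta> * of_real x) ^ 3)))) \<longlonglongrightarrow> of_real (Gamma (1 / 3) / 3)" unfolding 1 .
  have "(\<lambda>n. integral {0..real n} (\<lambda>x. exp (- ((\<zeta> * of_real x) ^ 3)))) \<longlonglongrightarrow> integral {0..} (\<lambda>x. exp (- ((\<zeta> * of_real x) ^ 3)))"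
  proof (rule integral_atLeast_0_limit[OF _ \<delta>])
    show "continuous_on {0..} (\<lambda>x. exp (- ((\<zeta> * of_real x) ^ 3)))" by (intro continuous_intros)
    fix x :: real
    have "(\<zeta> * of_real x) ^ 3 = of_real (x ^ 3) * \<zeta> ^ 3" by (simp add: power_mult_distrib)
    hence "Re ((\<zeta> * of_real x) ^ 3) = x ^ 3 * \<delta>" unfolding \<delta>_def by (simp only: Re_of_real_times)
    thus "norm (exp (- ((\<zeta> * of_real x) ^ 3))) \<le> exp (- \<delta> * x ^ 3)" by (simp add: mult.commute)
  qed
  from tendsto_mult[OF tendsto_const[of \<zeta>] this]
  have "\<zeta> * integral {0..} (\<lambda>x. exp (- ((\<zeta> * of_real x) ^ 3))) = of_real (Gamma (1 / 3) / 3)"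
    using A LIMSEQ_unique by blast
  thus "integral {0..} (\<lambda>x. exp (- ((\<zeta> * of_real x) ^ 3))) = of_real (Gamma (1 / 3)) / (3 * \<zeta>)"
    using \<zeta>0 by (simp add: field_simps)
qed

text \<open>Both angles phi + pi/3 and phi - pi/3 lie within a right angle, so their cosines are
  positive.\<close>

lemma cube_cone:
  assumes "- (pi / 6) < \<phi>" "\<phi> < pi / 6"
  shows "sqrt 3 * \<bar>sin \<phi>\<bar> < cos \<phi>"
proof -
  have "cos (\<phi> + pi / 3) > 0" "cos (\<phi> - pi / 3) > 0" by (rule cos_gt_zero_pi; use assms in simp)+
  hence "cos \<phi> * (1 / 2) - sin \<phi> * (sqrt 3 / 2) > 0" "cos \<phi> * (1 / 2) + sin \<phi> * (sqrt 3 / 2) > 0"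
    unfolding cos_add cos_diff cos_60 sin_60 by auto
  thus ?thesis by (auto simp: abs_if algebra_simps)
qed

text \<open>Substitution x = y / N^(1/3) and dominated convergence. The lower bound l makes the
  rescaled intervals exhaust the half-line; shifting the index by \<open>N0\<close> makes the
  eventual hypotheses hold for every index.\<close>

lemma scaled_dominated_limit:
  fixes g :: "nat \<Rightarrow> real \<Rightarrow> complex" and L :: "nat \<Rightarrow> real"
  assumes cont: "eventually (\<lambda>N. continuous_on {0..L N} (g N)) sequentially"
    and L: "l > 0" "eventually (\<lambda>N. L N \<ge> l) sequentially"
    and c: "c > 0"
    and b: "eventually (\<lambda>N. \<forall>x\<in>{0..L N}. norm (g N x) \<le> C * exp (- c * (real N * x ^ 3))) sequentially"
    and lim: "\<And>y. y \<ge> 0 \<Longrightarrow> (\<lambda>N. g N (y / real N powr (1 / 3))) \<longlonglongrightarrow> G y"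
  shows "(\<lambda>N. of_real (real N powr (1 / 3)) * integral {0..L N} (g N)) \<longlonglongrightarrow> integral {0..} G"
proof -
  have "eventually (\<lambda>N. continuous_on {0..L N} (g N) \<and> L N \<ge> l \<and> (\<forall>x\<in>{0..L N}. norm (g N x) \<le> C * exp (- c * (real N * x ^ 3))) \<and> N > 0) sequentially"
    using cont L(2) b eventually_gt_at_top[of 0] by eventually_elim auto
  then obtain N0 where N0: "\<And>N. N \<ge> N0 \<Longrightarrow> continuous_on {0..L N} (g N)" "\<And>N. N \<ge> N0 \<Longrightarrow> L N \<ge> l"
    "\<And>N x. N \<ge> N0 \<Longrightarrow> x \<in> {0..L N} \<Longrightarrow> norm (g N x) \<le> C * exp (- c * (real N * x ^ 3))" "\<And>N. N \<ge> N0 \<Longrightarrow> N > 0"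
    unfolding eventually_sequentially by blast
  define a where "a N = real N powr (1 / 3)" for N
  have a: "a N > 0" "a N ^ 3 = real N" if "N \<ge> N0" for N
  proof -
    show "a N > 0" using N0(4)[OF that] by (simp add: a_def)
    have "a N ^ 3 = a N powr 3" using \<open>a N > 0\<close> by (simp add: powr_numeral)
    thus "a N ^ 3 = real N" using N0(4)[OF that] by (simp add: a_def powr_powr)
  qed
  define f where "f k y = (if y \<in> {0..a (k + N0) * L (k + N0)} then g (k + N0) (y / a (k + N0)) else 0)" for k y
  have C: "C \<ge> 0"
  proof -
    have "norm (g N0 0) \<le> C * exp (- c * (real N0 * 0 ^ 3))"
      by (rule N0(3)) (use N0(2)[of N0] L(1) in auto)
    hence "norm (g N0 0) \<le> C" by simp
    thus ?thesis by (rule order_trans[OF norm_ge_zero])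
  qed
  have int: "(f k has_integral (of_real (a (k + N0)) * integral {0..L (k + N0)} (g (k + N0)))) {0..}" for k
  proof -
    define N where "N = k + N0"
    have N: "N \<ge> N0" by (simp add: N_def)
    have "(g N has_integral integral {0..L N} (g N)) {0..L N}"
      using N0(1)[OF N] by (intro integrable_integral integrable_continuous_real)
    hence "((\<lambda>x. g N ((1 / a N) * x)) has_integral (1 / \<bar>1 / a N\<bar>) *\<^sub>R integral {0..L N} (g N)) ((\<lambda>x. x / (1 / a N)) ` {0..L N})"
      by (rule has_integral_stretch_real) (use a(1)[OF N] in simp)
    moreover have "(\<lambda>x. x / (1 / a N)) ` {0..L N} = {0..a N * L N}"
    proof -
      have "(\<lambda>x. x / (1 / a N)) ` {0..L N} = (*) (a N) ` {0..L N}" by (intro image_cong) (auto simp: mult.commute)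
      also have "\<dots> = {a N * 0..a N * L N}" by (rule image_mult_atLeastAtMost[OF a(1)[OF N]])
      finally show ?thesis by simp
    qed
    ultimately have "((\<lambda>x. g N (x / a N)) has_integral (of_real (a N) * integral {0..L N} (g N))) {0..a N * L N}"
      using a(1)[OF N] by (simp add: scaleR_conv_of_real)
    hence "((\<lambda>x. if x \<in> {0..a N * L N} then g N (x / a N) else 0) has_integral (of_real (a N) * integral {0..L N} (g N))) {0..}"
      by (subst has_integral_restrict) auto
    thus ?thesis unfolding f_def N_def .
  qed
  have "(\<lambda>k. integral {0..} (f k)) \<longlonglongrightarrow> integral {0..} G"
  proof (rule dominated_convergence(2)[OF _ integrable_exp_minus_cube[OF c, of C]])
    show "f k integrable_on {0..}" for k using int by (auto simp: integrable_on_def)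
  next
    fix k and y :: real assume y: "y \<in> {0..}"
    define N where "N = k + N0"
    have N: "N \<ge> N0" by (simp add: N_def)
    have "norm (f k y) \<le> C * exp (- c * y ^ 3)"
    proof (cases "y \<in> {0..a N * L N}")
      case True
      hence "y / a N \<in> {0..L N}" using a(1)[OF N] by (simp add: field_simps)
      hence "norm (g N (y / a N)) \<le> C * exp (- c * (real N * (y / a N) ^ 3))" by (rule N0(3)[OF N])
      also have "real N * (y / a N) ^ 3 = y ^ 3"
        using a[OF N] N0(4)[OF N] by (simp add: power_divide)
      finally show ?thesis using True by (simp add: f_def N_def)
    next
      case False
      hence "f k y = 0" unfolding f_def N_def by (rule if_not_P)
      thus ?thesis using C by simp
    qed
    also have "\<dots> \<le> C * (exp c * exp (- c * y))"
      by (intro mult_left_mono exp_minus_cube_le c C) (use y in simp)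
    finally show "norm (f k y) \<le> C * (exp c * exp (- c * y))" .
  next
    fix y :: real assume y: "y \<in> {0..}"
    have "filterlim (\<lambda>N. l * a N) at_top sequentially"
      unfolding a_def using L(1) by real_asymp
    hence "eventually (\<lambda>N. y \<le> l * a N) sequentially" by (simp add: filterlim_at_top)
    hence e: "eventually (\<lambda>k. y \<le> l * a (k + N0)) sequentially" by (rule sequentially_offset)
    have "(\<lambda>k. g (k + N0) (y / a (k + N0))) \<longlonglongrightarrow> G y"
      using LIMSEQ_ignore_initial_segment[OF lim, of y N0] y by (simp add: a_def)
    moreover have "eventually (\<lambda>k. g (k + N0) (y / a (k + N0)) = f k y) sequentially"
      using e
    proof eventually_elim
      case (elim k)
      have "l * a (k + N0) \<le> L (k + N0) * a (k + N0)"
        using N0(2)[of "k + N0"] a(1)[of "k + N0"] by (intro mult_right_mono) auto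
      hence "y \<le> a (k + N0) * L (k + N0)" using elim by (simp add: mult.commute)
      thus ?case using y by (simp add: f_def)
    qed
    ultimately show "(\<lambda>k. f k y) \<longlonglongrightarrow> G y" by (rule Lim_transform_eventually)
  qed
  hence "(\<lambda>k. of_real (a (k + N0)) * integral {0..L (k + N0)} (g (k + N0))) \<longlonglongrightarrow> integral {0..} G"
    using integral_unique[OF int] by simp
  thus ?thesis unfolding a_def by (rule LIMSEQ_offset)
qed

lemma scaled_cubic_limit:
  fixes f :: "real \<Rightarrow> real"
  assumes f: "((\<lambda>x. f x / x ^ 3) \<longlongrightarrow> l) (at_right 0)" "f 0 = 0" and y: "y \<ge> 0"
  shows "(\<lambda>N. real N * f (y / real N powr (1 / 3))) \<longlonglongrightarrow> l * y ^ 3"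
proof (cases "y = 0")
  case True
  thus ?thesis using f(2) by simp
next
  case False
  hence y0: "y > 0" using y by simp
  have "filterlim (\<lambda>N. y / real N powr (1 / 3)) (at_right 0) sequentially" using y0 by real_asymp
  from filterlim_compose[OF f(1) this]
  have "(\<lambda>N. f (y / real N powr (1 / 3)) / (y / real N powr (1 / 3)) ^ 3 * y ^ 3) \<longlonglongrightarrow> l * y ^ 3"
    by (intro tendsto_mult tendsto_const)
  moreover have "eventually (\<lambda>N. f (y / real N powr (1 / 3)) / (y / real N powr (1 / 3)) ^ 3 * y ^ 3 = real N * f (y / real N powr (1 / 3))) sequentially"
    using eventually_gt_at_top[of 0]
  proof eventually_elim
    case (elim N)
    have "(real N powr (1 / 3)) ^ 3 = (real N powr (1 / 3)) powr 3" using elim by (simp add: powr_numeral)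
    also have "\<dots> = real N" using elim by (simp add: powr_powr)
    finally have "(y / real N powr (1 / 3)) ^ 3 = y ^ 3 / real N" by (simp add: power_divide)
    thus ?case using y0 by simp
  qed
  ultimately show ?thesis by (rule Lim_transform_eventually)
qed

context fig8_kappa
begin

text \<open>
  The last condition makes \<open>exp (2 \<pi> \<i> (t - \<kappa>) / \<omega>)\<close> exponentially small, so that the theta factors tend to 1.
\<close>

definition edges :: "complex set" where
  "edges = {t. 0 \<le> Re t \<and> Re t \<le> \<kappa> / 2 \<and> - pi \<le> Im t \<and> Im t \<le> 0 \<and> 2 * pi * real p * (Re t - \<kappa>) - \<kappa> * Im t \<le> - (\<kappa> * pi)}"

text \<open>For p = 1 the last condition of \<open>edges\<close> becomes an equality at x = kappa/2,
  which is why the real edge is cut there.\<close>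

lemma of_real_in_edges:
  assumes "0 \<le> x" "x \<le> \<kappa> / 2" shows "of_real x \<in> edges"
proof -
  have p: "real p \<ge> 1" using p_pos by simp
  have "2 * pi * real p * (x - \<kappa>) \<le> 2 * pi * real p * (- (\<kappa> / 2))" by (intro mult_left_mono) (use assms in auto)
  also have "\<dots> = - (\<kappa> * pi * real p)" by simp
  also have "\<dots> \<le> - (\<kappa> * pi * 1)" by (intro le_imp_neg_le mult_left_mono p) (use kappa_pos in auto)
  finally have "2 * pi * real p * (x - \<kappa>) \<le> - (\<kappa> * pi)" by simp
  thus ?thesis using assms by (simp add: edges_def)
qed

lemma imaginary_in_edges:
  assumes "0 \<le> y" "y \<le> pi" shows "- (\<i> * of_real y) \<in> edges"
proof -
  have p: "real p \<ge> 1" using p_pos by simp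
  have "\<kappa> * pi * 2 * 1 \<le> \<kappa> * pi * 2 * real p" by (intro mult_left_mono p) (use kappa_pos in auto)
  hence "\<kappa> * pi * 2 \<le> \<kappa> * pi * 2 * real p" by (simp only: mult_1_right)
  moreover have "\<kappa> * y \<le> \<kappa> * pi" by (intro mult_left_mono) (use assms kappa_pos in auto)
  moreover have "2 * pi * real p * (0 - \<kappa>) - \<kappa> * (- y) = \<kappa> * y - \<kappa> * pi * 2 * real p" by (simp add: algebra_simps)
  ultimately have "2 * pi * real p * (0 - \<kappa>) - \<kappa> * (- y) \<le> - (\<kappa> * pi)" by linarith
  thus ?thesis using assms kappa_pos by (simp add: edges_def)
qed

lemma norm_exp_coord_edges:
  assumes "t \<in> edges" shows "norm (exp (2 * pi * \<i> * coord N t)) \<le> exp (- (dual_rate N / 2))"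
proof -
  have "2 * pi * real N / (norm \<xi>)\<^sup>2 * (2 * pi * real p * (Re t - \<kappa>) - \<kappa> * Im t) \<le> 2 * pi * real N / (norm \<xi>)\<^sup>2 * (- (\<kappa> * pi))"
    using assms by (intro mult_left_mono) (auto simp: edges_def)
  also have "\<dots> = - (dual_rate N / 2)" by (simp add: dual_rate_def power2_eq_square)
  finally show ?thesis unfolding norm_exp_coord by simp
qed

section \<open>Limits along the two edges at the corner\<close>

lemma theta_rest_tendsto_1:
  assumes "(\<lambda>N. norm (exp (2 * pi * \<i> * x N)) * exp (- dual_rate N)) \<longlonglongrightarrow> 0"
  shows "(\<lambda>N. theta_rest N (x N)) \<longlonglongrightarrow> 1"
proof -
  have "(\<lambda>N. \<Prod>n<p. 1 - exp (2 * pi * \<i> * x N - of_nat (Suc n) * (4 * (of_real pi)\<^sup>2 / mesh N))) \<longlonglongrightarrow> (\<Prod>n<p. 1 - 0)"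
  proof (intro tendsto_prod tendsto_diff tendsto_const)
    fix n
    show "(\<lambda>N. exp (2 * pi * \<i> * x N - of_nat (Suc n) * (4 * (of_real pi)\<^sup>2 / mesh N))) \<longlonglongrightarrow> 0"
      by (rule Lim_null_comparison[OF always_eventually[OF allI[OF norm_exp_theta_rest_le]] assms])
  qed
  thus ?thesis unfolding theta_rest_def by simp
qed

lemma exp_minus_dual_rate_tendsto: "(\<lambda>N. exp (- dual_rate N)) \<longlonglongrightarrow> 0"
proof -
  have "exp (- dual_rate N) = exp (- (dual_rate N / 2)) * exp (- (dual_rate N / 2))" for N unfolding exp_add[symmetric] by simp
  thus ?thesis using tendsto_mult[OF exp_dual_rate_tendsto exp_dual_rate_tendsto] by simp
qed

lemma theta_rest_0_tendsto: "(\<lambda>N. theta_rest N 0) \<longlonglongrightarrow> 1"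
  by (rule theta_rest_tendsto_1) (use exp_minus_dual_rate_tendsto in simp)

lemma norm_exp_shift_less_1:
  assumes "0 \<le> Re t" "Re t \<le> \<kappa> / 2"
  shows "norm (exp (t - of_real \<kappa>)) < 1" "norm (exp (- t - of_real \<kappa>)) < 1"
  using assms kappa_pos by auto

text \<open>Each |1 - w| is at most 2 and enters with a square root; the denominator is at least
  1/2.\<close>

lemma norm_amplitude_le:
  assumes "0 \<le> Re t" "Re t \<le> \<kappa> / 2" shows "norm (amplitude t) \<le> 4"
proof -
  have ln2: "Re (Ln (1 - w)) \<le> ln 2" if w: "norm w < 1" for w :: complex
  proof -
    have "1 - w \<noteq> 0" using w by auto
    moreover have "norm (1 - w) \<le> 2" using norm_triangle_ineq4[of 1 w] w by simp
    ultimately show ?thesis by simp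
  qed
  have "norm (exp ((Ln (1 - exp (t - of_real \<kappa>)) + Ln (1 - exp (- t - of_real \<kappa>))) / 2)) \<le> exp (ln 2)"
    using ln2[OF norm_exp_shift_less_1(1)[OF assms]] ln2[OF norm_exp_shift_less_1(2)[OF assms]] unfolding norm_exp_eq_Re exp_le_cancel_iff by simp
  moreover have "norm (1 - exp (- complex_of_real \<kappa>)) \<ge> 1 / 2"
  proof -
    have "1 - exp (- complex_of_real \<kappa>) = of_real (1 - exp (- \<kappa>))" by (simp add: exp_of_real flip: of_real_minus)
    hence "norm (1 - exp (- complex_of_real \<kappa>)) = \<bar>1 - exp (- \<kappa>)\<bar>" by (simp only: norm_of_real)
    moreover have "exp (- \<kappa>) \<le> 1 / 2" using exp_minus_kappa_le by (rule order_trans) simp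
    ultimately show ?thesis by linarith
  qed
  ultimately have "norm (amplitude t) \<le> exp (ln 2) / (1 / 2)" unfolding amplitude_def norm_divide by (intro frac_le) auto
  thus ?thesis by simp
qed

lemma isCont_amplitude: "isCont amplitude 0"
proof -
  have "1 - exp (- complex_of_real \<kappa>) = of_real (1 - exp (- \<kappa>))" by (simp add: exp_of_real flip: of_real_minus)
  hence "1 - exp (- complex_of_real \<kappa>) \<notin> \<real>\<^sub>\<le>\<^sub>0" using kappa_pos by (simp only: complex_nonpos_Reals_iff) simp
  thus ?thesis unfolding amplitude_def[abs_def] by (intro continuous_intros) (use one_minus_exp_minus_kappa_nonzero in auto)
qed

text \<open>The 16 is 4 from the amplitude divided by (1/2)(1/2) from the two parts of the
  denominator.\<close>

lemma Q_edges_bound: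
  "\<exists>C>0. eventually (\<lambda>N. \<forall>t\<in>edges. norm (Q N t) \<le> C * exp (real N * Psi t)) sequentially"
proof -
  obtain C where C: "C > 0" "\<And>N t. N > 0 \<Longrightarrow> 0 \<le> Re t \<Longrightarrow> Re t \<le> \<kappa> / 2 \<Longrightarrow>
      \<exists>E. norm E \<le> C / real N \<and> F N t = exp (of_nat N / \<xi> * V t + E) * amplitude t"
    using F_asymp_precise by metis
  have "eventually (\<lambda>N. exp (- (dual_rate N / 2)) < 1 / 2) sequentially"
    by (rule order_tendstoD(2)[OF exp_dual_rate_tendsto]) simp
  hence "eventually (\<lambda>N. \<forall>t\<in>edges. norm (Q N t) \<le> 16 * exp C * exp (real N * Psi t)) sequentially"
    using theta_rest_lower eventually_gt_at_top[of 0]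
  proof eventually_elim
    case (elim N)
    show ?case
    proof
      fix t assume t: "t \<in> edges"
      hence t': "0 \<le> Re t" "Re t \<le> \<kappa> / 2" "Re t \<le> \<kappa>" "- pi \<le> Im t" using kappa_pos by (auto simp: edges_def)
      obtain E where E: "norm E \<le> C / real N" "F N t = exp (of_nat N / \<xi> * V t + E) * amplitude t" using C(2)[OF elim(3) t'(1,2)] by blast
      have "C / real N \<le> C / 1" using C(1) elim(3) by (intro divide_left_mono) auto
      hence "Re E \<le> C" using E(1) complex_Re_le_cmod[of E] by simp
      moreover have "Re (of_nat N / \<xi> * V t) = real N * Psi t"
        unfolding Psi_def using Re_of_real_times[of "real N" "V t / \<xi>"] by simp
      ultimately have "norm (exp (of_nat N / \<xi> * V t + E)) \<le> exp (real N * Psi t + C)" by simp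
      hence "norm (F N t) \<le> exp (real N * Psi t + C) * 4" unfolding E(2) norm_mult
        by (intro mult_mono norm_amplitude_le t') auto
      moreover have "norm (theta_factors (mesh N) (Suc p) (coord N t)) \<ge> 1 / 2 * (1 / 2)"
      proof -
        have "norm (exp (2 * pi * \<i> * coord N t)) \<le> 1 / 2" using norm_exp_coord_edges[OF t, of N] elim(1) by linarith
        hence "norm (1 - exp (2 * pi * \<i> * coord N t)) \<ge> 1 / 2"
          using norm_triangle_ineq2[of 1 "exp (2 * pi * \<i> * coord N t)"] by (simp only: norm_one)
        moreover have "norm (theta_rest N (coord N t)) \<ge> 1 / 2" using elim(2) t' by blast
        ultimately show ?thesis unfolding theta_factors_eq_theta_rest norm_mult by (intro mult_mono) auto
      qed
      ultimately have "norm (Q N t) \<le> exp (real N * Psi t + C) * 4 / (1 / 2 * (1 / 2))"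
        unfolding Q_def norm_divide by (intro frac_le) auto
      thus "norm (Q N t) \<le> 16 * exp C * exp (real N * Psi t)" by (simp add: exp_add mult_ac)
    qed
  qed
  thus ?thesis by (intro exI[of _ "16 * exp C"]) simp
qed

lemma Q_edges_limit:
  assumes e: "eventually (\<lambda>N. t N \<in> edges) sequentially" and t0: "t \<longlonglongrightarrow> 0"
    and v: "(\<lambda>N. of_nat N / \<xi> * V (t N)) \<longlonglongrightarrow> v"
  shows "(\<lambda>N. Q N (t N)) \<longlonglongrightarrow> exp v"
proof -
  obtain C where C: "C > 0" "\<And>N t. N > 0 \<Longrightarrow> 0 \<le> Re t \<Longrightarrow> Re t \<le> \<kappa> / 2 \<Longrightarrow>
      \<exists>E. norm E \<le> C / real N \<and> F N t = exp (of_nat N / \<xi> * V t + E) * amplitude t"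
    using F_asymp_precise by metis
  define E where "E N = (SOME E. norm E \<le> C / real N \<and> F N (t N) = exp (of_nat N / \<xi> * V (t N) + E) * amplitude (t N))" for N
  have E: "eventually (\<lambda>N. norm (E N) \<le> C / real N \<and> F N (t N) = exp (of_nat N / \<xi> * V (t N) + E N) * amplitude (t N)) sequentially"
    using e eventually_gt_at_top[of 0]
  proof eventually_elim
    case (elim N)
    show ?case unfolding E_def by (rule someI_ex[OF C(2)]) (use elim in \<open>auto simp: edges_def\<close>)
  qed
  have "E \<longlonglongrightarrow> 0"
  proof (rule Lim_null_comparison)
    show "eventually (\<lambda>N. norm (E N) \<le> C / real N) sequentially" using E by eventually_elim auto
    show "(\<lambda>N. C / real N) \<longlonglongrightarrow> 0" by (rule lim_const_over_n)
  qed
  hence "(\<lambda>N. exp (of_nat N / \<xi> * V (t N) + E N) * amplitude (t N)) \<longlonglongrightarrow> exp (v + 0) * amplitude 0"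
    by (intro tendsto_intros v isCont_tendsto_compose[OF isCont_amplitude] t0)
  moreover have X: "(\<lambda>N. exp (2 * pi * \<i> * coord N (t N))) \<longlonglongrightarrow> 0"
    by (rule Lim_null_comparison[OF eventually_mono[OF e norm_exp_coord_edges] exp_dual_rate_tendsto])
  hence "(\<lambda>N. norm (exp (2 * pi * \<i> * coord N (t N))) * exp (- dual_rate N)) \<longlonglongrightarrow> 0 * 0"
    by (intro tendsto_mult tendsto_norm_zero exp_minus_dual_rate_tendsto)
  hence "(\<lambda>N. theta_rest N (coord N (t N))) \<longlonglongrightarrow> 1" by (intro theta_rest_tendsto_1) simp
  hence "(\<lambda>N. (1 - exp (2 * pi * \<i> * coord N (t N))) * theta_rest N (coord N (t N))) \<longlonglongrightarrow> (1 - 0) * 1"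
    by (intro tendsto_intros X)
  ultimately have "(\<lambda>N. exp (of_nat N / \<xi> * V (t N) + E N) * amplitude (t N) / ((1 - exp (2 * pi * \<i> * coord N (t N))) * theta_rest N (coord N (t N)))) \<longlonglongrightarrow> exp (v + 0) * amplitude 0 / ((1 - 0) * 1)"
    by (intro tendsto_divide) auto
  moreover have "eventually (\<lambda>N. exp (of_nat N / \<xi> * V (t N) + E N) * amplitude (t N) / ((1 - exp (2 * pi * \<i> * coord N (t N))) * theta_rest N (coord N (t N))) = Q N (t N)) sequentially"
    using E by eventually_elim (simp only: Q_def theta_factors_eq_theta_rest)
  ultimately have "(\<lambda>N. Q N (t N)) \<longlonglongrightarrow> exp (v + 0) * amplitude 0 / ((1 - 0) * 1)" by (rule Lim_transform_eventually)
  thus ?thesis unfolding amplitude_0 by simp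
qed

text \<open>At scale N^(-1/3), N V / xi tends to - y^3 / (3 xi), which fixes zeta^3. Since V is real
  here, domination uses only the weight kappa of Re V, whence \<open>c\<close>.\<close>

lemma real_edge_limit:
  assumes z: "sqrt 3 * \<bar>Im \<zeta>\<bar> < Re \<zeta>" "\<zeta> ^ 3 = 1 / (3 * \<xi>)"
  shows "(\<lambda>N. of_real (real N powr (1 / 3)) * integral {0..\<kappa> / 2} (\<lambda>x. Q N (of_real x))) \<longlonglongrightarrow> of_real (Gamma (1 / 3)) / (3 * \<zeta>)"
  unfolding integral_exp_minus_cube_complex(2)[OF z(1), symmetric]
proof -
  obtain C where C: "C > 0" "eventually (\<lambda>N. \<forall>t\<in>edges. norm (Q N t) \<le> C * exp (real N * Psi t)) sequentially"
    using Q_edges_bound by blast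
  define c where "c = \<kappa> / (3 * (norm \<xi>)\<^sup>2)"
  have c: "c > 0" using kappa_pos xi_nonzero by (simp add: c_def)
  show "(\<lambda>N. of_real (real N powr (1 / 3)) * integral {0..\<kappa> / 2} (\<lambda>x. Q N (of_real x))) \<longlonglongrightarrow> integral {0..} (\<lambda>x. exp (- ((\<zeta> * of_real x) ^ 3)))"
  proof (rule scaled_dominated_limit[OF _ _ _ c])
    show "eventually (\<lambda>N. continuous_on {0..\<kappa> / 2} (\<lambda>x. Q N (of_real x))) sequentially"
      using eventually_ge_at_top[of "50 * p"]
    proof eventually_elim
      case (elim N)
      note M = cut_index_height[OF elim]
      have "\<kappa> / (2 * real N) \<le> \<kappa> / 2" using kappa_pos M(1) by (simp add: field_simps)
      hence "of_real x \<in> cbox (Complex 0 (- cut_height N)) (Complex (\<kappa> - \<kappa> / (2 * real N)) 0) - box (Complex 0 (- cut_height N)) (Complex (\<kappa> - \<kappa> / (2 * real N)) 0)"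
        if "x \<in> {0..\<kappa> / 2}" for x using that M(3) by (auto simp: in_cbox_complex_iff in_box_complex_iff)
      thus ?case
        by (intro continuous_on_compose2[OF residue_sum(1)[OF elim], of _ complex_of_real] continuous_intros) auto
    qed
    show "\<kappa> / 2 > 0" using kappa_pos by simp
    show "eventually (\<lambda>N. \<forall>x\<in>{0..\<kappa> / 2}. norm (Q N (of_real x)) \<le> C * exp (- c * (real N * x ^ 3))) sequentially"
      using C(2)
    proof eventually_elim
      case (elim N)
      show ?case
      proof
        fix x assume x: "x \<in> {0..\<kappa> / 2}"
        have x': "0 \<le> x" "x \<le> \<kappa>" using x kappa_pos by auto
        have "Psi (of_real x) = \<kappa> * V_on_real x / (norm \<xi>)\<^sup>2" unfolding Psi_eq V_real_eq[OF x'] by simp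
        also have "\<dots> \<le> \<kappa> * (- (x ^ 3) / 3) / (norm \<xi>)\<^sup>2"
          by (intro divide_right_mono mult_left_mono) (use V_on_real_le[OF x'] kappa_pos in auto)
        also have "\<dots> = - c * x ^ 3" by (simp add: c_def)
        finally have "real N * Psi (of_real x) \<le> real N * (- c * x ^ 3)" by (intro mult_left_mono) auto
        hence "C * exp (real N * Psi (of_real x)) \<le> C * exp (- c * (real N * x ^ 3))" using C(1) by (simp add: mult.left_commute)
        thus "norm (Q N (of_real x)) \<le> C * exp (- c * (real N * x ^ 3))"
          using elim of_real_in_edges[of x] x by force
      qed
    qed
    fix y :: real assume y: "y \<ge> 0"
    define s where "s N = y / real N powr (1 / 3)" for N
    have s0: "s \<longlonglongrightarrow> 0" unfolding s_def by real_asymp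
    hence es: "eventually (\<lambda>N. s N < \<kappa> / 2) sequentially" by (rule order_tendstoD(2)) (use kappa_pos in simp)
    have sge: "s N \<ge> 0" for N using y by (simp add: s_def)
    have "(\<lambda>N. Q N (of_real (s N))) \<longlonglongrightarrow> exp (of_real (- 1 / 3 * y ^ 3) / \<xi>)"
    proof (rule Q_edges_limit)
      show "eventually (\<lambda>N. complex_of_real (s N) \<in> edges) sequentially"
        using es by eventually_elim (rule of_real_in_edges, use sge in auto)
      show "(\<lambda>N. complex_of_real (s N)) \<longlonglongrightarrow> 0" using tendsto_of_real[OF s0] by simp
      have "(\<lambda>N. of_real (real N * V_on_real (s N)) / \<xi>) \<longlonglongrightarrow> of_real (- 1 / 3 * y ^ 3) / \<xi>"
        unfolding s_def by (intro tendsto_divide tendsto_const tendsto_of_real scaled_cubic_limit[OF V_on_real_limit V_on_real_0 y] xi_nonzero)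
      moreover have "eventually (\<lambda>N. of_real (real N * V_on_real (s N)) / \<xi> = of_nat N / \<xi> * V (of_real (s N))) sequentially"
        using es by eventually_elim (use sge kappa_pos in \<open>simp add: V_real_eq\<close>)
      ultimately show "(\<lambda>N. of_nat N / \<xi> * V (of_real (s N))) \<longlonglongrightarrow> of_real (- 1 / 3 * y ^ 3) / \<xi>" by (rule Lim_transform_eventually)
    qed
    moreover have "of_real (- 1 / 3 * y ^ 3) / \<xi> = - ((\<zeta> * of_real y) ^ 3)" unfolding power_mult_distrib z(2) by simp
    ultimately show "(\<lambda>N. Q N (of_real (y / real N powr (1 / 3)))) \<longlonglongrightarrow> exp (- ((\<zeta> * of_real y) ^ 3))"
      unfolding s_def by simp
  qed auto
qed

text \<open>Since V (- i y) behaves like - i y^3 / 3, an extra i appears in zeta^3, and domination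
  now rests on the weight 2 pi p of Im V. The interval varies with N but always contains
  [0, 3].\<close>

lemma imaginary_edge_limit:
  assumes z: "sqrt 3 * \<bar>Im \<zeta>\<bar> < Re \<zeta>" "\<zeta> ^ 3 = \<i> / (3 * \<xi>)"
  shows "(\<lambda>N. of_real (real N powr (1 / 3)) * integral {0..cut_height N} (\<lambda>y. Q N (- (\<i> * of_real y)))) \<longlonglongrightarrow> of_real (Gamma (1 / 3)) / (3 * \<zeta>)"
  unfolding integral_exp_minus_cube_complex(2)[OF z(1), symmetric]
proof -
  obtain C where C: "C > 0" "eventually (\<lambda>N. \<forall>t\<in>edges. norm (Q N t) \<le> C * exp (real N * Psi t)) sequentially"
    using Q_edges_bound by blast
  define c where "c = 2 * pi * real p / (60 * (norm \<xi>)\<^sup>2)"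
  have c: "c > 0" using p_pos xi_nonzero by (simp add: c_def)
  show "(\<lambda>N. of_real (real N powr (1 / 3)) * integral {0..cut_height N} (\<lambda>y. Q N (- (\<i> * of_real y)))) \<longlonglongrightarrow> integral {0..} (\<lambda>x. exp (- ((\<zeta> * of_real x) ^ 3)))"
  proof (rule scaled_dominated_limit[OF _ _ _ c])
    show "eventually (\<lambda>N. continuous_on {0..cut_height N} (\<lambda>y. Q N (- (\<i> * of_real y)))) sequentially"
      using eventually_ge_at_top[of "50 * p"]
    proof eventually_elim
      case (elim N)
      note M = cut_index_height[OF elim]
      have "\<kappa> / (2 * real N) \<le> \<kappa>" using kappa_pos M(1) by (simp add: field_simps)
      hence "- (\<i> * of_real y) \<in> cbox (Complex 0 (- cut_height N)) (Complex (\<kappa> - \<kappa> / (2 * real N)) 0) - box (Complex 0 (- cut_height N)) (Complex (\<kappa> - \<kappa> / (2 * real N)) 0)"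
        if "y \<in> {0..cut_height N}" for y using that M(3) by (auto simp: in_cbox_complex_iff in_box_complex_iff)
      thus ?case
        by (intro continuous_on_compose2[OF residue_sum(1)[OF elim], of _ "\<lambda>y. - (\<i> * complex_of_real y)"] continuous_intros) auto
    qed
    show "(3 :: real) > 0" by simp
    show "eventually (\<lambda>N. 3 \<le> cut_height N) sequentially"
      using eventually_ge_at_top[of "50 * p"] by eventually_elim (rule cut_index_height(3))
    show "eventually (\<lambda>N. \<forall>y\<in>{0..cut_height N}. norm (Q N (- (\<i> * of_real y))) \<le> C * exp (- c * (real N * y ^ 3))) sequentially"
      using C(2) eventually_ge_at_top[of "50 * p"]
    proof eventually_elim
      case (elim N)
      show ?case
      proof
        fix y assume y: "y \<in> {0..cut_height N}"
        have y': "0 \<le> y" "y \<le> pi" using y cut_index_height(2)[OF elim(2)] by auto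
        have "Psi (- (\<i> * of_real y)) = 2 * pi * real p * (- V_on_imag y) / (norm \<xi>)\<^sup>2" unfolding Psi_eq V_imag_eq[OF y'(1)] by simp
        also have "\<dots> \<le> 2 * pi * real p * (- (y ^ 3 / 60)) / (norm \<xi>)\<^sup>2"
          by (intro divide_right_mono mult_left_mono) (use V_on_imag_ge[OF y'] in auto)
        also have "\<dots> = - c * y ^ 3" by (simp add: c_def)
        finally have "real N * Psi (- (\<i> * of_real y)) \<le> real N * (- c * y ^ 3)" by (intro mult_left_mono) auto
        hence "C * exp (real N * Psi (- (\<i> * of_real y))) \<le> C * exp (- c * (real N * y ^ 3))" using C(1) by (simp add: mult.left_commute)
        thus "norm (Q N (- (\<i> * of_real y))) \<le> C * exp (- c * (real N * y ^ 3))"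
          using elim(1) imaginary_in_edges[OF y'] by force
      qed
    qed
    fix y :: real assume y: "y \<ge> 0"
    define s where "s N = y / real N powr (1 / 3)" for N
    have s0: "s \<longlonglongrightarrow> 0" unfolding s_def by real_asymp
    hence es: "eventually (\<lambda>N. s N < pi) sequentially" by (rule order_tendstoD(2)) simp
    have sge: "s N \<ge> 0" for N using y by (simp add: s_def)
    have "(\<lambda>N. Q N (- (\<i> * of_real (s N)))) \<longlonglongrightarrow> exp (- \<i> * of_real (1 / 3 * y ^ 3) / \<xi>)"
    proof (rule Q_edges_limit)
      show "eventually (\<lambda>N. - (\<i> * complex_of_real (s N)) \<in> edges) sequentially"
        using es by eventually_elim (rule imaginary_in_edges, use sge in auto)
      show "(\<lambda>N. - (\<i> * complex_of_real (s N))) \<longlonglongrightarrow> 0"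
        using tendsto_minus[OF tendsto_mult[OF tendsto_const[of \<i>] tendsto_of_real[OF s0]]] by simp
      have "(\<lambda>N. - \<i> * of_real (real N * V_on_imag (s N)) / \<xi>) \<longlonglongrightarrow> - \<i> * of_real (1 / 3 * y ^ 3) / \<xi>"
        unfolding s_def by (intro tendsto_divide tendsto_mult tendsto_const tendsto_of_real scaled_cubic_limit[OF V_on_imag_limit V_on_imag_0 y] xi_nonzero)
      moreover have "- \<i> * of_real (real N * V_on_imag (s N)) / \<xi> = of_nat N / \<xi> * V (- (\<i> * of_real (s N)))" for N
        unfolding V_imag_eq[OF sge] by simp
      ultimately show "(\<lambda>N. of_nat N / \<xi> * V (- (\<i> * of_real (s N)))) \<longlonglongrightarrow> - \<i> * of_real (1 / 3 * y ^ 3) / \<xi>" by (simp only:)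
    qed
    moreover have "- \<i> * of_real (1 / 3 * y ^ 3) / \<xi> = - ((\<zeta> * of_real y) ^ 3)" unfolding power_mult_distrib z(2) by simp
    ultimately show "(\<lambda>N. Q N (- (\<i> * of_real (y / real N powr (1 / 3))))) \<longlonglongrightarrow> exp (- ((\<zeta> * of_real y) ^ 3))"
      unfolding s_def by simp
  qed
qed

section \<open>The cube root of xi and the final constant\<close>

definition \<xi>_root :: complex where
  "\<xi>_root = of_real (norm \<xi> powr (1 / 3)) * exp (\<i> * of_real (arctan (2 * real p * pi / \<kappa>) / 3))"

lemma xi_root_cube: "\<xi>_root ^ 3 = \<xi>"
proof -
  define x where "x = 2 * real p * pi / \<kappa>"
  have n: "norm \<xi> = \<kappa> * sqrt (1 + x\<^sup>2)"
  proof -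
    have "(norm \<xi>)\<^sup>2 = \<kappa>\<^sup>2 * (1 + x\<^sup>2)" using kappa_pos by (simp add: cmod_power2 x_def field_simps)
    hence "sqrt ((norm \<xi>)\<^sup>2) = sqrt (\<kappa>\<^sup>2) * sqrt (1 + x\<^sup>2)" by (simp only: real_sqrt_mult)
    thus ?thesis using kappa_pos by simp
  qed
  have s: "sqrt (1 + x\<^sup>2) > 0" by (simp add: add_pos_nonneg)
  have "(norm \<xi> powr (1 / 3)) ^ 3 = (norm \<xi> powr (1 / 3)) powr 3" using xi_nonzero by (simp add: powr_numeral)
  hence r3: "(norm \<xi> powr (1 / 3)) ^ 3 = norm \<xi>" using xi_nonzero by (simp add: powr_powr)
  have "exp (\<i> * complex_of_real (arctan x / 3)) ^ 3 = exp (of_nat 3 * (\<i> * complex_of_real (arctan x / 3)))" by (rule exp_of_nat_mult[symmetric])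
  also have "\<dots> = cis (arctan x)" by (simp add: cis_conv_exp)
  finally have e3: "exp (\<i> * complex_of_real (arctan x / 3)) ^ 3 = cis (arctan x)" .
  have "\<xi>_root ^ 3 = of_real (norm \<xi>) * cis (arctan x)"
    unfolding \<xi>_root_def x_def[symmetric] power_mult_distrib e3 of_real_power[symmetric] r3 ..
  also have "\<dots> = \<xi>"
  proof (rule complex_eqI)
    show "Re (of_real (norm \<xi>) * cis (arctan x)) = Re \<xi>" using s by (simp add: n cos_arctan)
    show "Im (of_real (norm \<xi>) * cis (arctan x)) = Im \<xi>" using s kappa_pos by (simp add: n sin_arctan x_def)
  qed
  finally show ?thesis .
qed

lemma cone_exp:
  assumes "r > 0" "- (pi / 6) < \<phi>" "\<phi> < pi / 6"
  shows "sqrt 3 * \<bar>Im (of_real r * exp (\<i> * of_real \<phi>))\<bar> < Re (of_real r * exp (\<i> * of_real \<phi>))"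
proof -
  have "r * (sqrt 3 * \<bar>sin \<phi>\<bar>) < r * cos \<phi>" by (intro mult_strict_left_mono cube_cone assms)
  thus ?thesis using assms(1) by (simp add: Re_exp Im_exp abs_mult algebra_simps)
qed

text \<open>The argument 3 theta of xi lies in (0, pi/2), so the roots with arguments - theta and
  pi/6 - theta both lie in the cone of \<open>cone_exp\<close>; this singles out the correct
  branches of the two cube roots.\<close>

lemma sum_F_asymp:
  "(\<lambda>N. (\<Sum>j=1..N. F N (of_real \<kappa> - of_nat j * mesh N)) / of_real (real N powr (2 / 3))) \<longlonglongrightarrow>
     of_real (Gamma (1 / 3)) * exp (pi * \<i> / 6) / of_real (3 powr (1 / 6)) / \<xi>_root\<^sup>2"
proof -
  define \<theta> where "\<theta> = arctan (2 * real p * pi / \<kappa>) / 3"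
  define r where "r = 1 / (3 powr (1 / 3) * norm \<xi> powr (1 / 3))"
  define z1 where "z1 = of_real r * exp (\<i> * of_real (- \<theta>))"
  define z2 where "z2 = of_real r * exp (\<i> * of_real (pi / 6 - \<theta>))"
  define k where "k = complex_of_real (3 powr (1 / 3))"
  have th: "0 < \<theta>" "\<theta> < pi / 6"
    using arctan_bounded[of "2 * real p * pi / \<kappa>"] p_pos kappa_pos by (auto simp: \<theta>_def)
  have r: "r > 0" using xi_nonzero by (simp add: r_def)
  have c1: "sqrt 3 * \<bar>Im z1\<bar> < Re z1" unfolding z1_def by (rule cone_exp[OF r]) (use th in auto)
  have c2: "sqrt 3 * \<bar>Im z2\<bar> < Re z2" unfolding z2_def by (rule cone_exp[OF r]) (use th in auto)
  have k0: "k \<noteq> 0" by (simp add: k_def)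
  have root0: "\<xi>_root \<noteq> 0" using xi_root_cube xi_nonzero by auto
  have k3: "k ^ 3 = 3"
  proof -
    have "(3 powr (1 / 3) :: real) ^ 3 = (3 powr (1 / 3)) powr 3" by (simp add: powr_numeral)
    hence "(3 powr (1 / 3) :: real) ^ 3 = 3" by (simp add: powr_powr)
    thus ?thesis unfolding k_def of_real_power[symmetric] by simp
  qed
  have z1: "z1 = 1 / (k * \<xi>_root)"
  proof -
    have "exp (\<i> * complex_of_real (- \<theta>)) = inverse (exp (\<i> * complex_of_real \<theta>))" by (simp add: exp_minus)
    thus ?thesis unfolding z1_def \<xi>_root_def \<theta>_def[symmetric] k_def r_def
      by (simp only: of_real_divide of_real_1 of_real_mult of_real_inverse divide_inverse inverse_mult_distrib mult_ac mult_1_left)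
  qed
  have z2: "z2 = exp (\<i> * of_real (pi / 6)) / (k * \<xi>_root)"
  proof -
    have "\<i> * complex_of_real (pi / 6 - \<theta>) = \<i> * of_real (pi / 6) + \<i> * of_real (- \<theta>)" by (simp add: algebra_simps)
    hence "z2 = exp (\<i> * of_real (pi / 6)) * z1" unfolding z2_def z1_def by (simp only: exp_add mult.left_commute)
    thus ?thesis unfolding z1 by simp
  qed
  define e where "e = exp (\<i> * complex_of_real (pi / 6))"
  have e: "e = of_real (sqrt 3 / 2) + \<i> / 2"
    by (rule complex_eqI) (simp_all add: e_def Re_exp Im_exp cos_30 sin_30)
  have ee: "e * e = 1 / 2 + \<i> * of_real (sqrt 3 / 2)" "e * e * e = \<i>"
  proof -
    have s3: "complex_of_real (sqrt 3) * complex_of_real (sqrt 3) = 3" by (simp flip: of_real_mult)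
    have "e * e = exp (\<i> * of_real (pi / 3))" unfolding e_def exp_add[symmetric] by (simp add: algebra_simps)
    also have "\<dots> = 1 / 2 + \<i> * of_real (sqrt 3 / 2)"
      by (rule complex_eqI) (simp_all add: Re_exp Im_exp cos_60 sin_60)
    finally show A: "e * e = 1 / 2 + \<i> * of_real (sqrt 3 / 2)" .
    show "e * e * e = \<i>" unfolding A unfolding e using s3 by (simp add: algebra_simps)
  qed
  have e0: "e \<noteq> 0" by (simp add: e_def)
  have z1c: "z1 ^ 3 = 1 / (3 * \<xi>)" unfolding z1 by (simp add: power_divide power_mult_distrib k3 xi_root_cube)
  have z2c: "z2 ^ 3 = \<i> / (3 * \<xi>)" unfolding z2 e_def[symmetric]
    by (simp add: power_divide power_mult_distrib k3 xi_root_cube) (simp add: power3_eq_cube ee(2))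
  define S where "S N = (\<Sum>j=1..N. F N (of_real \<kappa> - of_nat j * mesh N))" for N
  define I where "I N = integral {0..\<kappa> / 2} (\<lambda>x. Q N (of_real x)) + \<i> * integral {0..cut_height N} (\<lambda>y. Q N (- (\<i> * of_real y)))" for N
  have "(\<lambda>N. theta_rest N 0 / \<xi> * (of_real (real N powr (1 / 3)) * integral {0..\<kappa> / 2} (\<lambda>x. Q N (of_real x))
      + \<i> * (of_real (real N powr (1 / 3)) * integral {0..cut_height N} (\<lambda>y. Q N (- (\<i> * of_real y)))))
      + (S N - theta_rest N 0 / mesh N * I N) * of_real (real N powr (- 2 / 3))) \<longlonglongrightarrow>
    1 / \<xi> * (of_real (Gamma (1 / 3)) / (3 * z1) + \<i> * (of_real (Gamma (1 / 3)) / (3 * z2))) + 0 * of_real 0"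
    unfolding S_def I_def
    by (intro tendsto_intros theta_rest_0_tendsto real_edge_limit[OF c1 z1c] imaginary_edge_limit[OF c2 z2c] main_decomp xi_nonzero) real_asymp
  moreover have "eventually (\<lambda>N. theta_rest N 0 / \<xi> * (of_real (real N powr (1 / 3)) * integral {0..\<kappa> / 2} (\<lambda>x. Q N (of_real x))
      + \<i> * (of_real (real N powr (1 / 3)) * integral {0..cut_height N} (\<lambda>y. Q N (- (\<i> * of_real y)))))
      + (S N - theta_rest N 0 / mesh N * I N) * of_real (real N powr (- 2 / 3)) = S N / of_real (real N powr (2 / 3))) sequentially"
    using eventually_gt_at_top[of 0]
  proof eventually_elim
    case (elim N)
    \<comment> \<open>One factor N belongs to 1/omega = N/xi, so dividing the sum by N^(2/3) leaves
      the scaling N^(1/3) of the edge limits.\<close>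
    have "real N powr (1 / 3) = real N * real N powr (- 2 / 3)"
      using elim powr_add[of "real N" 1 "- 2 / 3"] by simp
    hence a: "complex_of_real (real N powr (1 / 3)) = of_nat N * of_real (real N powr (- 2 / 3))"
      by (simp only: of_real_mult of_real_of_nat_eq)
    have b: "complex_of_real (real N powr (- 2 / 3)) = 1 / of_real (real N powr (2 / 3))"
      using powr_minus_divide[of "real N" "2 / 3"] by simp
    have "d / x * (n * q * u + \<i> * (n * q * v)) + (s - d / (x / n) * (u + \<i> * v)) * q = s * q" for d x n q u v s :: complex
      by (simp add: algebra_simps add_divide_distrib)
    hence "theta_rest N 0 / \<xi> * (of_real (real N powr (1 / 3)) * integral {0..\<kappa> / 2} (\<lambda>x. Q N (of_real x))
        + \<i> * (of_real (real N powr (1 / 3)) * integral {0..cut_height N} (\<lambda>y. Q N (- (\<i> * of_real y)))))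
        + (S N - theta_rest N 0 / mesh N * I N) * of_real (real N powr (- 2 / 3)) = S N * of_real (real N powr (- 2 / 3))"
      unfolding a I_def mesh_def .
    thus ?case unfolding b by simp
  qed
  ultimately have "(\<lambda>N. S N / of_real (real N powr (2 / 3))) \<longlonglongrightarrow>
      1 / \<xi> * (of_real (Gamma (1 / 3)) / (3 * z1) + \<i> * (of_real (Gamma (1 / 3)) / (3 * z2))) + 0 * of_real 0"
    by (rule Lim_transform_eventually)
  moreover have "1 / \<xi> * (of_real (Gamma (1 / 3)) / (3 * z1) + \<i> * (of_real (Gamma (1 / 3)) / (3 * z2))) + 0 * of_real 0
     = of_real (Gamma (1 / 3)) * e / of_real (3 powr (1 / 6)) / \<xi>_root\<^sup>2"
  proof -
    define g where "g = complex_of_real (Gamma (1 / 3))"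
    have ie: "\<i> / e = e * e" using ee(2) e0 by (simp add: field_simps)
    have "1 / \<xi> * (g / (3 * z1) + \<i> * (g / (3 * z2))) = g * k / 3 * \<xi>_root / \<xi> * (1 + \<i> / e)"
      unfolding z1 z2 e_def[symmetric] using k0 root0 e0 by (simp add: field_simps)
    \<comment> \<open>As e^3 = i, the left side is 1 + e^2: two unit vectors at an angle of pi/3,
      whose sum has length sqrt 3 and the direction of their bisector e.\<close>
    also have "1 + \<i> / e = of_real (sqrt 3) * e"
    proof -
      have s3: "complex_of_real (sqrt 3) * complex_of_real (sqrt 3) = 3" by (simp flip: of_real_mult)
      show ?thesis unfolding ie unfolding ee(1) unfolding e using s3 by (simp add: algebra_simps)
    qed
    also have "g * k / 3 * \<xi>_root / \<xi> * (of_real (sqrt 3) * e) = g * e * (k / 3 * of_real (sqrt 3)) * (1 / \<xi>_root\<^sup>2)"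
    proof -
      have "\<xi>_root * \<xi>_root\<^sup>2 = \<xi>" using xi_root_cube by (simp only: power3_eq_cube power2_eq_square mult.assoc)
      thus ?thesis using root0 xi_nonzero by (auto simp: field_simps)
    qed
    also have "k / 3 * of_real (sqrt 3) = 1 / complex_of_real (3 powr (1 / 6))"
    proof -
      have "3 powr (1 / 2) = sqrt (3 :: real)" "3 powr (- 1) = (1 / 3 :: real)"
        by (simp_all add: powr_half_sqrt powr_minus_divide)
      hence "3 powr (1 / 3) / 3 * sqrt 3 = (3 powr (1 / 3) * 3 powr (- 1) * 3 powr (1 / 2) :: real)" by simp
      also have "\<dots> = 3 powr (- (1 / 6))" unfolding powr_add[symmetric] by simp
      also have "\<dots> = 1 / 3 powr (1 / 6)" by (rule powr_minus_divide)
      finally have "complex_of_real (3 powr (1 / 3) / 3 * sqrt 3) = of_real (1 / 3 powr (1 / 6))" by (simp only:)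
      thus ?thesis unfolding k_def by simp
    qed
    finally show ?thesis unfolding g_def by simp
  qed
  moreover have "e = exp (pi * \<i> / 6)" unfolding e_def by (simp add: mult.commute)
  ultimately show ?thesis unfolding S_def by simp
qed

text \<open>The prefactor exp (2 pi i p kappa N / xi) of \<open>jones_eq_sum_F\<close> is the
  denominator in \<open>jones_dual_asymp\<close>, so it drops out of the quotient.\<close>

lemma jones_asymp:
  "(\<lambda>N::nat. jones_fig8 N (exp (\<xi> / of_nat N)) /
            (jones_fig8 p (exp (4 * pi\<^sup>2 * of_nat N / \<xi>)) *
             (complex_of_real (Gamma (1/3 :: real)) * exp (pi * \<i> / 6) / complex_of_real (3 powr (1/6))) *
             (complex_of_real (real N powr (2/3)) / \<xi>_root\<^sup>2) *
             exp (2 * complex_of_real \<kappa> * pi * \<i> / \<xi> * of_nat N)))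
         \<longlonglongrightarrow> 1"
proof -
  define S where "S N = (\<Sum>j=1..N. F N (of_real \<kappa> - of_nat j * mesh N))" for N
  define A where "A = complex_of_real (Gamma (1/3)) * exp (pi * \<i> / 6) / complex_of_real (3 powr (1/6))"
  define B where "B N = jones_fig8 p (exp (4 * pi\<^sup>2 * of_nat N / \<xi>)) * exp (2 * of_real \<kappa> * pi * \<i> / \<xi> * of_nat N)
     / exp (2 * pi * \<i> * of_nat p * \<kappa> * of_nat N / \<xi>)" for N
  have "Gamma (1 / 3 :: real) > 0" by (rule Gamma_real_pos) simp
  hence "Gamma (1 / 3 :: real) \<noteq> 0" by linarith
  hence A0: "A \<noteq> 0" unfolding A_def mult_eq_0_iff divide_eq_0_iff of_real_eq_0_iff by (metis exp_not_eq_zero powr_eq_0_iff zero_neq_numeral)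
  have root0: "\<xi>_root \<noteq> 0" using xi_root_cube xi_nonzero by auto
  have "(\<lambda>N. S N / of_real (real N powr (2 / 3)) / (A / \<xi>_root\<^sup>2) * inverse (B N)) \<longlonglongrightarrow> A / \<xi>_root\<^sup>2 / (A / \<xi>_root\<^sup>2) * inverse 1"
    unfolding S_def
    by (intro tendsto_mult tendsto_divide tendsto_inverse tendsto_const sum_F_asymp[folded A_def] jones_dual_asymp[folded B_def]) (use A0 root0 in auto)
  moreover have "A / \<xi>_root\<^sup>2 / (A / \<xi>_root\<^sup>2) * inverse 1 = 1" using A0 root0 by simp
  moreover have "eventually (\<lambda>N. S N / of_real (real N powr (2 / 3)) / (A / \<xi>_root\<^sup>2) * inverse (B N) =
      jones_fig8 N (exp (\<xi> / of_nat N)) / (jones_fig8 p (exp (4 * pi\<^sup>2 * of_nat N / \<xi>)) * A *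
             (complex_of_real (real N powr (2/3)) / \<xi>_root\<^sup>2) * exp (2 * complex_of_real \<kappa> * pi * \<i> / \<xi> * of_nat N))) sequentially"
    using eventually_gt_at_top[of 0]
  proof eventually_elim
    case (elim N)
    show ?case unfolding jones_eq_sum_F[OF elim] S_def[symmetric] B_def
      by (simp only: divide_inverse inverse_mult_distrib inverse_inverse_eq of_real_mult of_real_numeral of_real_eq_id id_apply mult_ac)
  qed
  ultimately show ?thesis unfolding A_def[symmetric] using Lim_transform_eventually by fastforce
qed

end

theorem theorem1p8:
  fixes p :: nat and \<kappa> :: real and \<xi> S \<xi>13 :: complex
  assumes "p > 0"
  defines "\<kappa> \<equiv> arcosh (3/2 :: real)"
  defines "\<xi> \<equiv> complex_of_real \<kappa> + 2 * of_nat p * pi * \<i>"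
  defines "S \<equiv> 2 * complex_of_real \<kappa> * pi * \<i>"
  defines "\<xi>13 \<equiv> complex_of_real (norm \<xi> powr (1/3)) * exp (\<i> * complex_of_real (arctan (2 * real p * pi / \<kappa>) / 3))"
  shows "(\<lambda>N::nat. jones_fig8 N (exp (\<xi> / of_nat N)) /
            (jones_fig8 p (exp (4 * pi\<^sup>2 * of_nat N / \<xi>)) *
             (complex_of_real (Gamma (1/3 :: real)) * exp (pi * \<i> / 6) / complex_of_real (3 powr (1/6))) *
             (complex_of_real (real N powr (2/3)) / \<xi>13\<^sup>2) *
             exp (S / \<xi> * of_nat N)))
         \<longlonglongrightarrow> 1"
proof -
  interpret fig8_kappa p \<kappa> \<xi>
    by unfold_locales (use assms in auto)
  show ?thesis using jones_asymp unfolding \<xi>_root_def S_def \<xi>13_def .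
qed

end
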